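(* Let $d\in\mathbb N$ and let $p,r$ be real numbers with $1<p\le r$. Then for any $\varphi\in L^p(\mathbb R^d,\mu)$ and any $\psi\in L^\infty(\mathbb R^d,\mu)$, the product $\Gamma\big(\sqrt{p-1}/\sqrt{r-1}\big)\varphi\diamond\Gamma\big(\sqrt{r-p}/\sqrt{r-1}\big)\psi$ belongs to $L^r(\mathbb R^d,\mu)$ and $$\Big\|\Big[\Gamma\Big(\tfrac{\sqrt{p-1}}{\sqrt{r-1}}\Big)\varphi\Big]\diamond\Big[\Gamma\Big(\tfrac{\sqrt{r-p}}{\sqrt{r-1}}\Big)\psi\Big]\Big\|_r\le\|\varphi\|_p\,\|\psi\|_\infty.$$ In particular (taking $\psi\equiv1$), $\big\|\Gamma\big(\sqrt{p-1}/\sqrt{r-1}\big)\varphi\big\|_r\le\|\varphi\|_p$.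
   Context: $\mu$ is the standard Gaussian probability measure on $\mathbb R^d$ and $\|\cdot\|_p$ the norm of $L^p(\mathbb R^d,\mu)$. Gaussian chaos setting: $L^2(\mathbb R^d,\mu)=\bigoplus_n G_n$ with $G_0=\mathbb C$, $G_n=\overline{F_n}\ominus\overline{F_{n-1}}$, $F_n$ the polynomials of degree $\le n$ in the coordinates, $P_n$ the projection onto $G_n$. Wick product: $\varphi\diamond\psi=P_{m+n}(\varphi\psi)$ for $\varphi\in G_m,\psi\in G_n$, extended bilinearly. Second quantization $\Gamma(c)\sum f_n=\sum c^nf_n$, which for real $|c|\le 1$ extends to a norm-one operator on each $L^p(\mu)$. With $u=(r-1)/(p-1)$, $v=(r-1)/(r-p)$ one has $1/u+1/v=1$, and the map $(\varphi,\psi)\mapsto\Gamma(1/\sqrt u)\varphi\diamond\Gamma(1/\sqrt v)\psi$ extends uniquely continuously from $L^2\times L^2$ to $L^1\times L^1\to L^1$; the expression in the claim denotes this extension. *)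

theory Defs
  imports "HOL-Analysis.Analysis" "HOL-Probability.Essential_Supremum"
begin

definition gauss :: "(real^'n) measure" where
  "gauss = density lborel
     (\<lambda>x. ennreal ((2 * pi) powr (- real CARD('n) / 2) * exp (- ((norm x)\<^sup>2) / 2)))"

definition Lp_space :: "real \<Rightarrow> (real^'n \<Rightarrow> complex) set" where
  "Lp_space p = {f. f \<in> borel_measurable gauss \<and> integrable gauss (\<lambda>x. cmod (f x) powr p)}"

definition Lp_norm :: "real \<Rightarrow> (real^'n \<Rightarrow> complex) \<Rightarrow> real" where
  "Lp_norm p f = (\<integral>x. cmod (f x) powr p \<partial>gauss) powr (1 / p)"

definition Linf_space :: "(real^'n \<Rightarrow> complex) set" where
  "Linf_space = {f. f \<in> borel_measurable gauss \<and> esssup gauss (\<lambda>x. ereal (cmod (f x))) < \<infinity>}"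

definition Linf_norm :: "(real^'n \<Rightarrow> complex) \<Rightarrow> real" where
  "Linf_norm f = real_of_ereal (esssup gauss (\<lambda>x. ereal (cmod (f x))))"

definition gip :: "(real^'n \<Rightarrow> complex) \<Rightarrow> (real^'n \<Rightarrow> complex) \<Rightarrow> complex" where
  "gip f g = (\<integral>x. f x * cnj (g x) \<partial>gauss)"

definition poly_fun :: "nat \<Rightarrow> (real^'n \<Rightarrow> complex) \<Rightarrow> bool" where
  "poly_fun n f \<longleftrightarrow> (\<exists>c :: ('n \<Rightarrow> nat) \<Rightarrow> complex.
     \<forall>x. f x = (\<Sum>\<alpha>\<in>{\<alpha>. sum \<alpha> UNIV \<le> n}. c \<alpha> * (\<Prod>i\<in>UNIV. (complex_of_real (x $ i)) ^ (\<alpha> i))))"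

definition is_poly :: "(real^'n \<Rightarrow> complex) \<Rightarrow> bool" where
  "is_poly f \<longleftrightarrow> (\<exists>n. poly_fun n f)"

definition pdeg :: "(real^'n \<Rightarrow> complex) \<Rightarrow> nat" where
  "pdeg f = (LEAST n. poly_fun n f)"

text \<open>G_n = F_n minus F_(n-1) in L^2(gauss); F_n is finite dimensional hence closed.\<close>
definition chaos :: "nat \<Rightarrow> (real^'n \<Rightarrow> complex) set" where
  "chaos n = (if n = 0 then {f. poly_fun 0 f}
     else {f. poly_fun n f \<and> (\<forall>h. poly_fun (n - 1) h \<longrightarrow> gip f h = 0)})"

definition chaos_proj :: "nat \<Rightarrow> (real^'n \<Rightarrow> complex) \<Rightarrow> (real^'n \<Rightarrow> complex)" where
  "chaos_proj n f = (THE g. g \<in> chaos n \<and> (\<forall>h\<in>chaos n. gip (\<lambda>x. f x - g x) h = 0))"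

definition sq_poly :: "real \<Rightarrow> (real^'n \<Rightarrow> complex) \<Rightarrow> (real^'n \<Rightarrow> complex)" where
  "sq_poly c f = (\<lambda>x. \<Sum>n\<le>pdeg f. complex_of_real c ^ n * chaos_proj n f x)"

definition wick :: "(real^'n \<Rightarrow> complex) \<Rightarrow> (real^'n \<Rightarrow> complex) \<Rightarrow> (real^'n \<Rightarrow> complex)" where
  "wick a b = (\<lambda>x. \<Sum>m\<le>pdeg a. \<Sum>n\<le>pdeg b.
      chaos_proj (m + n) (\<lambda>y. chaos_proj m a y * chaos_proj n b y) x)"

section \<open>Extension by L^1-continuity from the dense set of polynomials\<close>

definition L1_conv :: "(nat \<Rightarrow> real^'n \<Rightarrow> complex) \<Rightarrow> (real^'n \<Rightarrow> complex) \<Rightarrow> bool" where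
  "L1_conv fs f \<longleftrightarrow> ((\<lambda>k. \<integral>\<^sup>+x. ennreal (cmod (fs k x - f x)) \<partial>gauss) \<longlonglongrightarrow> 0)"

definition ext1 :: "((real^'n \<Rightarrow> complex) \<Rightarrow> (real^'n \<Rightarrow> complex))
    \<Rightarrow> (real^'n \<Rightarrow> complex) \<Rightarrow> (real^'n \<Rightarrow> complex)" where
  "ext1 T \<phi> = (SOME g. g \<in> Lp_space 1 \<and>
     (\<forall>as. (\<forall>k. is_poly (as k)) \<and> L1_conv as \<phi> \<longrightarrow> L1_conv (\<lambda>k. T (as k)) g))"

definition ext2 :: "((real^'n \<Rightarrow> complex) \<Rightarrow> (real^'n \<Rightarrow> complex) \<Rightarrow> (real^'n \<Rightarrow> complex))
    \<Rightarrow> (real^'n \<Rightarrow> complex) \<Rightarrow> (real^'n \<Rightarrow> complex) \<Rightarrow> (real^'n \<Rightarrow> complex)" where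
  "ext2 B \<phi> \<psi> = (SOME g. g \<in> Lp_space 1 \<and>
     (\<forall>as bs. (\<forall>k. is_poly (as k) \<and> is_poly (bs k)) \<and> L1_conv as \<phi> \<and> L1_conv bs \<psi>
        \<longrightarrow> L1_conv (\<lambda>k. B (as k) (bs k)) g))"

text \<open>Gamma(c) on L^p (c real, |c| \<le> 1), and (phi,psi) \<mapsto> Gamma(a) phi \<diamond> Gamma(b) psi on L^1 x L^1.\<close>
definition sq :: "real \<Rightarrow> (real^'n \<Rightarrow> complex) \<Rightarrow> (real^'n \<Rightarrow> complex)" where
  "sq c = ext1 (sq_poly c)"

definition wick_sq :: "real \<Rightarrow> real \<Rightarrow> (real^'n \<Rightarrow> complex) \<Rightarrow> (real^'n \<Rightarrow> complex) \<Rightarrow> (real^'n \<Rightarrow> complex)" where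
  "wick_sq a b = ext2 (\<lambda>f g. wick (sq_poly a f) (sq_poly b g))"

end

theory Submission
  imports Defs "HOL-Probability.Probability"
begin

text \<open>For polynomials and \<open>a\<^sup>2 + b\<^sup>2 = 1\<close> the product of \<open>\<Gamma>(a) f\<close> and \<open>\<Gamma>(b) g\<close> has the Mehler-type
  representation \<open>x \<mapsto> \<integral> f (a x + b y) g (b x - a y) d\<mu>(y)\<close>: on homogeneous chaoses both sides have the same
  component of top degree, and a rotation of the Gaussian pair shows that the integral is orthogonal to
  lower degrees. By rotation invariance the integral is continuous in \<open>L\<^sup>1\<close>, so it represents the
  extension, and its modulus is at most \<open>\<parallel>\<psi>\<parallel>\<^sub>\<infinity> \<Gamma>(a) \<bar>\<phi>\<bar>\<close>. What remains is Nelson's hypercontractivity.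

  It follows from the two-function inequality
  \<open>E (f (X) powr \<alpha> * g (Y) powr \<beta>) \<le> (E f (X)) powr \<alpha> * (E g (Y)) powr \<beta>\<close> for \<open>a\<close>-correlated Gaussian vectors, where
  \<open>\<alpha> = 1 / p\<close> and \<open>\<beta> = 1 - 1 / r\<close> satisfy \<open>a\<^sup>2 \<alpha> \<beta> = (1 - \<alpha>) (1 - \<beta>)\<close>. The time interval is cut into \<open>n\<close> Gaussian
  steps: in the second order Taylor expansion of one step the covariance of the increments is controlled
  by Gebelein's inequality (the spectral gap), which makes the quadratic part nonpositive, and the cubic
  errors add up to \<open>O (n powr (-1/2))\<close>.\<close>

section \<open>The Gaussian measure and its rotation invariance\<close>

text \<open>The two-function inequality is applied to powers of F and of its own image
  \<open>ou a F\<close>, where the symmetry of \<open>ou\<close> turns it into hypercontractivity.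
  The Taylor expansion of a step is uniform only for functions with values in a fixed interval
  [c, C] with c > 0. The heat flow preserves c, C and the Lipschitz constant, so one error constant
  serves for every step; this is why the inequality is proved in that class and then extended by
  density, truncation and Fatou's lemma. \<open>wick_sq\<close> and \<open>sq\<close> choose some
  function with a limit property, so they are accessible only up to null sets, and only because
  every integrable function is an L^1 limit of polynomials. The density has to be reached through
  bounded trigonometric polynomials, since polynomials that approximate well on a ball are
  uncontrolled outside it. Rotation invariance is obtained for a \<noteq> 0, which p > 1 guarantees,
  while b = 0 does occur, when p = r.\<close>

definition gdens :: "real^'n \<Rightarrow> real" where
  "gdens x = (2 * pi) powr (- real CARD('n) / 2) * exp (- ((norm x)\<^sup>2) / 2)"

lemma gauss_eq: "gauss = density lborel (\<lambda>x. ennreal (gdens x))"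
  by (simp add: gauss_def gdens_def)

lemma gdens_pos: "gdens x > 0"
  by (simp add: gdens_def)

lemma gdens_measurable [measurable]: "gdens \<in> borel_measurable borel"
  unfolding gdens_def by measurable

lemma sets_gauss [simp, measurable_cong]: "sets (gauss :: (real^'n) measure) = sets borel"
  by (simp add: gauss_def)

lemma space_gauss [simp]: "space (gauss :: (real^'n) measure) = UNIV"
  by (simp add: gauss_def)

lemma nn_integral_gauss:
  fixes f :: "real^'n \<Rightarrow> ennreal"
  assumes [measurable]: "f \<in> borel_measurable borel"
  shows "(\<integral>\<^sup>+x. f x \<partial>gauss) = (\<integral>\<^sup>+x. ennreal (gdens x) * f x \<partial>lborel)"
  unfolding gauss_eq by (subst nn_integral_density) auto

text \<open>Factorization into coordinates reduces the total mass to the one-dimensional normal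
  density through \<open>nn_integral_lborel_prod\<close>.\<close>

lemma gdens_prod:
  fixes x :: "real^'n"
  shows "gdens x = (\<Prod>b\<in>Basis. std_normal_density (x \<bullet> b))"
proof -
  have "(\<Prod>b\<in>(Basis::(real^'n) set). std_normal_density (x \<bullet> b))
      = (1 / sqrt (2*pi)) ^ CARD('n) * exp (- (\<Sum>b\<in>Basis. (x \<bullet> b)\<^sup>2) / 2)"
    unfolding std_normal_density_def prod.distrib
    by (simp add: exp_sum[symmetric] sum_divide_distrib sum_negf)
  also have "(\<Sum>b\<in>Basis. (x \<bullet> b)\<^sup>2) = (norm x)\<^sup>2"
    unfolding power2_norm_eq_inner by (subst (2) euclidean_inner) (simp add: power2_eq_square)
  also have "(1 / sqrt (2*pi)) ^ CARD('n) = (2 * pi) powr (- real CARD('n) / 2)"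
    by (simp add: powr_half_sqrt[symmetric] powr_realpow[symmetric] powr_powr powr_minus divide_simps powr_divide)
  finally show ?thesis by (simp add: gdens_def)
qed

lemma prob_space_gauss: "prob_space (gauss :: (real^'n) measure)"
proof
  have *: "(\<integral>\<^sup>+x. ennreal (std_normal_density x) \<partial>lborel) = 1"
  proof -
    have "emeasure (density lborel (normal_density 0 1)) UNIV = 1"
      using prob_space.emeasure_space_1[OF prob_space_normal_density[of 1 0]] by simp
    then show ?thesis by (simp add: emeasure_density)
  qed
  have "emeasure (gauss :: (real^'n) measure) (space gauss)
      = (\<integral>\<^sup>+x. (\<Prod>b\<in>(Basis::(real^'n) set). ennreal (std_normal_density (x \<bullet> b))) \<partial>lborel)"
    by (simp add: gauss_eq emeasure_density gdens_prod prod_ennreal)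
  also have "\<dots> = 1"
    by (subst nn_integral_lborel_prod) (auto simp: *)
  finally show "emeasure (gauss :: (real^'n) measure) (space gauss) = 1" .
qed

interpretation gauss: prob_space "gauss :: (real^'n) measure"
  by (rule prob_space_gauss)

interpretation gauss2: pair_prob_space "gauss :: (real^'n) measure" "gauss :: (real^'n) measure"
  by unfold_locales

lemma nn_integral_lborel_affine:
  fixes f :: "'a::euclidean_space \<Rightarrow> ennreal"
  assumes [measurable]: "f \<in> borel_measurable borel" and "c \<noteq> 0"
  shows "(\<integral>\<^sup>+x. f x \<partial>lborel) = ennreal (\<bar>c\<bar>^DIM('a)) * (\<integral>\<^sup>+x. f (t + c *\<^sub>R x) \<partial>lborel)"
  by (subst lborel_affine[OF \<open>c \<noteq> 0\<close>, of t])
     (simp add: nn_integral_density nn_integral_distr nn_integral_cmult)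

text \<open>The matrix with rows (a, b) and (b, -a) is orthogonal, so the sum of the squared norms
  is preserved. It is also symmetric, so the substitution is its own inverse; with this sign
  convention the same formula serves for rotating back.\<close>

lemma gdens_rotate:
  fixes x y :: "real^'n"
  assumes ab: "a\<^sup>2 + b\<^sup>2 = 1"
  shows "gdens (a *\<^sub>R x + b *\<^sub>R y) * gdens (b *\<^sub>R x - a *\<^sub>R y) = gdens x * gdens y"
proof -
  have n: "(norm (a *\<^sub>R x + b *\<^sub>R y))\<^sup>2 + (norm (b *\<^sub>R x - a *\<^sub>R y))\<^sup>2
      = (a\<^sup>2 + b\<^sup>2) * ((norm x)\<^sup>2 + (norm y)\<^sup>2)"
    unfolding power2_norm_eq_inner
    by (simp add: inner_add_left inner_add_right inner_diff_left inner_diff_right algebra_simps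
        power2_eq_square inner_commute del: dot_square_norm)
  have e: "gdens u * gdens v = ((2 * pi) powr (- real CARD('n) / 2))\<^sup>2 * exp (- ((norm u)\<^sup>2 + (norm v)\<^sup>2) / 2)"
    for u v :: "real^'n"
    by (simp add: gdens_def power2_eq_square exp_add[symmetric] diff_divide_distrib add_divide_distrib)
  show ?thesis unfolding e n ab by simp
qed

text \<open>A rotation in the plane spanned by two copies of the space is a product of shears
  and dilations, each of which is an affine substitution in one variable.\<close>
lemma nn_integral_gauss_rotate:
  fixes F :: "real^'n \<Rightarrow> real^'n \<Rightarrow> ennreal"
  assumes F [measurable]: "case_prod F \<in> borel_measurable (borel \<Otimes>\<^sub>M borel)"
    and ab: "a\<^sup>2 + b\<^sup>2 = 1" and a: "a \<noteq> 0"
  shows "(\<integral>\<^sup>+x. (\<integral>\<^sup>+y. F (a *\<^sub>R x + b *\<^sub>R y) (b *\<^sub>R x - a *\<^sub>R y) \<partial>gauss) \<partial>gauss)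
       = (\<integral>\<^sup>+x. (\<integral>\<^sup>+y. F x y \<partial>gauss) \<partial>gauss)"
proof -
  define D where "D = CARD('n)"
  define G where "G u v = ennreal (gdens u * gdens v) * F u v" for u v :: "real^'n"
  have [measurable]: "case_prod G \<in> borel_measurable (borel \<Otimes>\<^sub>M borel)"
    unfolding G_def by measurable
  have GG: "(\<integral>\<^sup>+x. (\<integral>\<^sup>+y. H x y \<partial>gauss) \<partial>gauss)
      = (\<integral>\<^sup>+x. (\<integral>\<^sup>+y. ennreal (gdens x * gdens y) * H x y \<partial>lborel) \<partial>lborel)"
    if [measurable]: "case_prod H \<in> borel_measurable (borel \<Otimes>\<^sub>M borel)"
    for H :: "real^'n \<Rightarrow> real^'n \<Rightarrow> ennreal"
    by (simp add: nn_integral_gauss nn_integral_cmult[symmetric] ennreal_mult' less_imp_le[OF gdens_pos] mult.assoc)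
  \<comment> \<open>With u = a x + b y kept as first variable, the second one is b x - a y = (b/a) u
    - (1/a) y; this uses b^2 - 1 = -a^2.\<close>
  have v: "(b/a) *\<^sub>R (b *\<^sub>R y + a *\<^sub>R x) + (-1/a) *\<^sub>R y = b *\<^sub>R x - a *\<^sub>R y" for x y :: "real^'n"
  proof -
    have "b * b / a - 1 / a = - a"
      using ab a by (simp add: field_simps power2_eq_square)
    then have "(b * b / a) *\<^sub>R y - (1/a) *\<^sub>R y = - (a *\<^sub>R y)"
      by (metis scaleR_left_diff_distrib scaleR_minus_left)
    then show ?thesis using a by (simp add: algebra_simps)
  qed
  have "(\<integral>\<^sup>+x. (\<integral>\<^sup>+y. F x y \<partial>gauss) \<partial>gauss) = (\<integral>\<^sup>+u. (\<integral>\<^sup>+v. G u v \<partial>lborel) \<partial>lborel)"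
    unfolding G_def by (rule GG) measurable
  also have "\<dots> = (\<integral>\<^sup>+u. ennreal (\<bar>-1/a\<bar>^D) * (\<integral>\<^sup>+y. G u ((b/a) *\<^sub>R u + (-1/a) *\<^sub>R y) \<partial>lborel) \<partial>lborel)"
    using a by (intro nn_integral_cong, subst nn_integral_lborel_affine[where c = "-1/a" and t = "(b/a) *\<^sub>R _"]) (auto simp: D_def)
  also have "\<dots> = ennreal (\<bar>-1/a\<bar>^D) * (\<integral>\<^sup>+u. (\<integral>\<^sup>+y. G u ((b/a) *\<^sub>R u + (-1/a) *\<^sub>R y) \<partial>lborel) \<partial>lborel)"
    by (rule nn_integral_cmult) measurable
  also have "\<dots> = ennreal (\<bar>-1/a\<bar>^D) * (\<integral>\<^sup>+y. (\<integral>\<^sup>+u. G u ((b/a) *\<^sub>R u + (-1/a) *\<^sub>R y) \<partial>lborel) \<partial>lborel)"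
    by (subst lborel_pair.Fubini') auto
  also have "\<dots> = ennreal (\<bar>-1/a\<bar>^D) * (\<integral>\<^sup>+y. ennreal (\<bar>a\<bar>^D) * (\<integral>\<^sup>+x. G (b *\<^sub>R y + a *\<^sub>R x) (b *\<^sub>R x - a *\<^sub>R y) \<partial>lborel) \<partial>lborel)"
  proof (intro arg_cong2[where f = times] nn_integral_cong refl)
    fix y :: "real^'n"
    show "(\<integral>\<^sup>+u. G u ((b/a) *\<^sub>R u + (-1/a) *\<^sub>R y) \<partial>lborel)
        = ennreal (\<bar>a\<bar>^D) * (\<integral>\<^sup>+x. G (b *\<^sub>R y + a *\<^sub>R x) (b *\<^sub>R x - a *\<^sub>R y) \<partial>lborel)"
      using a by (subst nn_integral_lborel_affine[where c = a and t = "b *\<^sub>R y"]) (simp_all only: v D_def, auto)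
  qed
  \<comment> \<open>The Jacobian factors of the two dilations, by -1/a in v and by a in u,
    cancel.\<close>
  also have "\<dots> = (\<integral>\<^sup>+y. (\<integral>\<^sup>+x. G (b *\<^sub>R y + a *\<^sub>R x) (b *\<^sub>R x - a *\<^sub>R y) \<partial>lborel) \<partial>lborel)"
    using a by (subst nn_integral_cmult) (auto simp: mult.assoc[symmetric] ennreal_mult'[symmetric] power_mult_distrib[symmetric])
  also have "\<dots> = (\<integral>\<^sup>+x. (\<integral>\<^sup>+y. G (a *\<^sub>R x + b *\<^sub>R y) (b *\<^sub>R x - a *\<^sub>R y) \<partial>lborel) \<partial>lborel)"
    by (subst lborel_pair.Fubini') (auto simp: add.commute)
  also have "\<dots> = (\<integral>\<^sup>+x. (\<integral>\<^sup>+y. F (a *\<^sub>R x + b *\<^sub>R y) (b *\<^sub>R x - a *\<^sub>R y) \<partial>gauss) \<partial>gauss)"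
    unfolding G_def gdens_rotate[OF ab] by (rule GG[symmetric]) measurable
  finally show ?thesis by simp
qed

lemma distr_gauss_rotate:
  assumes ab: "a\<^sup>2 + b\<^sup>2 = 1" and a: "a \<noteq> 0"
  shows "distr (gauss \<Otimes>\<^sub>M gauss) (gauss \<Otimes>\<^sub>M gauss) (\<lambda>(x, y). (a *\<^sub>R x + b *\<^sub>R y, b *\<^sub>R x - a *\<^sub>R y))
     = (gauss \<Otimes>\<^sub>M gauss :: ((real^'n) \<times> (real^'n)) measure)"
proof (rule measure_eqI)
  fix A :: "((real^'n) \<times> (real^'n)) set"
  assume "A \<in> sets (distr (gauss \<Otimes>\<^sub>M gauss) (gauss \<Otimes>\<^sub>M gauss) (\<lambda>(x, y). (a *\<^sub>R x + b *\<^sub>R y, b *\<^sub>R x - a *\<^sub>R y)))"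
  then have [measurable]: "A \<in> sets (borel \<Otimes>\<^sub>M borel)"
    by (simp cong: sets_pair_measure_cong)
  then have A': "A \<in> sets (gauss \<Otimes>\<^sub>M gauss)" by (simp cong: sets_pair_measure_cong)
  have m: "(\<lambda>(x, y). (a *\<^sub>R x + b *\<^sub>R y, b *\<^sub>R x - a *\<^sub>R y)) \<in> (gauss \<Otimes>\<^sub>M gauss) \<rightarrow>\<^sub>M (gauss \<Otimes>\<^sub>M (gauss :: (real^'n) measure))"
    by measurable
  have "emeasure (distr (gauss \<Otimes>\<^sub>M gauss) (gauss \<Otimes>\<^sub>M gauss) (\<lambda>(x, y). (a *\<^sub>R x + b *\<^sub>R y, b *\<^sub>R x - a *\<^sub>R y))) A
     = (\<integral>\<^sup>+z. indicator A z \<partial>distr (gauss \<Otimes>\<^sub>M gauss) (gauss \<Otimes>\<^sub>M gauss) (\<lambda>(x, y). (a *\<^sub>R x + b *\<^sub>R y, b *\<^sub>R x - a *\<^sub>R y)))"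
    using A' by simp
  also have "\<dots> = (\<integral>\<^sup>+z. indicator A (a *\<^sub>R fst z + b *\<^sub>R snd z, b *\<^sub>R fst z - a *\<^sub>R snd z) \<partial>(gauss \<Otimes>\<^sub>M gauss))"
    by (subst nn_integral_distr[OF m]) (auto simp: A' split_beta)
  also have "\<dots> = (\<integral>\<^sup>+x. (\<integral>\<^sup>+y. indicator A (a *\<^sub>R x + b *\<^sub>R y, b *\<^sub>R x - a *\<^sub>R y) \<partial>gauss) \<partial>gauss)"
    by (subst gauss.nn_integral_fst[symmetric]) auto
  also have "\<dots> = (\<integral>\<^sup>+x. (\<integral>\<^sup>+y. indicator A (x, y) \<partial>gauss) \<partial>gauss)"
    by (rule nn_integral_gauss_rotate[OF _ ab a]) measurable
  also have "\<dots> = (\<integral>\<^sup>+z. indicator A z \<partial>(gauss \<Otimes>\<^sub>M gauss))"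
    by (subst gauss.nn_integral_fst[symmetric]) (auto simp: A')
  also have "\<dots> = emeasure (gauss \<Otimes>\<^sub>M gauss) A"
    using A' by simp
  finally show "emeasure (distr (gauss \<Otimes>\<^sub>M gauss) (gauss \<Otimes>\<^sub>M gauss) (\<lambda>(x, y). (a *\<^sub>R x + b *\<^sub>R y, b *\<^sub>R x - a *\<^sub>R y))) A
     = emeasure (gauss \<Otimes>\<^sub>M gauss) A" .
qed simp

lemma measurable_gauss_rotate [measurable]:
  "(\<lambda>(x, y). (a *\<^sub>R x + b *\<^sub>R y, b *\<^sub>R x - a *\<^sub>R y)) \<in> (gauss \<Otimes>\<^sub>M gauss) \<rightarrow>\<^sub>M (gauss \<Otimes>\<^sub>M (gauss :: (real^'n) measure))"
  by measurable

lemma integrable_gauss_rotate: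
  fixes F :: "(real^'n) \<times> (real^'n) \<Rightarrow> 'b::{banach, second_countable_topology}"
  assumes "a\<^sup>2 + b\<^sup>2 = 1" "a \<noteq> 0" "integrable (gauss \<Otimes>\<^sub>M gauss) F"
  shows "integrable (gauss \<Otimes>\<^sub>M gauss) (\<lambda>(x, y). F (a *\<^sub>R x + b *\<^sub>R y, b *\<^sub>R x - a *\<^sub>R y))"
proof -
  have "integrable (distr (gauss \<Otimes>\<^sub>M gauss) (gauss \<Otimes>\<^sub>M gauss) (\<lambda>(x, y). (a *\<^sub>R x + b *\<^sub>R y, b *\<^sub>R x - a *\<^sub>R y))) F"
    using assms(3) unfolding distr_gauss_rotate[OF assms(1,2)] .
  from integrable_distr[OF measurable_gauss_rotate this] show ?thesis
    by (simp add: split_beta')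
qed

lemma integral_gauss_rotate:
  fixes F :: "(real^'n) \<times> (real^'n) \<Rightarrow> 'b::{banach, second_countable_topology}"
  assumes "a\<^sup>2 + b\<^sup>2 = 1" "a \<noteq> 0" "F \<in> borel_measurable (gauss \<Otimes>\<^sub>M gauss)"
  shows "(\<integral>(x, y). F (a *\<^sub>R x + b *\<^sub>R y, b *\<^sub>R x - a *\<^sub>R y) \<partial>(gauss \<Otimes>\<^sub>M gauss)) = (\<integral>z. F z \<partial>(gauss \<Otimes>\<^sub>M gauss))"
  using integral_distr[OF measurable_gauss_rotate assms(3), of a b]
  unfolding distr_gauss_rotate[OF assms(1,2)] by (simp add: split_beta')

lemma AE_gauss_rotate:
  assumes "a\<^sup>2 + b\<^sup>2 = 1" "a \<noteq> 0" "AE z in (gauss \<Otimes>\<^sub>M gauss :: ((real^'n) \<times> (real^'n)) measure). P z"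
  shows "AE z in (gauss \<Otimes>\<^sub>M gauss :: ((real^'n) \<times> (real^'n)) measure).
     P (a *\<^sub>R fst z + b *\<^sub>R snd z, b *\<^sub>R fst z - a *\<^sub>R snd z)"
proof -
  have "AE z in distr (gauss \<Otimes>\<^sub>M gauss) (gauss \<Otimes>\<^sub>M gauss) (\<lambda>(x, y). (a *\<^sub>R x + b *\<^sub>R y, b *\<^sub>R x - a *\<^sub>R y)). P z"
    using assms(3) unfolding distr_gauss_rotate[OF assms(1,2)] .
  from AE_distrD[OF measurable_gauss_rotate this] show ?thesis
    by (simp add: split_beta')
qed

section \<open>Moments of the Gaussian measure and sums of independent copies\<close>

text \<open>Completing the square bounds s |x| by s^2 + |x|^2 / 4. What is left of the density is a
  Gaussian in x / sqrt 2, whose integral is finite by dilation.\<close>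

lemma integrable_gauss_exp_norm:
  "integrable (gauss :: (real^'n) measure) (\<lambda>x. exp (s * norm x))"
proof (rule integrableI_bounded)
  let ?r = "1 / sqrt 2"
  have le: "gdens x * exp (s * norm x) \<le> exp (s\<^sup>2) * gdens (?r *\<^sub>R x)" for x :: "real^'n"
  proof -
    have "0 \<le> (s - norm x / 2)\<^sup>2" by simp
    then have "- ((norm x)\<^sup>2) / 2 + s * norm x \<le> s\<^sup>2 + (- ((norm x / sqrt 2)\<^sup>2) / 2)"
      by (simp add: power2_eq_square field_simps)
    then have "exp (- ((norm x)\<^sup>2) / 2) * exp (s * norm x) \<le> exp (s\<^sup>2) * exp (- ((norm x / sqrt 2)\<^sup>2) / 2)"
      unfolding exp_add[symmetric] by simp
    then show ?thesis
      by (simp add: gdens_def mult.assoc mult.left_commute[of "exp (s\<^sup>2)"] mult_left_mono)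
  qed
  have one: "(\<integral>\<^sup>+x. ennreal (gdens (x::real^'n)) \<partial>lborel) = 1"
    using gauss.emeasure_space_1 unfolding gauss_eq by (simp add: emeasure_density)
  have "(\<integral>\<^sup>+x. ennreal (gdens (x::real^'n)) \<partial>lborel)
     = ennreal (\<bar>?r\<bar> ^ CARD('n)) * (\<integral>\<^sup>+x. ennreal (gdens (?r *\<^sub>R (x::real^'n))) \<partial>lborel)"
    by (subst nn_integral_lborel_affine[where c = ?r and t = 0]) auto
  \<comment> \<open>The total mass 1 is a positive multiple of the dilated integral, which rules out
    the value infinity.\<close>
  then have fin: "(\<integral>\<^sup>+x. ennreal (gdens (?r *\<^sub>R (x::real^'n))) \<partial>lborel) < \<infinity>"
    unfolding one by (auto simp: ennreal_mult_eq_top_iff less_top[symmetric] ennreal_eq_0_iff ennreal_mult_top not_le split: if_splits)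
  have "(\<integral>\<^sup>+x. ennreal (norm (exp (s * norm x))) \<partial>(gauss :: (real^'n) measure))
     = (\<integral>\<^sup>+x. ennreal (gdens (x::real^'n) * exp (s * norm x)) \<partial>lborel)"
    by (simp add: nn_integral_gauss ennreal_mult' less_imp_le[OF gdens_pos])
  also have "\<dots> \<le> (\<integral>\<^sup>+x. ennreal (exp (s\<^sup>2)) * ennreal (gdens (?r *\<^sub>R (x::real^'n))) \<partial>lborel)"
    using le by (intro nn_integral_mono) (simp add: ennreal_mult'[symmetric] ennreal_leI)
  also have "\<dots> = ennreal (exp (s\<^sup>2)) * (\<integral>\<^sup>+x. ennreal (gdens (?r *\<^sub>R (x::real^'n))) \<partial>lborel)"
    by (rule nn_integral_cmult) measurable
  also have "\<dots> < \<infinity>"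
    using fin by (simp add: ennreal_mult_less_top)
  finally show "(\<integral>\<^sup>+x. ennreal (norm (exp (s * norm x))) \<partial>(gauss :: (real^'n) measure)) < \<infinity>" .
qed measurable

lemma integrable_gauss_exp_bound:
  fixes f :: "real^'n \<Rightarrow> 'b::{banach, second_countable_topology}"
  assumes [measurable]: "f \<in> borel_measurable borel" and "\<And>x. norm (f x) \<le> C * exp (s * norm x)"
  shows "integrable gauss f"
proof (rule Bochner_Integration.integrable_bound)
  show "integrable gauss (\<lambda>x::real^'n. C * exp (s * norm x))"
    using integrable_gauss_exp_norm by (rule integrable_mult_right)
  show "AE x in gauss. norm (f x) \<le> norm (C * exp (s * norm x))"
    using assms(2) by (auto intro!: AE_I2 order_trans[OF assms(2)])
qed measurable

text \<open>One term of the exponential series. It converts polynomial growth into exponential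
  growth, for which integrability is settled.\<close>

lemma power_le_fact_exp:
  assumes "0 \<le> (x::real)"
  shows "x ^ k \<le> fact k * exp x"
proof -
  have "(\<Sum>n\<in>{k}. inverse (fact n) * x ^ n) \<le> (\<Sum>n. inverse (fact n) * x ^ n)"
    using assms by (intro sum_le_suminf summable_exp) auto
  then show ?thesis
    by (simp add: exp_def scaleR_conv_of_real field_simps)
qed

lemma integrable_gauss_norm_power:
  assumes "0 \<le> c"
  shows "integrable (gauss :: (real^'n) measure) (\<lambda>x. (norm x + c) ^ k)"
proof (rule integrable_gauss_exp_bound)
  fix x :: "real^'n"
  show "norm ((norm x + c) ^ k) \<le> fact k * exp c * exp (1 * norm x)"
    using power_le_fact_exp[of "norm x + c" k] assms
    by (simp add: exp_add mult_ac)
qed measurable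

lemma gauss_prob_UNIV [simp]: "gauss.prob (UNIV :: (real^'n) set) = 1"
  using gauss.prob_space by simp

lemma integrable_gauss_pair_fst:
  fixes f :: "real^'n \<Rightarrow> 'b::{banach, second_countable_topology}"
  assumes "integrable gauss f"
  shows "integrable (gauss \<Otimes>\<^sub>M gauss :: ((real^'n) \<times> (real^'n)) measure) (\<lambda>z. f (fst z))"
  using assms by (intro integrable_distr[of fst _ gauss]) (simp_all add: gauss.distr_pair_fst)

lemma integral_gauss_pair_fst:
  fixes f :: "real^'n \<Rightarrow> 'b::{banach, second_countable_topology}"
  assumes "f \<in> borel_measurable borel"
  shows "(\<integral>z. f (fst z) \<partial>(gauss \<Otimes>\<^sub>M gauss :: ((real^'n) \<times> (real^'n)) measure)) = (\<integral>x. f x \<partial>gauss)"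
  using integral_distr[of fst "gauss \<Otimes>\<^sub>M gauss :: ((real^'n) \<times> (real^'n)) measure" gauss f] assms
  by (simp add: gauss.distr_pair_fst)

text \<open>Independent centred Gaussian vectors with variances s^2 and t^2 add up to one with
  variance r^2: rotate by (s/r, t/r) and read off the first coordinate. The semigroup laws of
  \<open>ou\<close> and of the heat flow come from here.\<close>

lemma gauss_integral_add:
  fixes F :: "real^'n \<Rightarrow> 'b::{banach, second_countable_topology}"
  assumes [measurable]: "F \<in> borel_measurable borel" and st: "0 \<le> s" "0 \<le> t"
    and r: "r\<^sup>2 = s\<^sup>2 + t\<^sup>2" "0 \<le> r" and int: "integrable gauss (\<lambda>z. F (r *\<^sub>R z))"
  shows "integrable (gauss \<Otimes>\<^sub>M gauss) (\<lambda>z. F (s *\<^sub>R fst z + t *\<^sub>R snd z))" (is ?A)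
    and "(\<integral>z. F (s *\<^sub>R fst z + t *\<^sub>R snd z) \<partial>(gauss \<Otimes>\<^sub>M gauss)) = (\<integral>z. F (r *\<^sub>R z) \<partial>gauss)" (is ?B)
    and "(\<integral>z. (\<integral>w. F (s *\<^sub>R z + t *\<^sub>R w) \<partial>gauss) \<partial>gauss) = (\<integral>z. F (r *\<^sub>R z) \<partial>gauss)" (is ?C)
proof -
  have "?A \<and> ?B \<and> ?C"
  \<comment> \<open>Rotation invariance is available with a nonzero first coefficient, so s = 0 is
    done by swapping the two factors.\<close>
  proof (cases "s = 0")
    case True
    then have rt: "r = t" using st r by simp
    note i = integrable_gauss_pair_fst[OF int]
    have 1: "integrable (gauss \<Otimes>\<^sub>M gauss) (\<lambda>z. F (r *\<^sub>R snd (z :: (real^'n) \<times> (real^'n))))"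
      using gauss2.integrable_product_swap[OF i] by (simp add: split_beta')
    have 3: "(\<integral>z. (\<integral>w. F (r *\<^sub>R w) \<partial>gauss) \<partial>(gauss :: (real^'n) measure)) = (\<integral>z. F (r *\<^sub>R z) \<partial>gauss)"
      by simp
    have 2: "(\<integral>z. F (r *\<^sub>R snd z) \<partial>(gauss \<Otimes>\<^sub>M gauss :: ((real^'n) \<times> (real^'n)) measure)) = (\<integral>z. F (r *\<^sub>R z) \<partial>gauss)"
      using gauss2.integral_fst'[OF 1] 3 by simp
    show ?thesis using 1 2 3 True rt by simp
  next
    case False
    then have r0: "r \<noteq> 0" using st r by (auto simp: sum_power2_eq_zero_iff)
    have ab: "(s/r)\<^sup>2 + (t/r)\<^sup>2 = 1" "s/r \<noteq> 0"
      using False r0 by (auto simp: power_divide add_divide_distrib[symmetric] r(1)[symmetric])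
    have eq: "r *\<^sub>R ((s/r) *\<^sub>R x + (t/r) *\<^sub>R y) = s *\<^sub>R x + t *\<^sub>R y" for x y :: "real^'n"
      using r0 by (simp add: scaleR_add_right)
    note i = integrable_gauss_pair_fst[OF int]
    have 1: ?A
      using integrable_gauss_rotate[OF ab i] by (simp add: split_beta' eq)
    have 2: ?B
      using integral_gauss_rotate[OF ab, of "\<lambda>z. F (r *\<^sub>R fst z)"] integral_gauss_pair_fst[of "\<lambda>z. F (r *\<^sub>R z)"]
      by (simp add: split_beta' eq)
    have 3: ?C
      using gauss2.integral_fst'[OF 1] 2 by simp
    show ?thesis using 1 2 3 by simp
  qed
  then show ?A ?B ?C by auto
qed

section \<open>Spectral gap of the Ornstein-Uhlenbeck operator\<close>

lemma lipschitz_borel_measurable: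
  fixes F :: "'a::metric_space \<Rightarrow> 'b::metric_space"
  assumes "L-lipschitz_on UNIV F"
  shows "F \<in> borel_measurable borel"
  by (intro borel_measurable_continuous_onI lipschitz_on_continuous_on[OF assms])

lemma lipschitz_realD:
  fixes F :: "'a::real_normed_vector \<Rightarrow> real"
  assumes "L-lipschitz_on UNIV F"
  shows "\<bar>F x - F y\<bar> \<le> L * norm (x - y)"
  using lipschitz_onD[OF assms, of x y] by (simp add: dist_norm)

lemma lipschitz_realI:
  fixes F :: "'a::real_normed_vector \<Rightarrow> real"
  assumes "\<And>x y. \<bar>F x - F y\<bar> \<le> L * norm (x - y)" "0 \<le> L"
  shows "L-lipschitz_on UNIV F"
  using assms by (intro lipschitz_onI) (auto simp: dist_norm)

lemma Cauchy_Schwarz_integral: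
  fixes F G :: "'a \<Rightarrow> real"
  assumes [simp]: "integrable M (\<lambda>x. (F x)\<^sup>2)" "integrable M (\<lambda>x. (G x)\<^sup>2)" "integrable M (\<lambda>x. F x * G x)"
  shows "(\<integral>x. F x * G x \<partial>M)\<^sup>2 \<le> (\<integral>x. (F x)\<^sup>2 \<partial>M) * (\<integral>x. (G x)\<^sup>2 \<partial>M)"
proof -
  define A B I where "A = (\<integral>x. (F x)\<^sup>2 \<partial>M)" and "B = (\<integral>x. (G x)\<^sup>2 \<partial>M)" and "I = (\<integral>x. F x * G x \<partial>M)"
  have q: "0 \<le> t\<^sup>2 * A - 2 * t * I + B" for t
  proof -
    have "0 \<le> (\<integral>x. (t * F x - G x)\<^sup>2 \<partial>M)" by simp
    also have "\<dots> = (\<integral>x. t\<^sup>2 * (F x)\<^sup>2 - 2 * t * (F x * G x) + (G x)\<^sup>2 \<partial>M)"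
      by (intro Bochner_Integration.integral_cong) (auto simp: power2_eq_square algebra_simps)
    finally show ?thesis by (simp add: A_def B_def I_def)
  qed
  have "A \<ge> 0" by (simp add: A_def)
  show ?thesis
  proof (cases "A = 0")
    case True
    have "I = 0"
    proof (rule ccontr)
      assume "I \<noteq> 0"
      \<comment> \<open>With A = 0 the quadratic is linear in t; this t gives it the value
        -1.\<close>
      then show False using q[of "(B + 1) / (2 * I)"] True by simp
    qed
    then show ?thesis using True by (simp add: A_def I_def)
  next
    case False
    have "0 \<le> A * ((I/A)\<^sup>2 * A - 2 * (I/A) * I + B)"
      using q[of "I/A"] \<open>A \<ge> 0\<close> by (intro mult_nonneg_nonneg) auto
    also have "\<dots> = A * B - I\<^sup>2" using False by (simp add: field_simps power2_eq_square)
    finally show ?thesis by (simp add: A_def B_def I_def)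
  qed
qed

text \<open>The Ornstein-Uhlenbeck semigroup on real functions, indexed by the correlation \<rho> =
  exp (-t) instead of the time t; this is the Mehler kernel form of \<Gamma>(\<rho>).\<close>

definition ou :: "real \<Rightarrow> (real^'n \<Rightarrow> real) \<Rightarrow> real^'n \<Rightarrow> real" where
  "ou \<rho> F x = (\<integral>y. F (\<rho> *\<^sub>R x + sqrt (1 - \<rho>\<^sup>2) *\<^sub>R y) \<partial>gauss)"

lemma gauss_integral_bounds:
  fixes F :: "real^'n \<Rightarrow> real"
  assumes [measurable]: "F \<in> borel_measurable borel" and "\<And>x. c \<le> F x" "\<And>x. F x \<le> C"
  shows "integrable gauss F" "c \<le> (\<integral>x. F x \<partial>gauss)" "(\<integral>x. F x \<partial>gauss) \<le> C"
proof -
  have "\<bar>F x\<bar> \<le> \<bar>c\<bar> + \<bar>C\<bar>" for x using assms(2)[of x] assms(3)[of x] by linarith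
  then show i: "integrable gauss F"
    by (intro gauss.integrable_const_bound[of _ "\<bar>c\<bar> + \<bar>C\<bar>"]) auto
  have "(\<integral>x. c \<partial>(gauss::(real^'n) measure)) \<le> (\<integral>x. F x \<partial>gauss)" "(\<integral>x. F x \<partial>gauss) \<le> (\<integral>x. C \<partial>(gauss::(real^'n) measure))"
    using assms(2,3) i by (intro integral_mono; simp)+
  then show "c \<le> (\<integral>x. F x \<partial>gauss)" "(\<integral>x. F x \<partial>gauss) \<le> C" by simp_all
qed

lemma ou_measurable [measurable]:
  assumes [measurable]: "F \<in> borel_measurable borel"
  shows "ou \<rho> F \<in> borel_measurable borel"
  unfolding ou_def[abs_def] by measurable

lemma ou_bounds:
  assumes "F \<in> borel_measurable borel" "\<And>x. c \<le> F x" "\<And>x. F x \<le> C"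
  shows "c \<le> ou \<rho> F x" "ou \<rho> F x \<le> C"
  unfolding ou_def using assms by (auto intro!: gauss_integral_bounds)

text \<open>Serves both semigroups: with a = \<rho> for \<open>ou\<close>, where the contraction
  drives the spectral gap, and with a = 1 for the heat flow, where the constant is just
  kept.\<close>

lemma lipschitz_gauss_average:
  fixes F :: "real^'n \<Rightarrow> real"
  assumes L: "L-lipschitz_on UNIV F" and F: "\<And>x. c \<le> F x" "\<And>x. F x \<le> C" and "0 \<le> a"
  shows "(a * L)-lipschitz_on UNIV (\<lambda>x. \<integral>y. F (a *\<^sub>R x + b *\<^sub>R y) \<partial>gauss)"
proof (rule lipschitz_realI)
  note [measurable] = lipschitz_borel_measurable[OF L]
  fix x x' :: "real^'n"
  have i: "integrable gauss (\<lambda>y. F (a *\<^sub>R x + b *\<^sub>R y))" for x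
    using F by (intro gauss_integral_bounds[of _ c C]) auto
  have "\<bar>(\<integral>y. F (a *\<^sub>R x + b *\<^sub>R y) \<partial>gauss) - (\<integral>y. F (a *\<^sub>R x' + b *\<^sub>R y) \<partial>gauss)\<bar>
      = \<bar>\<integral>y. F (a *\<^sub>R x + b *\<^sub>R y) - F (a *\<^sub>R x' + b *\<^sub>R y) \<partial>gauss\<bar>"
    using i by simp
  also have "\<dots> \<le> (\<integral>y. \<bar>F (a *\<^sub>R x + b *\<^sub>R y) - F (a *\<^sub>R x' + b *\<^sub>R y)\<bar> \<partial>gauss)"
    by (rule integral_abs_bound)
  also have "\<dots> \<le> (\<integral>y. a * L * norm (x - x') \<partial>(gauss :: (real^'n) measure))"
  proof (rule integral_mono)
    show "\<bar>F (a *\<^sub>R x + b *\<^sub>R y) - F (a *\<^sub>R x' + b *\<^sub>R y)\<bar> \<le> a * L * norm (x - x')" for y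
      using lipschitz_realD[OF L, of "a *\<^sub>R x + b *\<^sub>R y" "a *\<^sub>R x' + b *\<^sub>R y"] \<open>0 \<le> a\<close>
      by (simp add: scaleR_diff_right[symmetric] mult_ac)
  qed (use i in auto)
  finally show "\<bar>(\<integral>y. F (a *\<^sub>R x + b *\<^sub>R y) \<partial>gauss) - (\<integral>y. F (a *\<^sub>R x' + b *\<^sub>R y) \<partial>gauss)\<bar> \<le> a * L * norm (x - x')"
    by simp
qed (use lipschitz_on_nonneg[OF L] \<open>0 \<le> a\<close> in auto)

lemma ou_lipschitz:
  assumes "L-lipschitz_on UNIV F" "\<And>x. c \<le> F x" "\<And>x. F x \<le> C" "0 \<le> \<rho>"
  shows "(\<rho> * L)-lipschitz_on UNIV (ou \<rho> F)"
  unfolding ou_def[abs_def] by (rule lipschitz_gauss_average[OF assms])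

lemma gauss_pair_integral_bounded:
  fixes F :: "(real^'n) \<times> (real^'n) \<Rightarrow> real"
  assumes [measurable]: "F \<in> borel_measurable (borel \<Otimes>\<^sub>M borel)" and "\<And>z. \<bar>F z\<bar> \<le> C"
  shows "integrable (gauss \<Otimes>\<^sub>M gauss) F"
    "(\<integral>x. (\<integral>y. F (x, y) \<partial>gauss) \<partial>gauss) = (\<integral>z. F z \<partial>(gauss \<Otimes>\<^sub>M gauss))"
proof -
  show "integrable (gauss \<Otimes>\<^sub>M gauss) F"
    using assms(2) by (intro gauss2.P.integrable_const_bound[of _ C]) auto
  then show "(\<integral>x. (\<integral>y. F (x, y) \<partial>gauss) \<partial>gauss) = (\<integral>z. F z \<partial>(gauss \<Otimes>\<^sub>M gauss))"
    by (rule gauss2.integral_fst')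
qed

lemma ou_pair:
  assumes [measurable]: "F \<in> borel_measurable borel" "G \<in> borel_measurable borel"
    and F: "\<And>x. \<bar>F x\<bar> \<le> C" and G: "\<And>x. \<bar>G x\<bar> \<le> C"
  shows "(\<integral>x. F x * ou \<rho> G x \<partial>gauss)
    = (\<integral>z. F (fst z) * G (\<rho> *\<^sub>R fst z + sqrt (1 - \<rho>\<^sup>2) *\<^sub>R snd z) \<partial>(gauss \<Otimes>\<^sub>M gauss))"
proof -
  have "\<bar>F x * G y\<bar> \<le> C * C" for x y
    using F[of x] G[of y] by (simp add: abs_mult mult_mono')
  then show ?thesis
    unfolding ou_def
    using gauss_pair_integral_bounded(2)[of "\<lambda>z. F (fst z) * G (\<rho> *\<^sub>R fst z + sqrt (1 - \<rho>\<^sup>2) *\<^sub>R snd z)" "C * C"]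
    by simp
qed

text \<open>The pair (X, \<rho> X + s Y) is exchangeable: the involutive rotation interchanges its
  two components.\<close>

lemma ou_symmetric:
  assumes [measurable]: "F \<in> borel_measurable borel" "G \<in> borel_measurable borel"
    and F: "\<And>x. \<bar>F x\<bar> \<le> C" and G: "\<And>x. \<bar>G x\<bar> \<le> C" and \<rho>: "0 < \<rho>" "\<rho> \<le> 1"
  shows "(\<integral>x. F x * ou \<rho> G x \<partial>gauss) = (\<integral>x. ou \<rho> F x * G x \<partial>gauss)"
proof -
  define s where "s = sqrt (1 - \<rho>\<^sup>2)"
  have ab: "\<rho>\<^sup>2 + s\<^sup>2 = 1" "\<rho> \<noteq> 0" using \<rho> by (auto simp: s_def power_le_one)
  have eq: "\<rho> *\<^sub>R (\<rho> *\<^sub>R x + s *\<^sub>R y) + s *\<^sub>R (s *\<^sub>R x - \<rho> *\<^sub>R y) = x" for x y :: "real^'n"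
  proof -
    have "\<rho> *\<^sub>R (\<rho> *\<^sub>R x + s *\<^sub>R y) + s *\<^sub>R (s *\<^sub>R x - \<rho> *\<^sub>R y) = (\<rho>\<^sup>2 + s\<^sup>2) *\<^sub>R x"
      by (simp add: algebra_simps power2_eq_square)
    then show ?thesis using ab by simp
  qed
  have "(\<integral>x. ou \<rho> F x * G x \<partial>gauss) = (\<integral>x. G x * ou \<rho> F x \<partial>gauss)"
    by (simp add: mult.commute)
  also have "\<dots> = (\<integral>z. G (fst z) * F (\<rho> *\<^sub>R fst z + s *\<^sub>R snd z) \<partial>(gauss \<Otimes>\<^sub>M gauss))"
    unfolding s_def by (rule ou_pair[OF _ _ G F]) measurable
  also have "\<dots> = (\<integral>z. F (fst z) * G (\<rho> *\<^sub>R fst z + s *\<^sub>R snd z) \<partial>(gauss \<Otimes>\<^sub>M gauss))"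
    using integral_gauss_rotate[OF ab, of "\<lambda>z. G (fst z) * F (\<rho> *\<^sub>R fst z + s *\<^sub>R snd z)"]
    by (simp add: split_beta' eq mult.commute)
  also have "\<dots> = (\<integral>x. F x * ou \<rho> G x \<partial>gauss)"
    unfolding s_def by (rule ou_pair[OF _ _ F G, symmetric]) measurable
  finally show ?thesis by simp
qed

text \<open>The two noise terms \<rho> s z and s w are independent with total variance \<rho>^2 s^2
  + s^2 = 1 - \<rho>^4. Squaring the correlation is the form in which the spectral gap iterates the
  operator.\<close>

lemma ou_ou:
  assumes [measurable]: "F \<in> borel_measurable borel" and F: "\<And>x. \<bar>F x\<bar> \<le> C"
    and \<rho>: "0 \<le> \<rho>" "\<rho> \<le> 1"
  shows "ou \<rho> (ou \<rho> F) x = ou (\<rho>\<^sup>2) F x"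
proof -
  define s where "s = sqrt (1 - \<rho>\<^sup>2)"
  have s: "s\<^sup>2 = 1 - \<rho>\<^sup>2" "s \<ge> 0" using \<rho> by (auto simp: s_def power_le_one)
  have r: "(sqrt (1 - (\<rho>\<^sup>2)\<^sup>2))\<^sup>2 = (\<rho> * s)\<^sup>2 + s\<^sup>2"
  proof -
    have "(\<rho>\<^sup>2)\<^sup>2 \<le> 1" using \<rho> by (simp add: power_le_one)
    then show ?thesis unfolding power_mult_distrib s(1) by (simp add: power2_eq_square algebra_simps)
  qed
  have "(\<integral>z. (\<integral>w. F (\<rho>\<^sup>2 *\<^sub>R x + ((\<rho> * s) *\<^sub>R z + s *\<^sub>R w)) \<partial>gauss) \<partial>gauss)
      = (\<integral>z. F (\<rho>\<^sup>2 *\<^sub>R x + sqrt (1 - (\<rho>\<^sup>2)\<^sup>2) *\<^sub>R z) \<partial>gauss)"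
  proof (rule gauss_integral_add(3)[OF _ _ s(2) r])
    show "integrable gauss (\<lambda>z. F (\<rho>\<^sup>2 *\<^sub>R x + sqrt (1 - (\<rho>\<^sup>2)\<^sup>2) *\<^sub>R z))"
      using F by (intro gauss.integrable_const_bound[of _ C]) auto
    show "0 \<le> sqrt (1 - (\<rho>\<^sup>2)\<^sup>2)" using \<rho> by (simp add: power_le_one)
  qed (use s \<rho> in auto)
  then show ?thesis
    unfolding ou_def s_def[symmetric] by (simp add: algebra_simps power2_eq_square)
qed

lemma gauss_integral_rotated:
  fixes F :: "real^'n \<Rightarrow> real"
  assumes [measurable]: "F \<in> borel_measurable borel" and F: "integrable gauss F" and \<rho>: "0 \<le> \<rho>" "\<rho> \<le> 1"
  shows "integrable (gauss \<Otimes>\<^sub>M gauss) (\<lambda>z. F (\<rho> *\<^sub>R fst z + sqrt (1 - \<rho>\<^sup>2) *\<^sub>R snd z))"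
    "(\<integral>z. F (\<rho> *\<^sub>R fst z + sqrt (1 - \<rho>\<^sup>2) *\<^sub>R snd z) \<partial>(gauss \<Otimes>\<^sub>M gauss)) = (\<integral>z. F z \<partial>gauss)"
    "(\<integral>x. ou \<rho> F x \<partial>gauss) = (\<integral>x. F x \<partial>gauss)"
  using gauss_integral_add[of F \<rho> "sqrt (1 - \<rho>\<^sup>2)" 1] F \<rho>
  by (auto simp: power_le_one ou_def)

text \<open>Average |F x - F y| \<le> L (|x| + |y|) over y. This turns a Lipschitz constant into
  pointwise bounds and hence into moment bounds.\<close>

lemma gauss_deviation_bound:
  fixes F :: "real^'n \<Rightarrow> real"
  assumes L: "L-lipschitz_on UNIV F" and F: "integrable gauss F"
  shows "\<bar>F x - (\<integral>y. F y \<partial>gauss)\<bar> \<le> L * (norm x + (\<integral>y. norm y \<partial>(gauss :: (real^'n) measure)))"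
proof -
  have inorm: "integrable gauss (\<lambda>y::real^'n. norm y)"
    using integrable_gauss_norm_power[of 0 1] by simp
  have "\<bar>F x - (\<integral>y. F y \<partial>gauss)\<bar> = \<bar>\<integral>y. F x - F y \<partial>gauss\<bar>"
    using F by simp
  also have "\<dots> \<le> (\<integral>y. \<bar>F x - F y\<bar> \<partial>gauss)"
    by (rule integral_abs_bound)
  also have "\<dots> \<le> (\<integral>y. L * (norm x + norm y) \<partial>(gauss :: (real^'n) measure))"
  proof (rule integral_mono)
    fix y
    have "\<bar>F x - F y\<bar> \<le> L * norm (x - y)"
      using L by (rule lipschitz_realD)
    also have "\<dots> \<le> L * (norm x + norm y)"
      using lipschitz_on_nonneg[OF L] by (intro mult_left_mono norm_triangle_ineq4) auto
    finally show "\<bar>F x - F y\<bar> \<le> L * (norm x + norm y)" .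
  qed (use F inorm in auto)
  also have "\<dots> = L * (norm x + (\<integral>y. norm y \<partial>(gauss :: (real^'n) measure)))"
    using inorm by simp
  finally show ?thesis .
qed

text \<open>The operator \<open>ou \<rho>\<close> contracts Lipschitz constants by \<open>\<rho>\<close>, so iterates of a centred Lipschitz
  function decay in \<open>L\<^sup>2\<close> at the right rate up to a constant; the ratio of norms is
  supermultiplicative along powers of \<open>\<rho>\<close>, which removes the constant.\<close>
lemma ou_spectral_gap:
  fixes G :: "real^'n \<Rightarrow> real"
  assumes L: "L-lipschitz_on UNIV G" and G: "\<And>x. \<bar>G x\<bar> \<le> C" and mean: "(\<integral>x. G x \<partial>gauss) = 0"
    and \<rho>: "0 < \<rho>" "\<rho> \<le> 1"
  shows "(\<integral>x. (ou \<rho> G x)\<^sup>2 \<partial>gauss) \<le> \<rho>\<^sup>2 * (\<integral>x. (G x)\<^sup>2 \<partial>gauss)"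
proof -
  note [measurable] = lipschitz_borel_measurable[OF L]
  have G': "- C \<le> G x" "G x \<le> C" for x using G[of x] by (auto simp: abs_le_iff)
  have oub: "\<bar>ou r G x\<bar> \<le> C" for r x
    using ou_bounds[OF lipschitz_borel_measurable[OF L] G', of r x] by (auto simp: abs_le_iff)
  have bint: "integrable gauss (\<lambda>x. H x * K x)"
    if "\<And>x. \<bar>H x\<bar> \<le> C" "\<And>x. \<bar>K x\<bar> \<le> C" "H \<in> borel_measurable borel" "K \<in> borel_measurable borel"
    for H K :: "real^'n \<Rightarrow> real"
    using that by (intro gauss.integrable_const_bound[of _ "C * C"]) (auto simp: abs_mult intro!: mult_mono')
  define N where "N r = (\<integral>x. (ou r G x)\<^sup>2 \<partial>gauss)" for r
  define N0 where "N0 = (\<integral>x. (G x)\<^sup>2 \<partial>gauss)"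
  define \<kappa> where "\<kappa> = (\<integral>y. norm y \<partial>(gauss :: (real^'n) measure))"
  define K where "K = L\<^sup>2 * (\<integral>x. (norm x + \<kappa>)\<^sup>2 \<partial>(gauss :: (real^'n) measure))"
  have \<kappa>0: "\<kappa> \<ge> 0" by (simp add: \<kappa>_def)
  \<comment> \<open>Decay of the right order in r, but with a constant K in place of the squared
    norm of G. The mean stays zero under \<open>ou\<close>, so the deviation bound is a bound on the
    function itself.\<close>
  have NK: "N r \<le> K * r\<^sup>2" if r: "0 \<le> r" "r \<le> 1" for r
  proof -
    have om: "(\<integral>x. ou r G x \<partial>gauss) = 0"
      using gauss_integral_rotated(3)[of G, OF _ gauss_integral_bounds(1)[of G, OF _ G'] r] mean by simp
    have pt: "\<bar>ou r G x\<bar> \<le> r * L * (norm x + \<kappa>)" for x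
      using gauss_deviation_bound[OF ou_lipschitz[OF L G' r(1)] gauss.integrable_const_bound[of _ C], of x] oub om
      by (simp add: \<kappa>_def)
    have "N r \<le> (\<integral>x. (r * L)\<^sup>2 * (norm x + \<kappa>)\<^sup>2 \<partial>(gauss :: (real^'n) measure))"
      unfolding N_def
    proof (rule integral_mono)
      show "integrable gauss (\<lambda>x. (ou r G x)\<^sup>2)"
        unfolding power2_eq_square by (rule bint) (use oub in auto)
      show "integrable gauss (\<lambda>x::real^'n. (r * L)\<^sup>2 * (norm x + \<kappa>)\<^sup>2)"
        by (intro integrable_mult_right integrable_gauss_norm_power \<kappa>0)
      show "(ou r G x)\<^sup>2 \<le> (r * L)\<^sup>2 * (norm x + \<kappa>)\<^sup>2" for x
        using power_mono[OF pt[of x], of 2] by (simp add: power_mult_distrib)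
    qed
    then show ?thesis by (simp add: K_def power_mult_distrib mult_ac)
  qed
  \<comment> \<open>By symmetry and the semigroup law, N r is the inner product of G with
    \<open>ou (r\<^sup>2) G\<close>, and Cauchy-Schwarz applies. For the ratio N / N0 this says that
    its square at r is at most its value at r^2.\<close>
  have NN: "(N r)\<^sup>2 \<le> N0 * N (r\<^sup>2)" if r: "0 < r" "r \<le> 1" for r
  proof -
    have "N r = (\<integral>x. ou r G x * ou r G x \<partial>gauss)" by (simp add: N_def power2_eq_square)
    also have "\<dots> = (\<integral>x. G x * ou r (ou r G) x \<partial>gauss)"
      by (rule ou_symmetric[OF _ _ G oub r, symmetric]) auto
    also have "\<dots> = (\<integral>x. G x * ou (r\<^sup>2) G x \<partial>gauss)"
      using r by (subst ou_ou[OF _ G]) auto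
    finally show ?thesis
      unfolding N0_def N_def
      using Cauchy_Schwarz_integral[of gauss G "ou (r\<^sup>2) G"] oub G by (simp add: bint power2_eq_square)
  qed
  have "N0 \<ge> 0" by (simp add: N0_def)
  have "N \<rho> \<le> \<rho>\<^sup>2 * N0"
  proof (cases "N0 = 0")
    case True
    then have "(N \<rho>)\<^sup>2 \<le> 0" using NN[OF \<rho>] by simp
    then show ?thesis using True by simp
  next
    case False
    then have N0: "N0 > 0" using \<open>N0 \<ge> 0\<close> by simp
    define q where "q = N \<rho> / N0"
    have q: "q ^ (2 ^ k) \<le> N (\<rho> ^ (2 ^ k)) / N0" for k
    proof (induction k)
      case 0 show ?case by (simp add: q_def)
    next
      case (Suc k)
      have "q \<ge> 0" using N0 by (simp add: q_def N_def)
      have "q ^ (2 ^ Suc k) = (q ^ 2 ^ k)\<^sup>2" by (simp add: power_mult[symmetric] mult.commute)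
      also have "\<dots> \<le> (N (\<rho> ^ (2 ^ k)) / N0)\<^sup>2"
        using Suc \<open>q \<ge> 0\<close> by (intro power_mono) auto
      also have "\<dots> \<le> N0 * N ((\<rho> ^ (2 ^ k))\<^sup>2) / N0\<^sup>2"
        using NN[of "\<rho> ^ (2 ^ k)"] \<rho> by (simp add: power_divide divide_right_mono power_le_one)
      also have "\<dots> = N (\<rho> ^ (2 ^ Suc k)) / N0"
        using N0 by (simp add: power2_eq_square[of N0] power_mult[symmetric] mult.commute)
      finally show ?case .
    qed
    \<comment> \<open>Otherwise q / \<rho>^2 > 1 has unbounded powers, whereas the iterated
      inequality \<open>q\<close> together with \<open>NK\<close> bounds the powers with exponent
      2^k by K / N0.\<close>
    have "q \<le> \<rho>\<^sup>2"
    proof (rule ccontr)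
      assume "\<not> q \<le> \<rho>\<^sup>2"
      then have gt: "q / \<rho>\<^sup>2 > 1" using \<rho> by simp
      have bd: "(q / \<rho>\<^sup>2) ^ (2 ^ k) \<le> K / N0" for k
      proof -
        have "q ^ (2 ^ k) \<le> K * (\<rho> ^ (2 ^ k))\<^sup>2 / N0"
          using q[of k] NK[of "\<rho> ^ (2 ^ k)"] \<rho> N0
          by (smt (verit) divide_right_mono power_le_one zero_le_power)
        also have "(\<rho> ^ (2 ^ k))\<^sup>2 = (\<rho>\<^sup>2) ^ (2 ^ k)" by (simp add: power_mult[symmetric] mult.commute)
        finally show ?thesis using \<rho> N0 by (simp add: power_divide field_simps)
      qed
      obtain n where n: "K / N0 < (q / \<rho>\<^sup>2) ^ n" using real_arch_pow[OF gt] by blast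
      have "(q / \<rho>\<^sup>2) ^ n \<le> (q / \<rho>\<^sup>2) ^ (2 ^ n)"
        using gt by (intro power_increasing) (auto simp: less_imp_le[OF less_exp])
      then show False using bd[of n] n by simp
    qed
    then show ?thesis using N0 by (simp add: q_def field_simps)
  qed
  then show ?thesis by (simp add: N_def N0_def)
qed

text \<open>Integrating out the second variable turns the left side into the inner product of F with
  \<open>ou \<rho> G\<close>; Cauchy-Schwarz and the spectral gap then supply the factor
  \<rho>.\<close>

lemma Gebelein_inequality:
  fixes F G :: "real^'n \<Rightarrow> real"
  assumes [measurable]: "F \<in> borel_measurable borel" and F: "\<And>x. \<bar>F x\<bar> \<le> C"
    and L: "L-lipschitz_on UNIV G" and G: "\<And>x. \<bar>G x\<bar> \<le> C" and mean: "(\<integral>x. G x \<partial>gauss) = 0"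
    and \<rho>: "0 < \<rho>" "\<rho> \<le> 1"
  shows "(\<integral>z. F (fst z) * G (\<rho> *\<^sub>R fst z + sqrt (1 - \<rho>\<^sup>2) *\<^sub>R snd z) \<partial>(gauss \<Otimes>\<^sub>M gauss))
    \<le> \<rho> * (sqrt (\<integral>x. (F x)\<^sup>2 \<partial>gauss) * sqrt (\<integral>x. (G x)\<^sup>2 \<partial>gauss))"
proof -
  note [measurable] = lipschitz_borel_measurable[OF L]
  have G': "- C \<le> G x" "G x \<le> C" for x using G[of x] by (auto simp: abs_le_iff)
  have oub: "\<bar>ou r G x\<bar> \<le> C" for r x
    using ou_bounds[OF lipschitz_borel_measurable[OF L] G', of r x] by (auto simp: abs_le_iff)
  have bint: "integrable gauss (\<lambda>x. H x * K x)"
    if "\<And>x. \<bar>H x\<bar> \<le> C" "\<And>x. \<bar>K x\<bar> \<le> C" "H \<in> borel_measurable borel" "K \<in> borel_measurable borel"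
    for H K :: "real^'n \<Rightarrow> real"
    using that by (intro gauss.integrable_const_bound[of _ "C * C"]) (auto simp: abs_mult intro!: mult_mono')
  have "(\<integral>x. F x * ou \<rho> G x \<partial>gauss)\<^sup>2 \<le> (\<integral>x. (F x)\<^sup>2 \<partial>gauss) * (\<integral>x. (ou \<rho> G x)\<^sup>2 \<partial>gauss)"
    using Cauchy_Schwarz_integral[of gauss F "ou \<rho> G"] oub F by (simp add: bint power2_eq_square)
  also have "\<dots> \<le> (\<integral>x. (F x)\<^sup>2 \<partial>gauss) * (\<rho>\<^sup>2 * (\<integral>x. (G x)\<^sup>2 \<partial>gauss))"
    by (intro mult_left_mono ou_spectral_gap[OF L G mean \<rho>]) auto
  finally have "\<bar>\<integral>x. F x * ou \<rho> G x \<partial>gauss\<bar> \<le> sqrt ((\<integral>x. (F x)\<^sup>2 \<partial>gauss) * (\<rho>\<^sup>2 * (\<integral>x. (G x)\<^sup>2 \<partial>gauss)))"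
    by (simp add: real_le_rsqrt)
  also have "\<dots> = \<rho> * (sqrt (\<integral>x. (F x)\<^sup>2 \<partial>gauss) * sqrt (\<integral>x. (G x)\<^sup>2 \<partial>gauss))"
    using \<rho> by (simp add: real_sqrt_mult)
  finally show ?thesis by (subst ou_pair[OF _ _ F G, symmetric]) auto
qed

section \<open>Two-function inequality for a short time step\<close>

text \<open>The third derivative of (1 + t) powr \<alpha> is positive. For u < 0 the Lagrange
  remainder is therefore nonpositive, however close u is to -1; for u > 0 the derivative is at most
  2, and 2/6 \<le> 1. This makes the cubic error uniform up to the singularity at -1.\<close>

lemma powr_Taylor_bound:
  fixes u \<alpha> :: real
  assumes u: "u > -1" and \<alpha>: "0 < \<alpha>" "\<alpha> < 1"
  shows "(1 + u) powr \<alpha> \<le> 1 + \<alpha> * u - \<alpha> * (1 - \<alpha>) / 2 * u\<^sup>2 + \<bar>u\<bar> ^ 3"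
proof (cases "u = 0")
  case False
  define d where "d m t = (\<Prod>i<m. \<alpha> - real i) * (1 + t) powr (\<alpha> - real m)" for m t
  have "\<exists>t. (if u < 0 then u < t \<and> t < 0 else 0 < t \<and> t < u) \<and>
      (1 + u) powr \<alpha> = (\<Sum>m<3. d m 0 / fact m * (u - 0) ^ m) + d 3 t / fact 3 * (u - 0) ^ 3"
  proof (rule Taylor[where a = "min u 0" and b = "max u 0"])
    show "d 0 = (\<lambda>u. (1 + u) powr \<alpha>)" by (simp add: d_def fun_eq_iff)
    show "\<forall>m t. m < 3 \<and> min u 0 \<le> t \<and> t \<le> max u 0 \<longrightarrow> (d m has_real_derivative d (Suc m) t) (at t)"
    proof (intro allI impI)
      fix m :: nat and t :: real assume "m < 3 \<and> min u 0 \<le> t \<and> t \<le> max u 0"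
      then have t: "1 + t > 0" using u by (auto simp: min_def split: if_splits)
      show "(d m has_real_derivative d (Suc m) t) (at t)"
      proof -
        have "((\<lambda>t. (1 + t) powr (\<alpha> - real m)) has_real_derivative
            (\<alpha> - real m) * (1 + t) powr (\<alpha> - real m - of_nat 1) * 1) (at t)"
          using t by (intro DERIV_fun_powr[where g = "\<lambda>t. 1 + t"]) (auto intro!: derivative_eq_intros)
        from DERIV_cmult[OF this, of "\<Prod>i<m. \<alpha> - real i"] show ?thesis
          unfolding d_def[abs_def] by (simp add: mult_ac diff_diff_eq add.commute)
      qed
    qed
  qed (use False in auto)
  then obtain t where t: "if u < 0 then u < t \<and> t < 0 else 0 < t \<and> t < u"
    and eq: "(1 + u) powr \<alpha> = (\<Sum>m<3. d m 0 / fact m * (u - 0) ^ m) + d 3 t / fact 3 * (u - 0) ^ 3"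
    by blast
  have s: "(\<Sum>m<3. d m 0 / fact m * (u - 0) ^ m) = 1 + \<alpha> * u - \<alpha> * (1 - \<alpha>) / 2 * u\<^sup>2"
    by (simp add: d_def eval_nat_numeral field_simps)
  have d3: "d 3 t = \<alpha> * (1 - \<alpha>) * (2 - \<alpha>) * (1 + t) powr (\<alpha> - 3)"
    by (simp add: d_def eval_nat_numeral algebra_simps)
  have "d 3 t / fact 3 * (u - 0) ^ 3 \<le> \<bar>u\<bar> ^ 3"
  proof (cases "u < 0")
    case True
    have "d 3 t \<ge> 0" unfolding d3 using \<alpha> by simp
    then have "d 3 t / fact 3 * (u - 0) ^ 3 \<le> 0"
      using True by (intro mult_nonneg_nonpos) (auto simp: power3_eq_cube mult_nonneg_nonpos mult_nonpos_nonpos)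
    then show ?thesis by (rule order_trans) simp
  next
    case u0: False
    then have "(1 + t) powr (\<alpha> - 3) \<le> (1 + t) powr 0"
      using t \<alpha> by (intro powr_mono) auto
    then have "(1 + t) powr (\<alpha> - 3) \<le> 1" using t u0 by simp
    moreover have "\<alpha> * (1 - \<alpha>) \<le> 1 * 1" using \<alpha> by (intro mult_mono) auto
    ultimately have "\<alpha> * (1 - \<alpha>) * (2 - \<alpha>) * (1 + t) powr (\<alpha> - 3) \<le> 1 * 2 * 1"
      using \<alpha> by (intro mult_mono) auto
    then have "d 3 t / fact 3 \<le> 1" unfolding d3 by (simp add: fact_numeral)
    then have "d 3 t / fact 3 * u ^ 3 \<le> 1 * u ^ 3"
      using u0 by (intro mult_right_mono) auto
    then show ?thesis using u0 by simp
  qed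
  then show ?thesis unfolding eq s by simp
qed simp

text \<open>The one-variable bounds are multiplied out. Each product of total degree three or more
  is dominated by |u|^3 + |v|^3 times a power of M, and the coefficients collect to 3 + 3 M + M^3
  \<le> 3 (1 + M)^3.\<close>

lemma powr_product_Taylor_bound:
  fixes u v \<alpha> \<beta> M :: real
  assumes u: "u > -1" "\<bar>u\<bar> \<le> M" and v: "v > -1" "\<bar>v\<bar> \<le> M"
    and \<alpha>: "0 < \<alpha>" "\<alpha> < 1" and \<beta>: "0 < \<beta>" "\<beta> < 1"
  shows "(1 + u) powr \<alpha> * (1 + v) powr \<beta> \<le> 1 + \<alpha> * u + \<beta> * v + \<alpha> * \<beta> * (u * v)
     - \<alpha> * (1 - \<alpha>) / 2 * u\<^sup>2 - \<beta> * (1 - \<beta>) / 2 * v\<^sup>2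
     + 3 * (1 + M) ^ 3 * (\<bar>u\<bar> ^ 3 + \<bar>v\<bar> ^ 3)"
proof -
  define a b where "a = \<alpha> * (1 - \<alpha>) / 2" and "b = \<beta> * (1 - \<beta>) / 2"
  have a: "0 \<le> a" "a \<le> 1" and b: "0 \<le> b" "b \<le> 1"
    using \<alpha> \<beta> mult_mono[of \<alpha> 1 "1 - \<alpha>" 1] mult_mono[of \<beta> 1 "1 - \<beta>" 1] by (auto simp: a_def b_def)
  define p q where "p = \<bar>u\<bar>" and "q = \<bar>v\<bar>"
  have p: "0 \<le> p" "p \<le> M" and q: "0 \<le> q" "q \<le> M" using u v by (auto simp: p_def q_def)
  have M: "0 \<le> M" using p by simp
  define S where "S = p ^ 3 + q ^ 3"
  \<comment> \<open>A mixed cubic term is absorbed by the cube of the larger variable.\<close>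
  have amgm: "x * y\<^sup>2 \<le> x ^ 3 + y ^ 3" if "0 \<le> x" "0 \<le> y" for x y :: real
  proof (cases "x \<le> y")
    case True
    then have "x * y\<^sup>2 \<le> y * y\<^sup>2" by (intro mult_right_mono) auto
    then show ?thesis using that by (simp add: power3_eq_cube power2_eq_square add_increasing)
  next
    case False
    then have "x * y\<^sup>2 \<le> x * x\<^sup>2" using that by (intro mult_left_mono power_mono) auto
    then show ?thesis using that by (simp add: power3_eq_cube power2_eq_square add_increasing2)
  qed
  have pS: "p ^ 3 \<le> S" "q ^ 3 \<le> S" "p * q\<^sup>2 \<le> S" "q * p\<^sup>2 \<le> S" "0 \<le> S"
    using amgm[of p q] amgm[of q p] p q by (auto simp: S_def)
  have U: "(1 + u) powr \<alpha> \<le> 1 + \<alpha> * u - a * u\<^sup>2 + p ^ 3"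
    using powr_Taylor_bound[OF u(1) \<alpha>] by (simp add: a_def p_def)
  have V: "(1 + v) powr \<beta> \<le> 1 + \<beta> * v - b * v\<^sup>2 + q ^ 3"
    using powr_Taylor_bound[OF v(1) \<beta>] by (simp add: b_def q_def)
  have uu: "u\<^sup>2 = p\<^sup>2" "v\<^sup>2 = q\<^sup>2" by (auto simp: p_def q_def)
  have au: "\<alpha> * u \<le> p" "- (\<alpha> * u) \<le> p" "\<beta> * v \<le> q" "- (\<beta> * v) \<le> q"
    using \<alpha> \<beta> mult_mono[of \<alpha> 1 "\<bar>u\<bar>" "\<bar>u\<bar>"] mult_mono[of \<beta> 1 "\<bar>v\<bar>" "\<bar>v\<bar>"]
    unfolding p_def q_def by (auto simp: abs_mult abs_le_iff intro: order_trans[OF abs_ge_self] order_trans[OF abs_ge_minus_self])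
  have t1: "- (\<alpha> * u) * (b * q\<^sup>2) \<le> S"
  proof -
    have "- (\<alpha> * u) * (b * q\<^sup>2) \<le> p * (1 * q\<^sup>2)" using au b p by (intro mult_mono) auto
    then show ?thesis using pS by simp
  qed
  have t2: "\<alpha> * u * q ^ 3 \<le> M * S"
  proof -
    have "\<alpha> * u * q ^ 3 \<le> M * S" using au p q pS by (intro mult_mono) auto
    then show ?thesis .
  qed
  have t3: "- (\<beta> * v) * (a * p\<^sup>2) \<le> S"
  proof -
    have "- (\<beta> * v) * (a * p\<^sup>2) \<le> q * (1 * p\<^sup>2)" using au a q by (intro mult_mono) auto
    then show ?thesis using pS by simp
  qed
  have t4: "\<beta> * v * p ^ 3 \<le> M * S"
    using au p q pS by (intro mult_mono) auto
  have t5: "a * p\<^sup>2 * (b * q\<^sup>2) \<le> M * S"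
  proof -
    have "a * p\<^sup>2 * (b * q\<^sup>2) \<le> 1 * p\<^sup>2 * (1 * q\<^sup>2)" using a b by (intro mult_mono) auto
    also have "\<dots> = p * (p * q\<^sup>2)" by (simp add: power2_eq_square)
    also have "\<dots> \<le> M * S" using p pS M by (intro mult_mono) auto
    finally show ?thesis .
  qed
  have t6: "0 \<le> a * p\<^sup>2 * q ^ 3" "0 \<le> p ^ 3 * (b * q\<^sup>2)" using a b p q by auto
  have t7: "p ^ 3 * q ^ 3 \<le> M ^ 3 * S" using p q pS by (intro mult_mono power_mono) auto
  have V0: "0 \<le> 1 + \<beta> * v - b * v\<^sup>2 + q ^ 3" using V by (rule order_trans[rotated]) simp
  have "(1 + u) powr \<alpha> * (1 + v) powr \<beta> \<le> (1 + \<alpha> * u - a * u\<^sup>2 + p ^ 3) * (1 + \<beta> * v - b * v\<^sup>2 + q ^ 3)"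
    by (rule order_trans[OF mult_right_mono[OF U] mult_left_mono[OF V]])
       (auto intro: order_trans[OF _ U])
  \<comment> \<open>The two products of a quadratic with a cubic term, subtracted at the end, are
    nonnegative and get dropped. Of the remaining terms three cost S, three cost M S and one costs
    M^3 S.\<close>
  also have "\<dots> = (1 + \<alpha> * u + \<beta> * v + \<alpha> * \<beta> * (u * v) - a * u\<^sup>2 - b * v\<^sup>2) + S
      + (- (\<alpha> * u) * (b * q\<^sup>2)) + \<alpha> * u * q ^ 3 + (- (\<beta> * v) * (a * p\<^sup>2)) + \<beta> * v * p ^ 3
      + a * p\<^sup>2 * (b * q\<^sup>2) - a * p\<^sup>2 * q ^ 3 - p ^ 3 * (b * q\<^sup>2) + p ^ 3 * q ^ 3"
    unfolding uu S_def by (simp add: algebra_simps)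
  also have "\<dots> \<le> (1 + \<alpha> * u + \<beta> * v + \<alpha> * \<beta> * (u * v) - a * u\<^sup>2 - b * v\<^sup>2)
      + (3 * S + 3 * (M * S) + M ^ 3 * S)"
    using t1 t2 t3 t4 t5 t6 t7 by linarith
  also have "3 * S + 3 * (M * S) + M ^ 3 * S = (3 + 3 * M + M ^ 3) * S" by (simp add: algebra_simps)
  also have "\<dots> \<le> 3 * (1 + M) ^ 3 * S"
  proof (rule mult_right_mono[OF _ pS(5)])
    show "3 + 3 * M + M ^ 3 \<le> 3 * (1 + M) ^ 3"
      using M by (simp add: power3_eq_cube algebra_simps add_increasing2)
  qed
  finally show ?thesis by (simp add: a_def b_def S_def p_def q_def)
qed

text \<open>A centred function with Lipschitz constant L is at most L times |x| plus the mean norm,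
  so its third absolute moment is of order L^3 with a constant depending on the dimension only. With
  L of order sqrt h this is the h powr (3/2) error of a time step.\<close>

lemma gauss_third_moment_bound:
  fixes F :: "real^'n \<Rightarrow> real"
  assumes L: "L-lipschitz_on UNIV F" and F: "integrable gauss F" "(\<integral>y. F y \<partial>gauss) = 0"
  shows "integrable gauss (\<lambda>x. \<bar>F x\<bar> ^ 3)"
    and "(\<integral>x. \<bar>F x\<bar> ^ 3 \<partial>gauss) \<le> L ^ 3 *
      (\<integral>x. (norm x + (\<integral>y. norm y \<partial>(gauss :: (real^'n) measure))) ^ 3 \<partial>(gauss :: (real^'n) measure))"
proof -
  note [measurable] = lipschitz_borel_measurable[OF L]
  define \<kappa> where "\<kappa> = (\<integral>y. norm y \<partial>(gauss :: (real^'n) measure))"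
  have \<kappa>0: "\<kappa> \<ge> 0" by (simp add: \<kappa>_def)
  have i: "integrable gauss (\<lambda>x::real^'n. L ^ 3 * (norm x + \<kappa>) ^ 3)"
    by (intro integrable_mult_right integrable_gauss_norm_power \<kappa>0)
  have le: "\<bar>F x\<bar> ^ 3 \<le> L ^ 3 * (norm x + \<kappa>) ^ 3" for x
    using power_mono[OF gauss_deviation_bound[OF L F(1), of x], of 3] F(2)
    by (simp add: \<kappa>_def power_mult_distrib)
  show i3: "integrable gauss (\<lambda>x. \<bar>F x\<bar> ^ 3)"
    by (rule Bochner_Integration.integrable_bound[OF i]) (auto intro!: AE_I2 order_trans[OF le])
  have "(\<integral>x. \<bar>F x\<bar> ^ 3 \<partial>gauss) \<le> (\<integral>x. L ^ 3 * (norm x + \<kappa>) ^ 3 \<partial>(gauss :: (real^'n) measure))"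
    by (rule integral_mono[OF i3 i le])
  then show "(\<integral>x. \<bar>F x\<bar> ^ 3 \<partial>gauss) \<le> L ^ 3 *
      (\<integral>x. (norm x + (\<integral>y. norm y \<partial>(gauss :: (real^'n) measure))) ^ 3 \<partial>(gauss :: (real^'n) measure))"
    by (simp add: \<kappa>_def)
qed

text \<open>Multiplied by \<alpha> \<beta>, the hypothesis on \<rho> reads (\<alpha> \<beta>
  \<rho>)^2 \<le> \<alpha> (1 - \<alpha>) \<beta> (1 - \<beta>), which is the discriminant condition
  for this form. A and B will be the L^2 norms of the normalized increments.\<close>

lemma quadratic_form_nonpos:
  fixes \<alpha> \<beta> \<rho> A B :: real
  assumes "0 < \<alpha>" "\<alpha> < 1" "0 < \<beta>" "\<beta> < 1" "0 \<le> \<rho>" "\<rho>\<^sup>2 * (\<alpha> * \<beta>) \<le> (1 - \<alpha>) * (1 - \<beta>)" "0 \<le> A" "0 \<le> B"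
  shows "\<alpha> * \<beta> * (\<rho> * (A * B)) \<le> \<alpha> * (1 - \<alpha>) / 2 * A\<^sup>2 + \<beta> * (1 - \<beta>) / 2 * B\<^sup>2"
proof -
  define a b where "a = sqrt (\<alpha> * (1 - \<alpha>))" and "b = sqrt (\<beta> * (1 - \<beta>))"
  have "(\<alpha> * \<beta> * \<rho>)\<^sup>2 = (\<alpha> * \<beta>) * (\<rho>\<^sup>2 * (\<alpha> * \<beta>))" by (simp add: power2_eq_square)
  also have "\<dots> \<le> (\<alpha> * \<beta>) * ((1 - \<alpha>) * (1 - \<beta>))" using assms by (intro mult_left_mono) auto
  also have "\<dots> = (a * b)\<^sup>2" using assms by (simp add: a_def b_def power_mult_distrib)
  finally have "\<alpha> * \<beta> * \<rho> \<le> a * b"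
    using assms by (rule_tac power2_le_imp_le) (auto simp: a_def b_def)
  then have "\<alpha> * \<beta> * \<rho> * (A * B) \<le> a * b * (A * B)" using assms by (intro mult_right_mono) auto
  also have "\<dots> \<le> (a * A)\<^sup>2 / 2 + (b * B)\<^sup>2 / 2"
    using sum_squares_bound[of "a * A" "b * B"] by (simp add: mult_ac)
  also have "\<dots> = \<alpha> * (1 - \<alpha>) / 2 * A\<^sup>2 + \<beta> * (1 - \<beta>) / 2 * B\<^sup>2"
    using assms by (simp add: a_def b_def power_mult_distrib)
  finally show ?thesis by (simp add: mult_ac)
qed

text \<open>Dividing by the means leaves the centred deviations u = F/m - 1 and v = G/n - 1: the
  linear terms integrate to zero, Gebelein's inequality bounds the mixed term, the quadratic part is
  nonpositive and only third moments survive. The order of quantifiers matters: K does not depend on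
  F, G or l, so that it can be used again after every step.\<close>

lemma one_step_inequality:
  fixes \<alpha> \<beta> \<rho> c C :: real
  assumes \<alpha>: "0 < \<alpha>" "\<alpha> < 1" and \<beta>: "0 < \<beta>" "\<beta> < 1" and \<rho>: "0 < \<rho>" "\<rho> \<le> 1"
    and comp: "\<rho>\<^sup>2 * (\<alpha> * \<beta>) \<le> (1 - \<alpha>) * (1 - \<beta>)" and c: "0 < c" "c \<le> C"
  shows "\<exists>K\<ge>0. \<forall>(F :: real^'n \<Rightarrow> real) G l. l-lipschitz_on UNIV F \<and> l-lipschitz_on UNIV G \<and>
      (\<forall>x. c \<le> F x \<and> F x \<le> C) \<and> (\<forall>x. c \<le> G x \<and> G x \<le> C) \<longrightarrow>
      (\<integral>z. F (fst z) powr \<alpha> * G (\<rho> *\<^sub>R fst z + sqrt (1 - \<rho>\<^sup>2) *\<^sub>R snd z) powr \<beta> \<partial>(gauss \<Otimes>\<^sub>M gauss))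
      \<le> (\<integral>x. F x \<partial>gauss) powr \<alpha> * (\<integral>x. G x \<partial>gauss) powr \<beta> + K * l ^ 3"
proof -
  define \<mu>3 where "\<mu>3 = (\<integral>x. (norm x + (\<integral>y. norm y \<partial>(gauss :: (real^'n) measure))) ^ 3 \<partial>(gauss :: (real^'n) measure))"
  \<comment> \<open>Quotients of values in [c, C] by the mean lie in (0, C/c], so the deviations lie
    between -1 and C/c - 1; C/c \<ge> 1 covers the lower end.\<close>
  define M where "M = C / c"
  \<comment> \<open>The factors 1 + C bound the powers of the two means, (1/c)^3 comes from the
    Lipschitz constant l/c of the deviations, and the 2 counts their two third moments.\<close>
  define K where "K = (1 + C) * (1 + C) * (3 * (1 + M) ^ 3 * (2 * ((1/c) ^ 3 * \<mu>3)))"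
  have \<mu>3: "0 \<le> \<mu>3" by (simp add: \<mu>3_def)
  have M: "1 \<le> M" using c by (simp add: M_def)
  have K: "0 \<le> K" unfolding K_def using \<mu>3 M c by simp
  have main: "(\<integral>z. F (fst z) powr \<alpha> * G (\<rho> *\<^sub>R fst z + sqrt (1 - \<rho>\<^sup>2) *\<^sub>R snd z) powr \<beta> \<partial>(gauss \<Otimes>\<^sub>M gauss))
      \<le> (\<integral>x. F x \<partial>gauss) powr \<alpha> * (\<integral>x. G x \<partial>gauss) powr \<beta> + K * l ^ 3"
    if lF: "l-lipschitz_on UNIV F" and lG: "l-lipschitz_on UNIV G"
      and F: "\<And>x. c \<le> F x" "\<And>x. F x \<le> C" and G: "\<And>x. c \<le> G x" "\<And>x. G x \<le> C"
    for F G :: "real^'n \<Rightarrow> real" and l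
  proof -
    note [measurable] = lipschitz_borel_measurable[OF lF] lipschitz_borel_measurable[OF lG]
    define Y where "Y z = \<rho> *\<^sub>R fst z + sqrt (1 - \<rho>\<^sup>2) *\<^sub>R snd z" for z :: "(real^'n) \<times> (real^'n)"
    have [measurable]: "Y \<in> borel_measurable (borel \<Otimes>\<^sub>M borel)" unfolding Y_def by measurable
    define m n where "m = (\<integral>x. F x \<partial>gauss)" and "n = (\<integral>x. G x \<partial>gauss)"
    have iF: "integrable gauss F" and m: "c \<le> m" "m \<le> C"
      using gauss_integral_bounds[of F c C] F by (auto simp: m_def)
    have iG: "integrable gauss G" and n: "c \<le> n" "n \<le> C"
      using gauss_integral_bounds[of G c C] G by (auto simp: n_def)
    define u v where "u x = F x / m - 1" and "v x = G x / n - 1" for x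
    have dev: "-1 < H x / k - 1" "\<bar>H x / k - 1\<bar> \<le> M" "(1/c * l)-lipschitz_on UNIV (\<lambda>x. H x / k - 1)"
      if "l-lipschitz_on UNIV H" "\<And>x. c \<le> H x" "\<And>x. H x \<le> C" "c \<le> k" "k \<le> C" for H :: "real^'n \<Rightarrow> real" and k x
    proof -
      have k: "k > 0" and H: "H x > 0" for x using that(4) less_le_trans[OF c(1) that(2)[of x]] c by auto
      show "-1 < H x / k - 1" using k H[of x] by simp
      have "H x / k \<le> C / c" using that c H[of x] k by (intro frac_le) (auto simp: less_imp_le)
      moreover have "0 < H x / k" using k H[of x] by simp
      ultimately show "\<bar>H x / k - 1\<bar> \<le> M" using M unfolding M_def by linarith
      show "(1/c * l)-lipschitz_on UNIV (\<lambda>x. H x / k - 1)"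
      proof (rule lipschitz_realI)
        fix x y
        have "\<bar>(H x / k - 1) - (H y / k - 1)\<bar> = 1 / k * \<bar>H x - H y\<bar>"
          using k by (simp add: diff_divide_distrib[symmetric])
        also have "\<dots> \<le> 1 / c * (l * norm (x - y))"
          using lipschitz_realD[OF that(1), of x y] that(4) c k by (intro mult_mono frac_le) auto
        finally show "\<bar>(H x / k - 1) - (H y / k - 1)\<bar> \<le> 1 / c * l * norm (x - y)" by simp
      qed (use lipschitz_on_nonneg[OF that(1)] c in auto)
    qed
    note du = dev[OF lF F m, folded u_def[abs_def]] and dv = dev[OF lG G n, folded v_def[abs_def]]
    have du': "-1 < u x" "\<bar>u x\<bar> \<le> M" and dv': "-1 < v x" "\<bar>v x\<bar> \<le> M" for x
      using du(1,2)[of x] dv(1,2)[of x] by (simp_all add: u_def v_def)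
    have [measurable]: "u \<in> borel_measurable borel" "v \<in> borel_measurable borel"
      unfolding u_def v_def by measurable
    have iu: "integrable gauss u" and iv: "integrable gauss v"
      using du' dv' by (auto intro!: gauss.integrable_const_bound[of _ M])
    have mu: "(\<integral>x. u x \<partial>gauss) = 0"
      using iF m c by (simp add: u_def m_def[symmetric])
    have mv: "(\<integral>x. v x \<partial>gauss) = 0"
      using iG n c by (simp add: v_def n_def[symmetric])
    \<comment> \<open>By homogeneity the powers of the means factor out, and the Taylor bound is
      applied to 1 + u and 1 + v.\<close>
    have pt: "F x powr \<alpha> * G y powr \<beta> \<le> m powr \<alpha> * n powr \<beta> * (1 + \<alpha> * u x + \<beta> * v y + \<alpha> * \<beta> * (u x * v y)
        - \<alpha> * (1 - \<alpha>) / 2 * (u x)\<^sup>2 - \<beta> * (1 - \<beta>) / 2 * (v y)\<^sup>2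
        + 3 * (1 + M) ^ 3 * (\<bar>u x\<bar> ^ 3 + \<bar>v y\<bar> ^ 3))" for x y
    proof -
      have "F x = m * (1 + u x)" "G y = n * (1 + v y)" using m n c by (auto simp: u_def v_def)
      then have "F x powr \<alpha> * G y powr \<beta> = m powr \<alpha> * n powr \<beta> * ((1 + u x) powr \<alpha> * (1 + v y) powr \<beta>)"
        using m n c du'(1)[of x] dv'(1)[of y] by (simp add: powr_mult)
      then show ?thesis
        using mult_left_mono[OF powr_product_Taylor_bound[OF du' dv' \<alpha> \<beta>], of "m powr \<alpha> * n powr \<beta>" x y] by simp
    qed
    define I where "I f = (\<integral>z. f z \<partial>(gauss \<Otimes>\<^sub>M gauss))" for f :: "(real^'n) \<times> (real^'n) \<Rightarrow> real"
    have bint: "integrable (gauss \<Otimes>\<^sub>M gauss) f"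
      if "f \<in> borel_measurable (borel \<Otimes>\<^sub>M borel)" "\<And>z. \<bar>f z\<bar> \<le> k" for f :: "(real^'n) \<times> (real^'n) \<Rightarrow> real" and k
      using gauss_pair_integral_bounded(1)[OF that] .
    have pu: "\<bar>u x\<bar> ^ k \<le> M ^ k" and pv: "\<bar>v x\<bar> ^ k \<le> M ^ k" for x k
      using du' dv' by (auto intro: power_mono)
    have ip: "integrable (gauss \<Otimes>\<^sub>M gauss) (\<lambda>z::(real^'n) \<times> (real^'n). u (fst z))" "integrable (gauss \<Otimes>\<^sub>M gauss) (\<lambda>z. v (Y z))"
      "integrable (gauss \<Otimes>\<^sub>M gauss) (\<lambda>z. u (fst z) * v (Y z))"
      "integrable (gauss \<Otimes>\<^sub>M gauss) (\<lambda>z::(real^'n) \<times> (real^'n). (u (fst z))\<^sup>2)" "integrable (gauss \<Otimes>\<^sub>M gauss) (\<lambda>z. (v (Y z))\<^sup>2)"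
      "integrable (gauss \<Otimes>\<^sub>M gauss) (\<lambda>z::(real^'n) \<times> (real^'n). \<bar>u (fst z)\<bar> ^ 3)" "integrable (gauss \<Otimes>\<^sub>M gauss) (\<lambda>z. \<bar>v (Y z)\<bar> ^ 3)"
    proof -
      have "\<bar>u x * v y\<bar> \<le> M * M" for x y
        using du'(2)[of x] dv'(2)[of y] by (simp add: abs_mult mult_mono')
      then show "integrable (gauss \<Otimes>\<^sub>M gauss) (\<lambda>z. u (fst z) * v (Y z))"
        by (intro bint[of _ "M * M"]) measurable
      show "integrable (gauss \<Otimes>\<^sub>M gauss) (\<lambda>z::(real^'n) \<times> (real^'n). u (fst z))"
        using du' dv' by (intro bint[of _ M]) simp_all
      show "integrable (gauss \<Otimes>\<^sub>M gauss) (\<lambda>z. v (Y z))"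
        using du' dv' by (intro bint[of _ M]) simp_all
      show "integrable (gauss \<Otimes>\<^sub>M gauss) (\<lambda>z::(real^'n) \<times> (real^'n). (u (fst z))\<^sup>2)"
        using pu[of _ 2] pv[of _ 2] by (intro bint[of _ "M\<^sup>2"]) simp_all
      show "integrable (gauss \<Otimes>\<^sub>M gauss) (\<lambda>z. (v (Y z))\<^sup>2)"
        using pu[of _ 2] pv[of _ 2] by (intro bint[of _ "M\<^sup>2"]) simp_all
      show "integrable (gauss \<Otimes>\<^sub>M gauss) (\<lambda>z::(real^'n) \<times> (real^'n). \<bar>u (fst z)\<bar> ^ 3)"
        using pu[of _ 3] pv[of _ 3] by (intro bint[of _ "M ^ 3"]) simp_all
      show "integrable (gauss \<Otimes>\<^sub>M gauss) (\<lambda>z. \<bar>v (Y z)\<bar> ^ 3)"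
        using pu[of _ 3] pv[of _ 3] by (intro bint[of _ "M ^ 3"]) simp_all
    qed
    have If: "I (\<lambda>z. f (fst z)) = (\<integral>x. f x \<partial>gauss)" and IY: "I (\<lambda>z. f (Y z)) = (\<integral>x. f x \<partial>gauss)"
      if "f \<in> borel_measurable borel" "integrable gauss f" for f
      using that integral_gauss_pair_fst[of f] gauss_integral_rotated(2)[of f \<rho>] \<rho>
      by (auto simp: I_def Y_def)
    define A B where "A = sqrt (\<integral>x. (u x)\<^sup>2 \<partial>gauss)" and "B = sqrt (\<integral>x. (v x)\<^sup>2 \<partial>gauss)"
    have AB: "0 \<le> A" "0 \<le> B" by (auto simp: A_def B_def)
    have Iuv: "I (\<lambda>z. u (fst z) * v (Y z)) \<le> \<rho> * (A * B)"
      unfolding I_def A_def B_def Y_def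
      by (rule Gebelein_inequality[OF _ du'(2) dv(3) dv'(2) mv \<rho>]) measurable
    have I2: "I (\<lambda>z. (u (fst z))\<^sup>2) = A\<^sup>2" "I (\<lambda>z. (v (Y z))\<^sup>2) = B\<^sup>2"
    proof -
      have "integrable gauss (\<lambda>x. (u x)\<^sup>2)" "integrable gauss (\<lambda>x. (v x)\<^sup>2)"
        using pu[of _ 2] pv[of _ 2] by (auto intro!: gauss.integrable_const_bound[of _ "M\<^sup>2"])
      then show "I (\<lambda>z. (u (fst z))\<^sup>2) = A\<^sup>2" "I (\<lambda>z. (v (Y z))\<^sup>2) = B\<^sup>2"
        using If[of "\<lambda>x. (u x)\<^sup>2"] IY[of "\<lambda>x. (v x)\<^sup>2"] by (simp_all add: A_def B_def)
    qed
    have I3: "I (\<lambda>z. \<bar>u (fst z)\<bar> ^ 3) \<le> (1/c * l) ^ 3 * \<mu>3" "I (\<lambda>z. \<bar>v (Y z)\<bar> ^ 3) \<le> (1/c * l) ^ 3 * \<mu>3"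
      using If[of "\<lambda>x. \<bar>u x\<bar> ^ 3"] IY[of "\<lambda>x. \<bar>v x\<bar> ^ 3"]
        gauss_third_moment_bound[OF du(3) iu mu] gauss_third_moment_bound[OF dv(3) iv mv]
      by (auto simp: \<mu>3_def)
    have "I (\<lambda>z. F (fst z) powr \<alpha> * G (Y z) powr \<beta>)
      \<le> I (\<lambda>z. m powr \<alpha> * n powr \<beta> * (1 + \<alpha> * u (fst z) + \<beta> * v (Y z) + \<alpha> * \<beta> * (u (fst z) * v (Y z))
        - \<alpha> * (1 - \<alpha>) / 2 * (u (fst z))\<^sup>2 - \<beta> * (1 - \<beta>) / 2 * (v (Y z))\<^sup>2
        + 3 * (1 + M) ^ 3 * (\<bar>u (fst z)\<bar> ^ 3 + \<bar>v (Y z)\<bar> ^ 3)))"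
      unfolding I_def
    proof (rule integral_mono[OF _ _ pt])
      have "F x powr \<alpha> \<le> C powr \<alpha>" "G x powr \<beta> \<le> C powr \<beta>" for x
        using F[of x] G[of x] c \<alpha> \<beta> by (auto intro!: powr_mono2)
      then show "integrable (gauss \<Otimes>\<^sub>M gauss) (\<lambda>z. F (fst z) powr \<alpha> * G (Y z) powr \<beta>)"
        by (intro bint[of _ "C powr \<alpha> * C powr \<beta>"]) (auto simp: abs_mult intro!: mult_mono')
    qed (intro integrable_mult_right Bochner_Integration.integrable_add Bochner_Integration.integrable_diff ip gauss2.P.integrable_const)
    also have "\<dots> = m powr \<alpha> * n powr \<beta> * (1 + \<alpha> * I (\<lambda>z. u (fst z)) + \<beta> * I (\<lambda>z. v (Y z))
        + \<alpha> * \<beta> * I (\<lambda>z. u (fst z) * v (Y z))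
        - \<alpha> * (1 - \<alpha>) / 2 * I (\<lambda>z. (u (fst z))\<^sup>2) - \<beta> * (1 - \<beta>) / 2 * I (\<lambda>z. (v (Y z))\<^sup>2)
        + 3 * (1 + M) ^ 3 * (I (\<lambda>z. \<bar>u (fst z)\<bar> ^ 3) + I (\<lambda>z. \<bar>v (Y z)\<bar> ^ 3)))"
      using ip by (simp add: I_def gauss2.P.prob_space)
    also have "I (\<lambda>z. u (fst z)) = 0" using If[of u] iu mu by simp
    also have "I (\<lambda>z. v (Y z)) = 0" using IY[of v] iv mv by simp
    also note I2(1)
    also note I2(2)
    also have "m powr \<alpha> * n powr \<beta> * (1 + \<alpha> * 0 + \<beta> * 0
        + \<alpha> * \<beta> * I (\<lambda>z. u (fst z) * v (Y z)) - \<alpha> * (1 - \<alpha>) / 2 * A\<^sup>2 - \<beta> * (1 - \<beta>) / 2 * B\<^sup>2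
        + 3 * (1 + M) ^ 3 * (I (\<lambda>z. \<bar>u (fst z)\<bar> ^ 3) + I (\<lambda>z. \<bar>v (Y z)\<bar> ^ 3)))
      \<le> m powr \<alpha> * n powr \<beta> * (1 + 3 * (1 + M) ^ 3 * (2 * ((1/c * l) ^ 3 * \<mu>3)))"
    proof (rule mult_left_mono)
      have "\<alpha> * \<beta> * I (\<lambda>z. u (fst z) * v (Y z)) \<le> \<alpha> * \<beta> * (\<rho> * (A * B))"
        using Iuv \<alpha> \<beta> by (intro mult_left_mono) auto
      also have "\<dots> \<le> \<alpha> * (1 - \<alpha>) / 2 * A\<^sup>2 + \<beta> * (1 - \<beta>) / 2 * B\<^sup>2"
        using \<rho> by (intro quadratic_form_nonpos \<alpha> \<beta> comp AB) auto
      finally have q: "\<alpha> * \<beta> * I (\<lambda>z. u (fst z) * v (Y z)) \<le> \<alpha> * (1 - \<alpha>) / 2 * A\<^sup>2 + \<beta> * (1 - \<beta>) / 2 * B\<^sup>2" .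
      have "3 * (1 + M) ^ 3 * (I (\<lambda>z. \<bar>u (fst z)\<bar> ^ 3) + I (\<lambda>z. \<bar>v (Y z)\<bar> ^ 3))
        \<le> 3 * (1 + M) ^ 3 * (2 * ((1/c * l) ^ 3 * \<mu>3))"
        using I3 M by (intro mult_left_mono) auto
      with q show "1 + \<alpha> * 0 + \<beta> * 0 + \<alpha> * \<beta> * I (\<lambda>z. u (fst z) * v (Y z)) - \<alpha> * (1 - \<alpha>) / 2 * A\<^sup>2 - \<beta> * (1 - \<beta>) / 2 * B\<^sup>2
        + 3 * (1 + M) ^ 3 * (I (\<lambda>z. \<bar>u (fst z)\<bar> ^ 3) + I (\<lambda>z. \<bar>v (Y z)\<bar> ^ 3))
        \<le> 1 + 3 * (1 + M) ^ 3 * (2 * ((1/c * l) ^ 3 * \<mu>3))" by linarith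
    qed simp
    also have "\<dots> = m powr \<alpha> * n powr \<beta> + m powr \<alpha> * n powr \<beta> * (3 * (1 + M) ^ 3 * (2 * ((1/c * l) ^ 3 * \<mu>3)))"
      by (simp add: algebra_simps)
    also have "m powr \<alpha> * n powr \<beta> * (3 * (1 + M) ^ 3 * (2 * ((1/c * l) ^ 3 * \<mu>3)))
      \<le> (1 + C) * (1 + C) * (3 * (1 + M) ^ 3 * (2 * ((1/c * l) ^ 3 * \<mu>3)))"
    proof (rule mult_right_mono)
      have b: "t powr \<gamma> \<le> 1 + C" if "c \<le> t" "t \<le> C" "0 < \<gamma>" "\<gamma> < 1" for t \<gamma>
      proof -
        have "t powr \<gamma> \<le> (1 + C) powr \<gamma>" using that c by (intro powr_mono2) auto
        also have "\<dots> \<le> (1 + C) powr 1" using that c by (intro powr_mono) auto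
        finally show ?thesis using that c by simp
      qed
      show "m powr \<alpha> * n powr \<beta> \<le> (1 + C) * (1 + C)"
        using b[OF m \<alpha>] b[OF n \<beta>] c by (intro mult_mono) auto
      show "0 \<le> 3 * (1 + M) ^ 3 * (2 * ((1/c * l) ^ 3 * \<mu>3))"
        using M \<mu>3 c lipschitz_on_nonneg[OF lF] by simp
    qed
    also have "(1 + C) * (1 + C) * (3 * (1 + M) ^ 3 * (2 * ((1/c * l) ^ 3 * \<mu>3))) = K * l ^ 3"
      unfolding K_def power_mult_distrib by (simp only: mult_ac)
    finally show ?thesis by (simp add: I_def Y_def m_def n_def)
  qed
  show ?thesis
    by (intro exI[of _ K] conjI K allI impI, elim conjE) (rule main; simp)
qed

section \<open>Two-function inequality along the heat flow\<close>

text \<open>The transition operator of Brownian motion. It keeps bounds and Lipschitz constants, and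
  at time 1 and the point 0 it is the Gaussian mean.\<close>

definition heat :: "real \<Rightarrow> (real^'n \<Rightarrow> real) \<Rightarrow> real^'n \<Rightarrow> real" where
  "heat h F x = (\<integral>z. F (x + sqrt h *\<^sub>R z) \<partial>gauss)"

text \<open>The heat flow of a pair of Brownian motions with correlation \<rho>, driven by the
  independent z and w.\<close>

definition heat2 :: "real \<Rightarrow> real \<Rightarrow> (real^'n \<Rightarrow> real^'n \<Rightarrow> real) \<Rightarrow> real^'n \<Rightarrow> real^'n \<Rightarrow> real" where
  "heat2 \<rho> h \<Phi> x y =
    (\<integral>z. (\<integral>w. \<Phi> (x + sqrt h *\<^sub>R z) (y + sqrt h *\<^sub>R (\<rho> *\<^sub>R z + sqrt (1 - \<rho>\<^sup>2) *\<^sub>R w)) \<partial>gauss) \<partial>gauss)"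

lemma sqrt_double: "0 \<le> h \<Longrightarrow> (sqrt (2 * h))\<^sup>2 = (sqrt h)\<^sup>2 + (sqrt h)\<^sup>2"
  by simp

lemma heat_double:
  assumes [measurable]: "F \<in> borel_measurable borel" and F: "\<And>x. \<bar>F x\<bar> \<le> C" and h: "0 \<le> h"
  shows "heat (2 * h) F x = heat h (heat h F) x"
proof -
  have "(\<integral>z. (\<integral>w. F (x + (sqrt h *\<^sub>R z + sqrt h *\<^sub>R w)) \<partial>gauss) \<partial>gauss) = (\<integral>z. F (x + sqrt (2 * h) *\<^sub>R z) \<partial>gauss)"
    using h F by (intro gauss_integral_add(3) sqrt_double gauss.integrable_const_bound[of _ C]) auto
  then show ?thesis unfolding heat_def by (simp add: add.assoc)
qed

lemma heat_measurable [measurable]: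
  assumes [measurable]: "F \<in> borel_measurable borel"
  shows "heat h F \<in> borel_measurable borel"
  unfolding heat_def[abs_def] by measurable

lemma heat_bounds:
  assumes "F \<in> borel_measurable borel" "\<And>x. c \<le> F x" "\<And>x. F x \<le> C"
  shows "c \<le> heat h F x" "heat h F x \<le> C"
  unfolding heat_def using assms by (auto intro!: gauss_integral_bounds)

lemma heat_lipschitz:
  assumes "L-lipschitz_on UNIV F" "\<And>x. c \<le> F x" "\<And>x. F x \<le> C"
  shows "L-lipschitz_on UNIV (heat h F)"
  using lipschitz_gauss_average[OF assms, of 1 "sqrt h"] by (simp add: heat_def[abs_def])

lemma heat2_measurable [measurable]:
  fixes \<Phi> :: "real^'n \<Rightarrow> real^'n \<Rightarrow> real"
  assumes [measurable]: "case_prod \<Phi> \<in> borel_measurable (borel \<Otimes>\<^sub>M borel)"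
  shows "case_prod (heat2 \<rho> h \<Phi>) \<in> borel_measurable (borel \<Otimes>\<^sub>M borel)"
  unfolding heat2_def[abs_def] by measurable

text \<open>The maps f and g are arbitrary. If the integrand fails to be integrable, the Bochner
  integral is 0 by convention, which still satisfies the bound because 0 \<le> C.\<close>

lemma heat2_inner:
  fixes \<Phi> :: "real^'n \<Rightarrow> real^'n \<Rightarrow> real"
  assumes [measurable]: "case_prod \<Phi> \<in> borel_measurable (borel \<Otimes>\<^sub>M borel)" and \<Phi>: "\<And>x y. \<bar>\<Phi> x y\<bar> \<le> C"
  shows "\<bar>\<integral>w. \<Phi> (f w) (g w) \<partial>(gauss :: (real^'n) measure)\<bar> \<le> C"
proof -
  have "\<bar>\<integral>w. \<Phi> (f w) (g w) \<partial>(gauss :: (real^'n) measure)\<bar> \<le> (\<integral>w. \<bar>\<Phi> (f w) (g w)\<bar> \<partial>(gauss :: (real^'n) measure))"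
    by (rule integral_abs_bound)
  also have "\<dots> \<le> C"
  proof (cases "integrable (gauss :: (real^'n) measure) (\<lambda>w. \<bar>\<Phi> (f w) (g w)\<bar>)")
    case True
    then have "(\<integral>w. \<bar>\<Phi> (f w) (g w)\<bar> \<partial>(gauss :: (real^'n) measure)) \<le> (\<integral>w. C \<partial>(gauss :: (real^'n) measure))"
      using \<Phi> by (intro integral_mono) auto
    then show ?thesis by simp
  next
    case False
    then show ?thesis using \<Phi>[of 0 0] by (simp add: not_integrable_integral_eq order_trans[OF abs_ge_zero])
  qed
  finally show ?thesis .
qed

text \<open>Both driving Gaussians are split into two independent parts. The splitting yields the
  order z1, z2, w1, w2 of integration; Fubini exchanges z2 with w1, so that each half step has its
  own pair.\<close>

lemma heat2_double:
  fixes \<Phi> :: "real^'n \<Rightarrow> real^'n \<Rightarrow> real"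
  assumes [measurable]: "case_prod \<Phi> \<in> borel_measurable (borel \<Otimes>\<^sub>M borel)"
    and \<Phi>: "\<And>x y. \<bar>\<Phi> x y\<bar> \<le> C" and h: "0 \<le> h"
  shows "heat2 \<rho> (2 * h) \<Phi> x y = heat2 \<rho> h (heat2 \<rho> h \<Phi>) x y"
proof -
  define s where "s = sqrt (1 - \<rho>\<^sup>2)"
  define k where "k = sqrt h"
  have mi: "\<bar>\<integral>w. \<Phi> (f w) (g w) \<partial>(gauss :: (real^'n) measure)\<bar> \<le> C" for f g
    by (rule heat2_inner[OF _ \<Phi>]) measurable
  \<comment> \<open>The average over w as a function of the already scaled increment z of the first
    motion.\<close>
  define \<Psi> where "\<Psi> z = (\<integral>w. \<Phi> (x + z) (y + \<rho> *\<^sub>R z + s *\<^sub>R (sqrt (2 * h) *\<^sub>R w)) \<partial>gauss)" for z :: "real^'n"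
  have [measurable]: "\<Psi> \<in> borel_measurable borel" unfolding \<Psi>_def by measurable
  have \<Psi>: "\<Psi> z = (\<integral>w1. (\<integral>w2. \<Phi> (x + z) (y + \<rho> *\<^sub>R z + s *\<^sub>R (k *\<^sub>R w1 + k *\<^sub>R w2)) \<partial>gauss) \<partial>gauss)" for z
    unfolding \<Psi>_def k_def using h \<Phi>
    by (intro gauss_integral_add(3)[symmetric] sqrt_double gauss.integrable_const_bound[of _ C]) auto
  have \<Psi>C: "\<bar>\<Psi> z\<bar> \<le> C" for z unfolding \<Psi>_def by (rule mi)
  have "heat2 \<rho> (2 * h) \<Phi> x y = (\<integral>z. \<Psi> (sqrt (2 * h) *\<^sub>R z) \<partial>gauss)"
    unfolding heat2_def \<Psi>_def s_def[symmetric] by (simp add: algebra_simps)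
  also have "\<dots> = (\<integral>z1. (\<integral>z2. \<Psi> (k *\<^sub>R z1 + k *\<^sub>R z2) \<partial>gauss) \<partial>gauss)"
    unfolding k_def using h \<Psi>C
    by (intro gauss_integral_add(3)[symmetric] sqrt_double gauss.integrable_const_bound[of _ C]) auto
  also have "\<dots> = (\<integral>z1. (\<integral>w1. (\<integral>z2. (\<integral>w2. \<Phi> (x + (k *\<^sub>R z1 + k *\<^sub>R z2))
      (y + \<rho> *\<^sub>R (k *\<^sub>R z1 + k *\<^sub>R z2) + s *\<^sub>R (k *\<^sub>R w1 + k *\<^sub>R w2)) \<partial>gauss) \<partial>gauss) \<partial>gauss) \<partial>gauss)"
    unfolding \<Psi>
  proof (rule Bochner_Integration.integral_cong[OF refl])
    fix z1 :: "real^'n"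
    define f where "f z2 w1 = (\<integral>w2. \<Phi> (x + (k *\<^sub>R z1 + k *\<^sub>R z2))
      (y + \<rho> *\<^sub>R (k *\<^sub>R z1 + k *\<^sub>R z2) + s *\<^sub>R (k *\<^sub>R w1 + k *\<^sub>R w2)) \<partial>gauss)" for z2 w1 :: "real^'n"
    have "integrable (gauss \<Otimes>\<^sub>M gauss) (case_prod f)"
      unfolding f_def by (rule gauss_pair_integral_bounded(1)[of _ C]) (use mi in \<open>auto simp: split_beta'\<close>)
    from gauss2.Fubini_integral[OF this]
    show "(\<integral>z2. (\<integral>w1. f z2 w1 \<partial>gauss) \<partial>gauss) = (\<integral>w1. (\<integral>z2. f z2 w1 \<partial>gauss) \<partial>gauss)"
      by simp
  qed
  also have "\<dots> = heat2 \<rho> h (heat2 \<rho> h \<Phi>) x y"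
    unfolding heat2_def s_def[symmetric] k_def[symmetric] by (simp add: algebra_simps)
  finally show ?thesis .
qed

text \<open>Averaging against a probability measure is monotone and fixes constants, so an additive
  error passes through a step without amplification.\<close>

lemma heat2_mono_add:
  fixes \<Phi> \<Phi>' :: "real^'n \<Rightarrow> real^'n \<Rightarrow> real"
  assumes [measurable]: "case_prod \<Phi> \<in> borel_measurable (borel \<Otimes>\<^sub>M borel)" "case_prod \<Phi>' \<in> borel_measurable (borel \<Otimes>\<^sub>M borel)"
    and \<Phi>: "\<And>x y. \<bar>\<Phi> x y\<bar> \<le> C" and \<Phi>': "\<And>x y. \<bar>\<Phi>' x y\<bar> \<le> C"
    and le: "\<And>x y. \<Phi> x y \<le> \<Phi>' x y + e"
  shows "heat2 \<rho> h \<Phi> x y \<le> heat2 \<rho> h \<Phi>' x y + e"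
proof -
  define X Y where "X z = x + sqrt h *\<^sub>R fst z" and "Y z = y + sqrt h *\<^sub>R (\<rho> *\<^sub>R fst z + sqrt (1 - \<rho>\<^sup>2) *\<^sub>R snd z)"
    for z :: "(real^'n) \<times> (real^'n)"
  have [measurable]: "X \<in> borel_measurable (borel \<Otimes>\<^sub>M borel)" "Y \<in> borel_measurable (borel \<Otimes>\<^sub>M borel)"
    unfolding X_def Y_def by measurable
  have i: "integrable (gauss \<Otimes>\<^sub>M gauss) (\<lambda>z. \<Phi> (X z) (Y z))" "integrable (gauss \<Otimes>\<^sub>M gauss) (\<lambda>z. \<Phi>' (X z) (Y z))"
    using \<Phi> \<Phi>' by (auto intro!: gauss_pair_integral_bounded(1)[of _ C])
  have e: "heat2 \<rho> h \<Phi> x y = (\<integral>z. \<Phi> (X z) (Y z) \<partial>(gauss \<Otimes>\<^sub>M gauss))"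
    "heat2 \<rho> h \<Phi>' x y = (\<integral>z. \<Phi>' (X z) (Y z) \<partial>(gauss \<Otimes>\<^sub>M gauss))"
    using gauss2.integral_fst'[OF i(1)] gauss2.integral_fst'[OF i(2)] by (simp_all add: heat2_def X_def Y_def)
  have "heat2 \<rho> h \<Phi> x y \<le> (\<integral>z. \<Phi>' (X z) (Y z) + e \<partial>(gauss \<Otimes>\<^sub>M gauss))"
    unfolding e using i le by (intro integral_mono) auto
  also have "\<dots> = heat2 \<rho> h \<Phi>' x y + e"
    unfolding e using i by (simp add: gauss2.P.prob_space)
  finally show ?thesis .
qed

text \<open>The error of a single step of length \<open>h\<close> is of order \<open>h powr (3/2)\<close>, so it becomes
  negligible when the unit time interval is cut into \<open>2 ^ k\<close> steps.\<close>
lemma gauss_bilinear_inequality_lipschitz: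
  fixes f g :: "real^'n \<Rightarrow> real"
  assumes \<alpha>: "0 < \<alpha>" "\<alpha> < 1" and \<beta>: "0 < \<beta>" "\<beta> < 1" and \<rho>: "0 < \<rho>" "\<rho> \<le> 1"
    and comp: "\<rho>\<^sup>2 * (\<alpha> * \<beta>) \<le> (1 - \<alpha>) * (1 - \<beta>)" and c: "0 < c" "c \<le> C"
    and lf: "L-lipschitz_on UNIV f" and lg: "L-lipschitz_on UNIV g"
    and f: "\<And>x. c \<le> f x" "\<And>x. f x \<le> C" and g: "\<And>x. c \<le> g x" "\<And>x. g x \<le> C"
  shows "(\<integral>z. (\<integral>w. f z powr \<alpha> * g (\<rho> *\<^sub>R z + sqrt (1 - \<rho>\<^sup>2) *\<^sub>R w) powr \<beta> \<partial>gauss) \<partial>gauss)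
    \<le> (\<integral>x. f x \<partial>gauss) powr \<alpha> * (\<integral>x. g x \<partial>gauss) powr \<beta>"
proof -
  from one_step_inequality[where 'n = 'n, OF \<alpha> \<beta> \<rho> comp c] obtain K where K: "K \<ge> 0"
    and step: "\<And>(F :: real^'n \<Rightarrow> real) G l. l-lipschitz_on UNIV F \<Longrightarrow> l-lipschitz_on UNIV G \<Longrightarrow>
      (\<And>x. c \<le> F x) \<Longrightarrow> (\<And>x. F x \<le> C) \<Longrightarrow> (\<And>x. c \<le> G x) \<Longrightarrow> (\<And>x. G x \<le> C) \<Longrightarrow>
      (\<integral>z. F (fst z) powr \<alpha> * G (\<rho> *\<^sub>R fst z + sqrt (1 - \<rho>\<^sup>2) *\<^sub>R snd z) powr \<beta> \<partial>(gauss \<Otimes>\<^sub>M gauss))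
      \<le> (\<integral>x. F x \<partial>gauss) powr \<alpha> * (\<integral>x. G x \<partial>gauss) powr \<beta> + K * l ^ 3"
    by (smt (verit))
  define B where "B = C powr \<alpha> * C powr \<beta>"
  have pB: "\<bar>a powr \<alpha> * b powr \<beta>\<bar> \<le> B" if "c \<le> a" "a \<le> C" "c \<le> b" "b \<le> C" for a b
    unfolding B_def using that c \<alpha> \<beta> by (auto simp: abs_mult intro!: mult_mono' powr_mono2)
  \<comment> \<open>The class is stable under \<open>heat\<close> with the same L, c and C, so
    \<open>step\<close> applies at each stage with the same K.\<close>
  define adm where "adm f \<longleftrightarrow> L-lipschitz_on UNIV f \<and> (\<forall>x. c \<le> f x \<and> f x \<le> C)" for f :: "real^'n \<Rightarrow> real"
  have adm_m: "f \<in> borel_measurable borel" if "adm f" for f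
    using that lipschitz_borel_measurable by (auto simp: adm_def)
  have adm_heat: "adm (heat h f)" if "adm f" for h f
    using that heat_lipschitz[of L f c C h] heat_bounds[of f c C h] adm_m[OF that] by (auto simp: adm_def)
  \<comment> \<open>Rescaling the increment to unit size multiplies the Lipschitz constant by sqrt
    h.\<close>
  have base: "heat2 \<rho> h (\<lambda>x y. f x powr \<alpha> * g y powr \<beta>) x y
      \<le> heat h f x powr \<alpha> * heat h g y powr \<beta> + K * (sqrt h * L) ^ 3"
    if fg: "adm f" "adm g" and h: "0 \<le> h" for f g h x y
  proof -
    note [measurable] = adm_m[OF fg(1)] adm_m[OF fg(2)]
    define F G where "F z = f (x + sqrt h *\<^sub>R z)" and "G z = g (y + sqrt h *\<^sub>R z)" for z
    have l: "(sqrt h * L)-lipschitz_on UNIV (\<lambda>z. k (x + sqrt h *\<^sub>R z))" if "adm k" for k x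
    proof (rule lipschitz_realI)
      fix z z'
      have "\<bar>k (x + sqrt h *\<^sub>R z) - k (x + sqrt h *\<^sub>R z')\<bar> \<le> L * norm (x + sqrt h *\<^sub>R z - (x + sqrt h *\<^sub>R z'))"
        using that lipschitz_realD unfolding adm_def by blast
      also have "norm (x + sqrt h *\<^sub>R z - (x + sqrt h *\<^sub>R z')) = sqrt h * norm (z - z')"
        using h by (simp add: scaleR_diff_right[symmetric])
      finally show "\<bar>k (x + sqrt h *\<^sub>R z) - k (x + sqrt h *\<^sub>R z')\<bar> \<le> sqrt h * L * norm (z - z')"
        by (simp add: mult_ac)
    qed (use h lipschitz_on_nonneg[OF lf] in auto)
    have "heat2 \<rho> h (\<lambda>x y. f x powr \<alpha> * g y powr \<beta>) x y
      = (\<integral>z. F (fst z) powr \<alpha> * G (\<rho> *\<^sub>R fst z + sqrt (1 - \<rho>\<^sup>2) *\<^sub>R snd z) powr \<beta> \<partial>(gauss \<Otimes>\<^sub>M gauss))"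
      unfolding heat2_def F_def G_def
      using fg pB by (subst gauss_pair_integral_bounded(2)[of _ B, symmetric]) (auto simp: adm_def)
    also have "\<dots> \<le> (\<integral>x. F x \<partial>gauss) powr \<alpha> * (\<integral>x. G x \<partial>gauss) powr \<beta> + K * (sqrt h * L) ^ 3"
      using fg by (intro step) (auto simp: adm_def F_def[abs_def] G_def[abs_def] intro!: l)
    finally show ?thesis by (simp add: heat_def F_def G_def)
  qed
  \<comment> \<open>The functions are kept arbitrary in the induction, since one half of the time
    interval is treated with f and g replaced by their heat flows. Each doubling adds the errors of
    both halves.\<close>
  have iter: "heat2 \<rho> (2 ^ k * h) (\<lambda>x y. f x powr \<alpha> * g y powr \<beta>) x y
      \<le> heat (2 ^ k * h) f x powr \<alpha> * heat (2 ^ k * h) g y powr \<beta> + 2 ^ k * (K * (sqrt h * L) ^ 3)"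
    if "adm f" "adm g" "0 \<le> h" for f g h x y k
    using that(1,2)
  proof (induction k arbitrary: f g x y)
    case 0
    then show ?case using base that(3) by simp
  next
    case (Suc k)
    note fg = Suc.prems
    note [measurable] = adm_m[OF fg(1)] adm_m[OF fg(2)]
    let ?h = "2 ^ k * h" and ?e = "2 ^ k * (K * (sqrt h * L) ^ 3)"
    have h: "0 \<le> ?h" using that(3) by simp
    have fb: "\<bar>k x\<bar> \<le> C" if "adm k" for k x
      using that c unfolding adm_def by (metis abs_of_nonneg less_imp_le order_trans)
    have pBa: "\<bar>k1 x powr \<alpha> * k2 y powr \<beta>\<bar> \<le> B" if "adm k1" "adm k2" for k1 k2 x y
      using that by (intro pB) (auto simp: adm_def)
    have "heat2 \<rho> (2 * ?h) (\<lambda>x y. f x powr \<alpha> * g y powr \<beta>) x y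
      = heat2 \<rho> ?h (heat2 \<rho> ?h (\<lambda>x y. f x powr \<alpha> * g y powr \<beta>)) x y"
      by (rule heat2_double[OF _ pBa[OF fg] h]) measurable
    also have "\<dots> \<le> heat2 \<rho> ?h (\<lambda>x y. heat ?h f x powr \<alpha> * heat ?h g y powr \<beta>) x y + ?e"
    proof (rule heat2_mono_add[where C = B])
      show "\<bar>heat2 \<rho> ?h (\<lambda>x y. f x powr \<alpha> * g y powr \<beta>) x y\<bar> \<le> B" for x y
      proof -
        have "integrable (gauss \<Otimes>\<^sub>M gauss) (\<lambda>z. f (x + sqrt ?h *\<^sub>R fst z) powr \<alpha> *
           g (y + sqrt ?h *\<^sub>R (\<rho> *\<^sub>R fst z + sqrt (1 - \<rho>\<^sup>2) *\<^sub>R snd z)) powr \<beta>)" (is "integrable _ ?F")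
          using pBa[OF fg] by (intro gauss_pair_integral_bounded(1)[of _ B]) auto
        then have eq: "heat2 \<rho> ?h (\<lambda>x y. f x powr \<alpha> * g y powr \<beta>) x y = (\<integral>z. ?F z \<partial>(gauss \<Otimes>\<^sub>M gauss))"
          and i: "integrable (gauss \<Otimes>\<^sub>M gauss) ?F"
          using gauss2.integral_fst'[of ?F] by (simp_all add: heat2_def)
        have "\<bar>\<integral>z. ?F z \<partial>(gauss \<Otimes>\<^sub>M gauss)\<bar> \<le> (\<integral>z. \<bar>?F z\<bar> \<partial>(gauss \<Otimes>\<^sub>M gauss))"
          by (rule integral_abs_bound)
        also have "\<dots> \<le> (\<integral>z. B \<partial>(gauss \<Otimes>\<^sub>M gauss :: ((real^'n) \<times> (real^'n)) measure))"
          using i pBa[OF fg] by (intro integral_mono) auto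
        also have "\<dots> = B" by (simp add: gauss2.P.prob_space)
        finally show ?thesis unfolding eq .
      qed
    qed (use pBa[OF adm_heat[OF fg(1)] adm_heat[OF fg(2)]] Suc.IH[OF fg] in auto)
    also have "heat2 \<rho> ?h (\<lambda>x y. heat ?h f x powr \<alpha> * heat ?h g y powr \<beta>) x y
      \<le> heat ?h (heat ?h f) x powr \<alpha> * heat ?h (heat ?h g) y powr \<beta> + ?e"
      using Suc.IH[OF adm_heat[OF fg(1)] adm_heat[OF fg(2)]] .
    also have "heat ?h (heat ?h f) x = heat (2 * ?h) f x"
      by (rule heat_double[OF _ fb[OF fg(1)] h, symmetric]) measurable
    also have "heat ?h (heat ?h g) y = heat (2 * ?h) g y"
      by (rule heat_double[OF _ fb[OF fg(2)] h, symmetric]) measurable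
    finally show ?case by (simp add: mult_ac)
  qed
  have fg: "adm f" "adm g" using lf lg f g by (auto simp: adm_def)
  \<comment> \<open>Total time 1 from the point 0 gives the Gaussian integrals of the claim. With h
    = 1 / 2^k the 2^k single errors add up to K L^3 times 2 powr (-k/2).\<close>
  let ?D = "heat2 \<rho> 1 (\<lambda>x y. f x powr \<alpha> * g y powr \<beta>) 0 0 - heat 1 f 0 powr \<alpha> * heat 1 g 0 powr \<beta>"
  have "?D \<le> K * L ^ 3 * (1 / sqrt 2) ^ k" for k
  proof -
    have "?D \<le> 2 ^ k * (K * (sqrt (1 / 2 ^ k) * L) ^ 3)"
      using iter[OF fg, of "1 / 2 ^ k" k 0 0] by simp
    also have "\<dots> = K * L ^ 3 * (2 ^ k * (sqrt (1 / 2 ^ k) * sqrt (1 / 2 ^ k)) * sqrt (1 / 2 ^ k))"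
      by (simp add: power3_eq_cube mult_ac)
    also have "\<dots> = K * L ^ 3 * sqrt (1 / 2 ^ k)" by simp
    also have "sqrt (1 / 2 ^ k) = (1 / sqrt 2) ^ k"
      by (simp add: real_sqrt_divide real_sqrt_power power_divide)
    finally show ?thesis .
  qed
  moreover have "(\<lambda>k. K * L ^ 3 * (1 / sqrt 2) ^ k) \<longlonglongrightarrow> K * L ^ 3 * 0"
    by (intro tendsto_mult_left LIMSEQ_realpow_zero) auto
  ultimately have "?D \<le> K * L ^ 3 * 0"
    by (intro LIMSEQ_le_const) auto
  then show ?thesis by (simp add: heat2_def heat_def)
qed

section \<open>Hypercontractivity\<close>

lemma powr_diff_le:
  fixes x y C p :: real
  assumes "0 < x" "x \<le> C" "0 < y" "y \<le> C" "1 \<le> p"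
  shows "\<bar>x powr p - y powr p\<bar> \<le> p * C powr (p - 1) * \<bar>x - y\<bar>"
proof -
  have *: "y powr p - x powr p \<le> p * C powr (p - 1) * (y - x)" if "0 < x" "x < y" "y \<le> C" for x y
  proof -
    have "\<exists>z. x < z \<and> z < y \<and> y powr p - x powr p = (y - x) * (p * z powr (p - 1))"
      using that by (intro MVT2) (auto intro!: derivative_eq_intros)
    then obtain z where z: "x < z" "z < y" "y powr p - x powr p = (y - x) * (p * z powr (p - 1))" by blast
    have "(y - x) * (p * z powr (p - 1)) \<le> (y - x) * (p * C powr (p - 1))"
      using z that assms(5) by (intro mult_left_mono powr_mono2) auto
    then show ?thesis using z by (simp add: mult_ac)
  qed
  have m: "a powr p \<le> b powr p" if "0 < a" "a \<le> b" for a b using that assms(5) by (intro powr_mono2) auto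
  show ?thesis
    using *[of x y] *[of y x] m[of x y] m[of y x] assms by (cases x y rule: linorder_cases) auto
qed

lemma lipschitz_powr:
  fixes F :: "'a::real_normed_vector \<Rightarrow> real"
  assumes L: "L-lipschitz_on UNIV F" and F: "\<And>x. c \<le> F x" "\<And>x. F x \<le> C" and "0 < c" "1 \<le> p"
  shows "(p * C powr (p - 1) * L)-lipschitz_on UNIV (\<lambda>x. F x powr p)"
proof (rule lipschitz_realI)
  have F0: "F x > 0" for x using F(1)[of x] \<open>0 < c\<close> by linarith
  fix x y
  have "\<bar>F x powr p - F y powr p\<bar> \<le> p * C powr (p - 1) * \<bar>F x - F y\<bar>"
    using F0 F(2) \<open>1 \<le> p\<close> by (intro powr_diff_le)
  also have "\<dots> \<le> p * C powr (p - 1) * (L * norm (x - y))"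
    using \<open>1 \<le> p\<close> by (intro mult_left_mono lipschitz_realD[OF L]) auto
  finally show "\<bar>F x powr p - F y powr p\<bar> \<le> p * C powr (p - 1) * L * norm (x - y)" by (simp add: mult_ac)
qed (use lipschitz_on_nonneg[OF L] \<open>1 \<le> p\<close> in auto)

text \<open>Take f = F powr p and g = U powr r with U = \<open>ou \<rho> F\<close>, and exponents
  1/p and 1 - 1/r. The left side of the two-function inequality pairs F with
  \<open>ou \<rho>\<close> of U powr (r - 1); symmetry makes it N, the integral of U powr r, and
  dividing by N powr (1 - 1/r) leaves the claim.\<close>

lemma ou_hypercontractive_lipschitz:
  fixes F :: "real^'n \<Rightarrow> real"
  assumes p: "1 < p" "p \<le> r" and \<rho>: "\<rho> = sqrt (p - 1) / sqrt (r - 1)"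
    and L: "L-lipschitz_on UNIV F" and F: "\<And>x. c \<le> F x" "\<And>x. F x \<le> C" and c: "0 < c"
  shows "(\<integral>x. ou \<rho> F x powr r \<partial>gauss) \<le> (\<integral>x. F x powr p \<partial>gauss) powr (r / p)"
proof -
  note [measurable] = lipschitz_borel_measurable[OF L]
  have \<rho>01: "0 < \<rho>" "\<rho> \<le> 1" using p by (auto simp: \<rho>)
  have \<rho>2: "\<rho>\<^sup>2 = (p - 1) / (r - 1)" using p by (simp add: \<rho> power_divide)
  define U where "U = ou \<rho> F"
  have U: "c \<le> U x" "U x \<le> C" for x unfolding U_def using F by (auto intro!: ou_bounds)
  have [measurable]: "U \<in> borel_measurable borel" unfolding U_def by measurable
  have U0: "U x > 0" and F0: "F x > 0" for x using U(1)[of x] F(1)[of x] c by linarith+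
  have lU: "(\<rho> * L)-lipschitz_on UNIV U"
    unfolding U_def by (rule ou_lipschitz[OF L F]) (use \<rho>01 in auto)
  have cC: "c \<le> C" using F[of 0] by linarith
  define f g where "f x = F x powr p" and "g x = U x powr r" for x
  define \<alpha> \<beta> where "\<alpha> = 1 / p" and "\<beta> = 1 - 1 / r"
  define M where "M = max (p * C powr (p - 1) * L) (r * C powr (r - 1) * (\<rho> * L))"
  have lf: "M-lipschitz_on UNIV f"
    unfolding f_def by (rule lipschitz_on_mono[OF lipschitz_powr[OF L F c]]) (use p in \<open>auto simp: M_def\<close>)
  have lg: "M-lipschitz_on UNIV g"
    unfolding g_def by (rule lipschitz_on_mono[OF lipschitz_powr[OF lU U c]]) (use p in \<open>auto simp: M_def\<close>)
  define c' C' where "c' = min (c powr p) (c powr r)" and "C' = max (C powr p) (C powr r)"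
  have c': "0 < c'" using c by (auto simp: c'_def)
  have f: "c' \<le> f x" "f x \<le> C'" and g: "c' \<le> g x" "g x \<le> C'" for x
    using F[of x] U[of x] c p by (auto simp: f_def g_def c'_def C'_def min_le_iff_disj le_max_iff_disj intro: powr_mono2)
  have c'C': "c' \<le> C'" using f[of 0] by linarith
  have \<alpha>: "0 < \<alpha>" "\<alpha> < 1" and \<beta>: "0 < \<beta>" "\<beta> < 1" using p by (auto simp: \<alpha>_def \<beta>_def)
  \<comment> \<open>Equality holds: both sides are (p - 1) / (p r).\<close>
  have comp: "\<rho>\<^sup>2 * (\<alpha> * \<beta>) \<le> (1 - \<alpha>) * (1 - \<beta>)"
    unfolding \<rho>2 \<alpha>_def \<beta>_def using p by (simp add: field_simps)
  define N where "N = (\<integral>x. U x powr r \<partial>gauss)"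
  have Fb: "\<bar>F x\<bar> \<le> C" for x using F0[of x] F(2)[of x] by simp
  have Ub: "\<bar>U x powr (r - 1)\<bar> \<le> C powr (r - 1)" for x using U0[of x] U(2)[of x] p by (auto intro: powr_mono2)
  define B where "B = max C (C powr (r - 1))"
  have "(\<integral>z. (\<integral>w. f z powr \<alpha> * g (\<rho> *\<^sub>R z + sqrt (1 - \<rho>\<^sup>2) *\<^sub>R w) powr \<beta> \<partial>gauss) \<partial>gauss)
    = (\<integral>z. F z * ou \<rho> (\<lambda>x. U x powr (r - 1)) z \<partial>gauss)"
  proof -
    have "f x powr \<alpha> = F x" "g x powr \<beta> = U x powr (r - 1)" for x
    proof -
      have "p * \<alpha> = 1" "r * \<beta> = r - 1" using p by (auto simp: \<alpha>_def \<beta>_def field_simps)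
      then show "f x powr \<alpha> = F x" "g x powr \<beta> = U x powr (r - 1)"
        using F0[of x] U0[of x] by (simp_all add: f_def g_def powr_powr)
    qed
    then show ?thesis by (simp add: ou_def)
  qed
  also have "\<dots> = (\<integral>z. U z * U z powr (r - 1) \<partial>gauss)"
  proof -
    have b: "\<bar>F x\<bar> \<le> B" "\<bar>U x powr (r - 1)\<bar> \<le> B" for x
      using Fb[of x] Ub[of x] unfolding B_def by linarith+
    have m: "(\<lambda>x. U x powr (r - 1)) \<in> borel_measurable borel" by measurable
    show ?thesis
      using ou_symmetric[OF lipschitz_borel_measurable[OF L] m b \<rho>01] by (simp add: U_def)
  qed
  also have "\<dots> = N"
    unfolding N_def using powr_mult_base[OF less_imp_le[OF U0], of _ "r - 1"] by simp
  finally have "N \<le> (\<integral>x. f x \<partial>gauss) powr \<alpha> * (\<integral>x. g x \<partial>gauss) powr \<beta>"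
    using gauss_bilinear_inequality_lipschitz[OF \<alpha> \<beta> \<rho>01 comp c' c'C' lf lg f g] by simp
  then have le: "N \<le> (\<integral>x. f x \<partial>gauss) powr \<alpha> * N powr \<beta>" by (simp add: N_def g_def)
  have N0: "N > 0"
    using gauss_integral_bounds(2)[of g c' C'] g c' lipschitz_borel_measurable[OF lg] by (simp add: N_def g_def)
  \<comment> \<open>N is positive, so N powr \<beta> may be cancelled; the exponents satisfy 1/r +
    \<beta> = 1.\<close>
  have "N powr (1/r) * N powr \<beta> \<le> (\<integral>x. f x \<partial>gauss) powr \<alpha> * N powr \<beta>"
    using le N0 by (simp add: powr_add[symmetric] \<beta>_def)
  then have "N powr (1/r) \<le> (\<integral>x. f x \<partial>gauss) powr \<alpha>"
    using N0 by simp
  then have "(N powr (1/r)) powr r \<le> ((\<integral>x. f x \<partial>gauss) powr \<alpha>) powr r"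
    using p by (intro powr_mono2) auto
  then show ?thesis
    using N0 p by (simp add: powr_powr \<alpha>_def N_def U_def f_def)
qed

section \<open>Density of bounded Lipschitz functions in L^1\<close>

lemma compact_inner_approximation_gauss:
  fixes A :: "(real^'n) set"
  assumes "A \<in> sets borel" "0 < e"
  shows "\<exists>K. compact K \<and> K \<subseteq> A \<and> gauss.prob A - gauss.prob K < e"
proof (cases "gauss.prob A < e")
  case True
  then show ?thesis by (intro exI[of _ "{}"]) auto
next
  case False
  have "ennreal (gauss.prob A - e) < emeasure gauss A"
    using False \<open>0 < e\<close> by (simp add: gauss.emeasure_eq_measure ennreal_less_iff)
  also have "emeasure gauss A = (SUP K \<in> {K. K \<subseteq> A \<and> compact K}. emeasure gauss K)"
    using assms by (intro inner_regular) auto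
  finally obtain K where "K \<subseteq> A" "compact K" "ennreal (gauss.prob A - e) < emeasure gauss K"
    by (auto simp: less_SUP_iff)
  then show ?thesis
    using False by (intro exI[of _ K]) (auto simp: gauss.emeasure_eq_measure ennreal_less_iff)
qed

text \<open>For a measurable f that is not integrable the Bochner integral is 0 by convention and
  the condition empty, so this predicate says something only for integrable f.\<close>

definition lip_approx :: "(real^'n \<Rightarrow> real) \<Rightarrow> bool" where
  "lip_approx f \<longleftrightarrow> (\<forall>e>0. \<exists>g L B. L-lipschitz_on UNIV g \<and> (\<forall>x. \<bar>g x\<bar> \<le> B) \<and> (\<integral>x. \<bar>f x - g x\<bar> \<partial>gauss) < e)"

lemma bounded_lipschitz_integrable:
  fixes g :: "real^'n \<Rightarrow> real"
  assumes "L-lipschitz_on UNIV g" "\<And>x. \<bar>g x\<bar> \<le> B"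
  shows "integrable gauss g"
  using lipschitz_borel_measurable[OF assms(1)] assms(2) by (intro gauss.integrable_const_bound[of _ B]) auto

lemma gauss_dist_triangle:
  fixes f g h :: "real^'n \<Rightarrow> 'b::{banach, second_countable_topology}"
  assumes "integrable gauss f" "integrable gauss g" "integrable gauss h"
  shows "(\<integral>x. norm (f x - h x) \<partial>gauss) \<le> (\<integral>x. norm (f x - g x) \<partial>gauss) + (\<integral>x. norm (g x - h x) \<partial>gauss)"
proof -
  have "(\<integral>x. norm (f x - h x) \<partial>gauss) \<le> (\<integral>x. norm (f x - g x) + norm (g x - h x) \<partial>gauss)"
    using assms by (intro integral_mono) (auto intro: norm_triangle_ineq[THEN order_trans[rotated]] norm_diff_triangle_ineq
        norm_diff_triangle_le)
  then show ?thesis using assms by simp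
qed

lemma lip_approx_limit:
  assumes f: "integrable gauss f" and "\<And>e. 0 < e \<Longrightarrow> \<exists>g. integrable gauss g \<and> lip_approx g \<and> (\<integral>x. \<bar>f x - g x\<bar> \<partial>gauss) < e"
  shows "lip_approx f"
  unfolding lip_approx_def
proof (intro allI impI)
  fix e :: real assume "0 < e"
  then obtain g where g: "integrable gauss g" "lip_approx g" "(\<integral>x. \<bar>f x - g x\<bar> \<partial>gauss) < e/2"
    using assms(2)[of "e/2"] by auto
  then obtain h L B where h: "L-lipschitz_on UNIV h" "\<forall>x. \<bar>h x\<bar> \<le> B" "(\<integral>x. \<bar>g x - h x\<bar> \<partial>gauss) < e/2"
    unfolding lip_approx_def using \<open>0 < e\<close> by (meson half_gt_zero)
  have "(\<integral>x. \<bar>f x - h x\<bar> \<partial>gauss) < e"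
    using gauss_dist_triangle[OF f g(1) bounded_lipschitz_integrable[OF h(1)]] h(2,3) g(3) by fastforce
  then show "\<exists>g L B. L-lipschitz_on UNIV g \<and> (\<forall>x. \<bar>g x\<bar> \<le> B) \<and> (\<integral>x. \<bar>f x - g x\<bar> \<partial>gauss) < e"
    using h by blast
qed

text \<open>The cutoffs max 0 (1 - n dist (x, K)) are n-Lipschitz and converge to the indicator
  because K is closed; dominated convergence turns this into L^1 convergence.\<close>

lemma lip_approx_closed:
  fixes K :: "(real^'n) set"
  assumes K: "closed K"
  shows "lip_approx (\<lambda>x. indicator K x * c)"
\<comment> \<open>\<open>infdist\<close> to the empty set is 0 by convention, so the cutoffs would
  not vanish there.\<close>
proof (cases "K = {}")
  case True
  then show ?thesis
    unfolding lip_approx_def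
    by (auto intro!: exI[of _ "\<lambda>_. 0"] exI[of _ 0] lipschitz_on_constant)
next
  case False
  define g where "g n x = max 0 (1 - real n * infdist x K) * c" for n :: nat and x
  have lg: "(real n * \<bar>c\<bar>)-lipschitz_on UNIV (g n)" for n
  proof (rule lipschitz_realI)
    fix x y
    have "\<bar>g n x - g n y\<bar> = \<bar>max 0 (1 - real n * infdist x K) - max 0 (1 - real n * infdist y K)\<bar> * \<bar>c\<bar>"
      by (simp add: g_def abs_mult[symmetric] algebra_simps)
    also have "\<dots> \<le> \<bar>real n * infdist x K - real n * infdist y K\<bar> * \<bar>c\<bar>"
      by (intro mult_right_mono) auto
    also have "\<dots> = real n * \<bar>infdist x K - infdist y K\<bar> * \<bar>c\<bar>"
      by (simp add: abs_mult right_diff_distrib[symmetric])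
    also have "\<dots> \<le> real n * norm (x - y) * \<bar>c\<bar>"
      using infdist_triangle_abs[of x K y] by (intro mult_right_mono mult_left_mono) (auto simp: dist_norm)
    finally show "\<bar>g n x - g n y\<bar> \<le> real n * \<bar>c\<bar> * norm (x - y)" by (simp add: mult_ac)
  qed auto
  note [measurable] = lipschitz_borel_measurable[OF lg]
  have gB: "\<bar>g n x\<bar> \<le> \<bar>c\<bar>" for n x
  proof -
    have "0 \<le> max 0 (1 - real n * infdist x K)" "max 0 (1 - real n * infdist x K) \<le> 1"
      by (auto simp: infdist_nonneg)
    then show ?thesis unfolding g_def abs_mult by (intro mult_left_le_one_le) auto
  qed
  have [measurable]: "K \<in> sets borel" using K by simp
  have lim: "(\<lambda>n. g n x) \<longlonglongrightarrow> indicator K x * c" for x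
  proof (cases "x \<in> K")
    case True
    then show ?thesis by (simp add: g_def)
  next
    case x: False
    then have pos: "infdist x K > 0"
      using in_closed_iff_infdist_zero[OF K False, of x] infdist_nonneg[of x K] by linarith
    obtain m where m: "1 / infdist x K < real m" using reals_Archimedean2 by blast
    have "g n x = 0" if "n \<ge> m" for n
    proof -
      have "1 / infdist x K \<le> real n" using m that by linarith
      then have "1 \<le> real n * infdist x K" using pos by (simp add: field_simps)
      then show ?thesis by (simp add: g_def)
    qed
    then have "eventually (\<lambda>n. g n x = indicator K x * c) sequentially"
      using x by (auto simp: eventually_sequentially)
    then show ?thesis by (rule tendsto_eventually)
  qed
  have "(\<lambda>n. \<integral>x. \<bar>indicator K x * c - g n x\<bar> \<partial>gauss) \<longlonglongrightarrow> (\<integral>x. 0 \<partial>(gauss :: (real^'n) measure))"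
  proof (rule integral_dominated_convergence[where w = "\<lambda>_. 2 * \<bar>c\<bar>"])
    show "AE x in gauss. (\<lambda>n. \<bar>indicator K x * c - g n x\<bar>) \<longlonglongrightarrow> 0"
      using lim by (intro AE_I2 tendsto_rabs_zero) (auto intro!: tendsto_eq_intros)
    show "AE x in gauss. norm \<bar>indicator K x * c - g n x\<bar> \<le> 2 * \<bar>c\<bar>" for n
    proof (rule AE_I2)
      fix x
      have "\<bar>indicator K x * c - g n x\<bar> \<le> \<bar>indicator K x * c\<bar> + \<bar>g n x\<bar>" by (rule abs_triangle_ineq4)
      also have "\<bar>indicator K x * c\<bar> \<le> \<bar>c\<bar>" by (auto simp: indicator_def)
      finally show "norm \<bar>indicator K x * c - g n x\<bar> \<le> 2 * \<bar>c\<bar>" using gB[of n x] by simp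
    qed
  qed auto
  then have conv: "(\<lambda>n. \<integral>x. \<bar>indicator K x * c - g n x\<bar> \<partial>gauss) \<longlonglongrightarrow> 0" by simp
  show ?thesis
    unfolding lip_approx_def
  proof (intro allI impI)
    fix e :: real assume "0 < e"
    then obtain n where "(\<integral>x. \<bar>indicator K x * c - g n x\<bar> \<partial>gauss) < e"
      using order_tendstoD(2)[OF conv, of e] by (auto simp: eventually_sequentially)
    then show "\<exists>g L B. L-lipschitz_on UNIV g \<and> (\<forall>x. \<bar>g x\<bar> \<le> B) \<and> (\<integral>x. \<bar>indicator K x * c - g x\<bar> \<partial>gauss) < e"
      using lg gB by blast
  qed
qed

lemma lipschitz_dense_L1:
  fixes f :: "real^'n \<Rightarrow> real"
  assumes "integrable gauss f"
  shows "lip_approx f"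
  using assms
proof (induction rule: integrable_induct)
  case (base A c)
  have A: "A \<in> sets borel" using base by simp
  have iA: "integrable gauss (\<lambda>x. indicator K x * c)" if "K \<in> sets borel" for K :: "(real^'n) set"
    using that by (intro gauss.integrable_const_bound[of _ "\<bar>c\<bar>"]) (auto simp: indicator_def)
  show ?case
  proof (rule lip_approx_limit)
    fix e :: real assume "0 < e"
    \<comment> \<open>The summand 1 keeps the denominator positive for c = 0.\<close>
    then have "0 < e / (\<bar>c\<bar> + 1)" by simp
    from compact_inner_approximation_gauss[OF A this] obtain K
      where K: "compact K" "K \<subseteq> A" "gauss.prob A - gauss.prob K < e / (\<bar>c\<bar> + 1)" by blast
    have Kb: "K \<in> sets borel" by (rule borel_closed[OF compact_imp_closed[OF K(1)]])
    have "(\<integral>x. \<bar>indicator A x *\<^sub>R c - indicator K x * c\<bar> \<partial>gauss) = (\<integral>x. indicator (A - K) x * \<bar>c\<bar> \<partial>gauss)"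
      using K(2) by (intro Bochner_Integration.integral_cong) (auto simp: indicator_def)
    also have "\<dots> = gauss.prob (A - K) * \<bar>c\<bar>" using A Kb by simp
    also have "gauss.prob (A - K) = gauss.prob A - gauss.prob K"
      using A Kb K(2) by (intro gauss.finite_measure_Diff) auto
    also have "(gauss.prob A - gauss.prob K) * \<bar>c\<bar> \<le> e / (\<bar>c\<bar> + 1) * \<bar>c\<bar>"
      using K(3) by (intro mult_right_mono) auto
    also have "\<dots> < e" using \<open>0 < e\<close> by (simp add: field_simps)
    finally show "\<exists>g. integrable gauss g \<and> lip_approx g \<and> (\<integral>x. \<bar>indicator A x *\<^sub>R c - g x\<bar> \<partial>gauss) < e"
      using iA[OF Kb] lip_approx_closed[OF compact_imp_closed[OF K(1)]] by blast
  qed (use iA[OF A] in simp)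
next
  case (add f g)
  show ?case
    unfolding lip_approx_def
  proof (intro allI impI)
    fix e :: real assume "0 < e"
    then obtain f' L B g' L' B' where f': "L-lipschitz_on UNIV f'" "\<forall>x. \<bar>f' x\<bar> \<le> B" "(\<integral>x. \<bar>f x - f' x\<bar> \<partial>gauss) < e/2"
      and g': "L'-lipschitz_on UNIV g'" "\<forall>x. \<bar>g' x\<bar> \<le> B'" "(\<integral>x. \<bar>g x - g' x\<bar> \<partial>gauss) < e/2"
      using add.IH unfolding lip_approx_def by (meson half_gt_zero)
    have i: "integrable gauss f'" "integrable gauss g'"
      using f' g' by (auto intro: bounded_lipschitz_integrable)
    have "(\<integral>x. \<bar>f x + g x - (f' x + g' x)\<bar> \<partial>gauss) \<le> (\<integral>x. \<bar>f x - f' x\<bar> + \<bar>g x - g' x\<bar> \<partial>gauss)"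
      using i add.hyps by (intro integral_mono) auto
    also have "\<dots> < e" using i add.hyps f' g' by simp
    finally have "(\<integral>x. \<bar>f x + g x - (f' x + g' x)\<bar> \<partial>gauss) < e" .
    moreover have "\<bar>f' x + g' x\<bar> \<le> B + B'" for x
      using f'(2) g'(2) abs_triangle_ineq[of "f' x" "g' x"] by (smt (verit))
    ultimately show "\<exists>h L B. L-lipschitz_on UNIV h \<and> (\<forall>x. \<bar>h x\<bar> \<le> B) \<and> (\<integral>x. \<bar>f x + g x - h x\<bar> \<partial>gauss) < e"
      using lipschitz_on_add[OF f'(1) g'(1)] by blast
  qed
next
  case (lim f s)
  note [measurable] = borel_measurable_integrable[OF lim.hyps(1)] borel_measurable_integrable[OF lim.hyps(4)]
  show ?case
  proof (rule lip_approx_limit[OF lim.hyps(4)])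
    fix e :: real assume "0 < e"
    have "(\<lambda>n. \<integral>x. \<bar>f x - s n x\<bar> \<partial>gauss) \<longlonglongrightarrow> (\<integral>x. 0 \<partial>(gauss :: (real^'n) measure))"
    \<comment> \<open>The induction rule supplies |s n x| \<le> 2 |f x|, hence the dominating
      function 3 |f|.\<close>
    proof (rule integral_dominated_convergence[where w = "\<lambda>x. 3 * \<bar>f x\<bar>"])
      show "AE x in gauss. (\<lambda>n. \<bar>f x - s n x\<bar>) \<longlonglongrightarrow> 0"
        using lim.hyps(2) by (intro AE_I2 tendsto_rabs_zero) (auto intro!: tendsto_eq_intros)
      show "AE x in gauss. norm \<bar>f x - s n x\<bar> \<le> 3 * \<bar>f x\<bar>" for n
      proof (rule AE_I2)
        fix x
        show "norm \<bar>f x - s n x\<bar> \<le> 3 * \<bar>f x\<bar>"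
          using lim.hyps(3)[of x n] abs_triangle_ineq4[of "f x" "s n x"] by simp
      qed
    qed (use lim.hyps in auto)
    then obtain n where "(\<integral>x. \<bar>f x - s n x\<bar> \<partial>gauss) < e"
      using order_tendstoD(2)[of _ 0 sequentially e] \<open>0 < e\<close> by (auto simp: eventually_sequentially)
    then show "\<exists>g. integrable gauss g \<and> lip_approx g \<and> (\<integral>x. \<bar>f x - g x\<bar> \<partial>gauss) < e"
      using lim.hyps lim.IH by blast
  qed
qed

section \<open>Hypercontractivity from Lipschitz functions to all of L^p\<close>

lemma clip_lipschitz:
  fixes g :: "'a::real_normed_vector \<Rightarrow> real"
  assumes "L-lipschitz_on UNIV g"
  shows "L-lipschitz_on UNIV (\<lambda>x. max c (min C (g x)))"
proof (rule lipschitz_realI)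
  fix x y
  have "\<bar>max c (min C (g x)) - max c (min C (g y))\<bar> \<le> \<bar>g x - g y\<bar>" by linarith
  also have "\<dots> \<le> L * norm (x - y)" by (rule lipschitz_realD[OF assms])
  finally show "\<bar>max c (min C (g x)) - max c (min C (g y))\<bar> \<le> L * norm (x - y)" .
qed (use lipschitz_on_nonneg[OF assms] in auto)

text \<open>\<open>ou\<close> is positive and preserves the Gaussian mean: the pointwise bound of
  the difference by \<open>ou\<close> of |F - G| integrates to the claim.\<close>

lemma ou_L1_contraction:
  fixes F G :: "real^'n \<Rightarrow> real"
  assumes [measurable]: "F \<in> borel_measurable borel" "G \<in> borel_measurable borel"
    and F: "\<And>x. \<bar>F x\<bar> \<le> C" and G: "\<And>x. \<bar>G x\<bar> \<le> C" and \<rho>: "0 \<le> \<rho>" "\<rho> \<le> 1"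
  shows "(\<integral>x. \<bar>ou \<rho> F x - ou \<rho> G x\<bar> \<partial>gauss) \<le> (\<integral>x. \<bar>F x - G x\<bar> \<partial>gauss)"
proof -
  have D: "\<bar>F x - G x\<bar> \<le> 2 * C" for x using F[of x] G[of x] by linarith
  have i: "integrable gauss (\<lambda>y. k (\<rho> *\<^sub>R x + sqrt (1 - \<rho>\<^sup>2) *\<^sub>R y))"
    if "k \<in> borel_measurable borel" "\<And>x. \<bar>k x\<bar> \<le> 2 * C" for k :: "real^'n \<Rightarrow> real" and x
    using that by (intro gauss.integrable_const_bound[of _ "2 * C"]) auto
  have C: "0 \<le> C" using F[of 0] by linarith
  have iF: "integrable gauss (\<lambda>y. F (\<rho> *\<^sub>R x + sqrt (1 - \<rho>\<^sup>2) *\<^sub>R y))" and iG: "integrable gauss (\<lambda>y. G (\<rho> *\<^sub>R x + sqrt (1 - \<rho>\<^sup>2) *\<^sub>R y))" for x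
    using C by (auto intro!: i order_trans[OF F] order_trans[OF G])
  have ptw: "\<bar>ou \<rho> F x - ou \<rho> G x\<bar> \<le> ou \<rho> (\<lambda>x. \<bar>F x - G x\<bar>) x" for x
    unfolding ou_def Bochner_Integration.integral_diff[OF iF iG, symmetric] by (rule integral_abs_bound)
  have b: "\<bar>ou \<rho> k x\<bar> \<le> 2 * C" if [measurable]: "k \<in> borel_measurable borel" and k: "\<And>x. \<bar>k x\<bar> \<le> 2 * C" for k x
  proof -
    have "- (2 * C) \<le> k x" "k x \<le> 2 * C" for x using k[of x] by auto
    from ou_bounds[OF that(1) this, of \<rho> x] show ?thesis by auto
  qed
  have bF: "\<bar>ou \<rho> F x\<bar> \<le> 2 * C" and bG: "\<bar>ou \<rho> G x\<bar> \<le> 2 * C" and bD: "\<bar>ou \<rho> (\<lambda>x. \<bar>F x - G x\<bar>) x\<bar> \<le> 2 * C" for x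
    using D C by (auto intro!: b order_trans[OF F] order_trans[OF G])
  have "(\<integral>x. \<bar>ou \<rho> F x - ou \<rho> G x\<bar> \<partial>gauss) \<le> (\<integral>x. ou \<rho> (\<lambda>x. \<bar>F x - G x\<bar>) x \<partial>gauss)"
    using bF bG bD
    by (intro integral_mono ptw integrable_abs Bochner_Integration.integrable_diff gauss.integrable_const_bound[of _ "2 * C"]) auto
  also have "\<dots> = (\<integral>x. \<bar>F x - G x\<bar> \<partial>gauss)"
    using D by (intro gauss_integral_rotated(3) \<rho> gauss.integrable_const_bound[of _ "2 * C"]) auto
  finally show ?thesis .
qed

text \<open>On the interval [c, C] the power function is Lipschitz, so L^1 convergence of functions
  with values there passes to the powers. It is applied on both sides of the inequality, with the
  exponents p and r.\<close>

lemma tendsto_integral_powr: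
  fixes F :: "real^'n \<Rightarrow> real"
  assumes [measurable]: "F \<in> borel_measurable borel" "\<And>k. G k \<in> borel_measurable borel"
    and F: "\<And>x. c \<le> F x" "\<And>x. F x \<le> C" and G: "\<And>k x. c \<le> G k x" "\<And>k x. G k x \<le> C" and c: "0 < c" and p: "1 \<le> p"
    and lim: "(\<lambda>k. \<integral>x. \<bar>F x - G k x\<bar> \<partial>gauss) \<longlonglongrightarrow> 0"
  shows "(\<lambda>k. \<integral>x. G k x powr p \<partial>gauss) \<longlonglongrightarrow> (\<integral>x. F x powr p \<partial>gauss)"
proof -
  have b: "integrable gauss H \<and> integrable gauss (\<lambda>x. H x powr p)"
    if [measurable]: "H \<in> borel_measurable borel" and "\<And>x. c \<le> H x" "\<And>x. H x \<le> C" for H :: "real^'n \<Rightarrow> real"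
  proof -
    have "0 \<le> H x" "H x powr p \<le> C powr p" for x using that(2,3)[of x] c p by (auto intro!: powr_mono2)
    then have "integrable gauss (\<lambda>x. H x powr p)"
      by (intro gauss.integrable_const_bound[of _ "C powr p"]) auto
    with gauss_integral_bounds(1)[OF that] show ?thesis by simp
  qed
  have iF: "integrable gauss F" "integrable gauss (\<lambda>x. F x powr p)"
    and iG: "integrable gauss (G k)" "integrable gauss (\<lambda>x. G k x powr p)" for k
    using b[of F] b[of "G k"] F G by auto
  show ?thesis
  proof (rule LIM_zero_cancel, rule Lim_null_comparison)
    show "(\<lambda>k. p * C powr (p - 1) * (\<integral>x. \<bar>F x - G k x\<bar> \<partial>gauss)) \<longlonglongrightarrow> 0"
      using tendsto_mult_left[OF lim] by simp
    show "eventually (\<lambda>k. norm ((\<integral>x. G k x powr p \<partial>gauss) - (\<integral>x. F x powr p \<partial>gauss))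
      \<le> p * C powr (p - 1) * (\<integral>x. \<bar>F x - G k x\<bar> \<partial>gauss)) sequentially"
    proof (intro always_eventually allI)
      fix k
      have "norm ((\<integral>x. G k x powr p \<partial>gauss) - (\<integral>x. F x powr p \<partial>gauss)) = \<bar>\<integral>x. G k x powr p - F x powr p \<partial>gauss\<bar>"
        using iF iG by simp
      also have "\<dots> \<le> (\<integral>x. \<bar>G k x powr p - F x powr p\<bar> \<partial>gauss)" by (rule integral_abs_bound)
      also have "\<dots> \<le> (\<integral>x. p * C powr (p - 1) * \<bar>F x - G k x\<bar> \<partial>gauss)"
      proof (rule integral_mono)
        fix x
        show "\<bar>G k x powr p - F x powr p\<bar> \<le> p * C powr (p - 1) * \<bar>F x - G k x\<bar>"
          using powr_diff_le[of "G k x" C "F x" p] less_le_trans[OF c F(1)[of x]] less_le_trans[OF c G(1)[of k x]] F(2) G(2) p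
          by (simp add: abs_minus_commute)
      qed (use iF iG in auto)
      finally show "norm ((\<integral>x. G k x powr p \<partial>gauss) - (\<integral>x. F x powr p \<partial>gauss))
        \<le> p * C powr (p - 1) * (\<integral>x. \<bar>F x - G k x\<bar> \<partial>gauss)" by simp
    qed
  qed
qed

text \<open>Lipschitz approximants in L^1 are clipped to [c, C]; as F has its values there, clipping
  does not increase the distance.\<close>

lemma ou_hypercontractive_bounded:
  fixes F :: "real^'n \<Rightarrow> real"
  assumes p: "1 < p" "p \<le> r" and \<rho>: "\<rho> = sqrt (p - 1) / sqrt (r - 1)"
    and [measurable]: "F \<in> borel_measurable borel" and F: "\<And>x. c \<le> F x" "\<And>x. F x \<le> C" and c: "0 < c"
  shows "(\<integral>x. ou \<rho> F x powr r \<partial>gauss) \<le> (\<integral>x. F x powr p \<partial>gauss) powr (r / p)"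
proof -
  have \<rho>01: "0 \<le> \<rho>" "\<rho> \<le> 1" using p by (auto simp: \<rho>)
  have iF: "integrable gauss F" using F by (intro gauss_integral_bounds) auto
  define P where "P k g L \<longleftrightarrow> L-lipschitz_on UNIV g \<and> (\<forall>x. c \<le> g x \<and> g x \<le> C) \<and>
      (\<integral>x. \<bar>F x - g x\<bar> \<partial>gauss) < 1 / real (Suc k)" for k g L
  have "\<exists>g L. P k g L" for k
  proof -
    obtain g L B where g: "L-lipschitz_on UNIV g" "\<forall>x. \<bar>g x\<bar> \<le> B" "(\<integral>x. \<bar>F x - g x\<bar> \<partial>gauss) < 1 / real (Suc k)"
      using lipschitz_dense_L1[OF iF, unfolded lip_approx_def, rule_format, of "1 / real (Suc k)"] by auto
    let ?h = "\<lambda>x. max c (min C (g x))"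
    note [measurable] = lipschitz_borel_measurable[OF g(1)]
    have cC: "c \<le> C" using F[of 0] by linarith
    have "integrable gauss ?h" using cC by (intro gauss_integral_bounds[of _ c C]) auto
    moreover have "integrable gauss g" using bounded_lipschitz_integrable[OF g(1)] g(2) by blast
    ultimately have "(\<integral>x. \<bar>F x - ?h x\<bar> \<partial>gauss) \<le> (\<integral>x. \<bar>F x - g x\<bar> \<partial>gauss)"
    proof (intro integral_mono)
      fix x
      show "\<bar>F x - ?h x\<bar> \<le> \<bar>F x - g x\<bar>" using F(1)[of x] F(2)[of x] by linarith
    qed (use iF in auto)
    then show ?thesis unfolding P_def
      using clip_lipschitz[OF g(1), of c C] cC g(3) by (intro exI[of _ ?h] exI[of _ L]) auto
  qed
  then obtain G L where GL: "\<And>k. P k (G k) (L k)"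
    by metis
  have lG: "(L k)-lipschitz_on UNIV (G k)" and G: "c \<le> G k x" "G k x \<le> C"
     and d: "(\<integral>x. \<bar>F x - G k x\<bar> \<partial>gauss) < 1 / real (Suc k)" for k x
    using GL[of k] by (auto simp: P_def)
  note [measurable] = lipschitz_borel_measurable[OF lG]
  have lim: "(\<lambda>k. \<integral>x. \<bar>F x - G k x\<bar> \<partial>gauss) \<longlonglongrightarrow> 0"
    by (rule tendsto_sandwich[OF _ _ tendsto_const LIMSEQ_Suc[OF lim_1_over_n]]) (use d in \<open>auto intro!: always_eventually less_imp_le\<close>)
  have Fb: "\<bar>F x\<bar> \<le> C" and Gb: "\<bar>G k x\<bar> \<le> C" for x k using F[of x] G[of k x] c by auto
  have lim2: "(\<lambda>k. \<integral>x. \<bar>ou \<rho> F x - ou \<rho> (G k) x\<bar> \<partial>gauss) \<longlonglongrightarrow> 0"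
    by (rule tendsto_sandwich[OF _ _ tendsto_const lim])
       (auto intro!: always_eventually ou_L1_contraction[OF _ _ Fb Gb \<rho>01])
  have "(\<lambda>k. \<integral>x. G k x powr p \<partial>gauss) \<longlonglongrightarrow> (\<integral>x. F x powr p \<partial>gauss)"
    by (rule tendsto_integral_powr[OF _ _ F G c _ lim]) (use p in auto)
  then have l1: "(\<lambda>k. (\<integral>x. G k x powr p \<partial>gauss) powr (r / p)) \<longlonglongrightarrow> (\<integral>x. F x powr p \<partial>gauss) powr (r / p)"
    by (rule tendsto_powr2[OF _ tendsto_const]) (use p in auto)
  have l2: "(\<lambda>k. \<integral>x. ou \<rho> (G k) x powr r \<partial>gauss) \<longlonglongrightarrow> (\<integral>x. ou \<rho> F x powr r \<partial>gauss)"
    by (rule tendsto_integral_powr[OF _ _ _ _ _ _ c _ lim2, of C]) (use p F G in \<open>auto intro!: ou_bounds\<close>)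
  show ?thesis
    by (rule LIMSEQ_le[OF l2 l1]) (use ou_hypercontractive_lipschitz[OF p \<rho> lG G c] in blast)
qed

lemma powr_add_le:
  fixes x y p :: real
  assumes "0 \<le> x" "0 \<le> y" "0 \<le> p"
  shows "(x + y) powr p \<le> 2 powr p * (x powr p + y powr p)"
proof -
  have "(x + y) powr p \<le> (2 * max x y) powr p" using assms by (intro powr_mono2) auto
  also have "\<dots> = 2 powr p * max x y powr p" using assms by (simp add: powr_mult)
  also have "max x y powr p \<le> x powr p + y powr p" by (simp add: max_def)
  finally show ?thesis by simp
qed

lemma integrable_of_powr:
  fixes f :: "real^'n \<Rightarrow> real"
  assumes [measurable]: "f \<in> borel_measurable borel" and f: "\<And>x. 0 \<le> f x" and p: "1 \<le> p" and i: "integrable gauss (\<lambda>x. f x powr p)"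
  shows "integrable gauss f"
proof (rule Bochner_Integration.integrable_bound)
  show "integrable gauss (\<lambda>x. 1 + f x powr p)" using i by simp
  show "AE x in gauss. norm (f x) \<le> norm (1 + f x powr p)"
  proof (rule AE_I2)
    fix x
    show "norm (f x) \<le> norm (1 + f x powr p)"
    proof (cases "f x \<le> 1")
      case True
      then show ?thesis using f[of x] by (simp add: add_increasing2)
    next
      case False
      then have "f x powr 1 \<le> f x powr p" using p by (intro powr_mono) auto
      then show ?thesis using f[of x] by simp
    qed
  qed
qed measurable

text \<open>Truncation from above and a positive shift bring \<phi> into the bounded case. The right
  side converges by dominated convergence; on the left Fatou's lemma gives the bound and, with it,
  the integrability.\<close>

lemma ou_hypercontractive:
  fixes \<phi> :: "real^'n \<Rightarrow> real"
  assumes p: "1 < p" "p \<le> r" and \<rho>: "\<rho> = sqrt (p - 1) / sqrt (r - 1)"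
    and [measurable]: "\<phi> \<in> borel_measurable borel" and \<phi>: "\<And>x. 0 \<le> \<phi> x" and i: "integrable gauss (\<lambda>x. \<phi> x powr p)"
  shows "integrable gauss (\<lambda>x. ou \<rho> \<phi> x powr r)"
    and "(\<integral>x. ou \<rho> \<phi> x powr r \<partial>gauss) \<le> (\<integral>x. \<phi> x powr p \<partial>gauss) powr (r / p)"
proof -
  have \<rho>01: "0 \<le> \<rho>" "\<rho> \<le> 1" using p by (auto simp: \<rho>)
  have i\<phi>: "integrable gauss \<phi>" using \<phi> p i by (rule_tac integrable_of_powr[of _ p]) auto
  \<comment> \<open>1 / (k + 1) serves as the lower bound, with \<open>Suc\<close> to keep it
    positive at k = 0.\<close>
  define F where "F k x = min (\<phi> x) (real k) + 1 / real (Suc k)" for k x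
  have [measurable]: "F k \<in> borel_measurable borel" for k unfolding F_def by measurable
  have F: "1 / real (Suc k) \<le> F k x" "F k x \<le> real k + 1 / real (Suc k)" "F k x \<le> \<phi> x + 1" "0 \<le> F k x" for k x
  proof -
    have "1 / real (Suc k) \<le> 1" "0 < 1 / real (Suc k)" by auto
    then show "1 / real (Suc k) \<le> F k x" "F k x \<le> real k + 1 / real (Suc k)" "F k x \<le> \<phi> x + 1" "0 \<le> F k x"
      using \<phi>[of x] unfolding F_def by linarith+
  qed
  have Fl: "(\<lambda>k. F k x) \<longlonglongrightarrow> \<phi> x" for x
  proof -
    obtain m where m: "\<phi> x \<le> real m" using real_arch_simple by blast
    have "eventually (\<lambda>k. min (\<phi> x) (real k) = \<phi> x) sequentially"
      using m by (intro eventually_sequentiallyI[of m]) auto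
    then have "(\<lambda>k. min (\<phi> x) (real k)) \<longlonglongrightarrow> \<phi> x" by (rule tendsto_eventually)
    from tendsto_add[OF this LIMSEQ_Suc[OF lim_1_over_n]] show ?thesis by (simp add: F_def)
  qed
  have lp: "(\<lambda>k. \<integral>x. F k x powr p \<partial>gauss) \<longlonglongrightarrow> (\<integral>x. \<phi> x powr p \<partial>gauss)"
  proof (rule integral_dominated_convergence[where w = "\<lambda>x. 2 powr p * (\<phi> x powr p + 1 powr p)"])
    show "AE x in gauss. (\<lambda>k. F k x powr p) \<longlonglongrightarrow> \<phi> x powr p"
      using Fl p F(4) by (intro AE_I2 tendsto_powr2 tendsto_const) auto
    show "AE x in gauss. norm (F k x powr p) \<le> 2 powr p * (\<phi> x powr p + 1 powr p)" for k
    proof (rule AE_I2)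
      fix x
      have "F k x powr p \<le> (\<phi> x + 1) powr p" using F[of k x] p by (intro powr_mono2) auto
      also have "\<dots> \<le> 2 powr p * (\<phi> x powr p + 1 powr p)" using \<phi> p by (intro powr_add_le) auto
      finally show "norm (F k x powr p) \<le> 2 powr p * (\<phi> x powr p + 1 powr p)" by simp
    qed
  qed (use i in auto)
  have bnd: "(\<integral>x. ou \<rho> (F k) x powr r \<partial>gauss) \<le> (\<integral>x. F k x powr p \<partial>gauss) powr (r / p)" for k
    by (rule ou_hypercontractive_bounded[OF p \<rho> _ F(1,2)]) auto
  have ouF: "1 / real (Suc k) \<le> ou \<rho> (F k) x" "ou \<rho> (F k) x \<le> real k + 1 / real (Suc k)" for k x
    using F by (auto intro!: ou_bounds)
  have iouF: "integrable gauss (\<lambda>x. ou \<rho> (F k) x powr r)" for k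
  proof -
    have "0 \<le> ou \<rho> (F k) x" "ou \<rho> (F k) x powr r \<le> (real k + 1 / real (Suc k)) powr r" for x
      using ouF[of k x] p order_trans[of 0 "1 / real (Suc k)" "ou \<rho> (F k) x"] by (auto intro!: powr_mono2)
    then show ?thesis by (intro gauss.integrable_const_bound[of _ "(real k + 1 / real (Suc k)) powr r"]) auto
  qed
  \<comment> \<open>\<open>ou \<rho> \<phi>\<close> is a genuine average only where the section is
    integrable, which Fubini provides almost everywhere.\<close>
  have AEi: "AE x in gauss. integrable gauss (\<lambda>y. \<phi> (\<rho> *\<^sub>R x + sqrt (1 - \<rho>\<^sup>2) *\<^sub>R y))"
    using gauss2.AE_integrable_fst'[OF gauss_integral_rotated(1)[OF _ i\<phi> \<rho>01]] by simp
  have AEl: "AE x in gauss. (\<lambda>k. ou \<rho> (F k) x) \<longlonglongrightarrow> ou \<rho> \<phi> x"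
    using AEi
  proof eventually_elim
    case (elim x)
    show ?case unfolding ou_def
    proof (rule integral_dominated_convergence[where w = "\<lambda>y. \<phi> (\<rho> *\<^sub>R x + sqrt (1 - \<rho>\<^sup>2) *\<^sub>R y) + 1"])
      show "AE y in gauss. norm (F k (\<rho> *\<^sub>R x + sqrt (1 - \<rho>\<^sup>2) *\<^sub>R y)) \<le> \<phi> (\<rho> *\<^sub>R x + sqrt (1 - \<rho>\<^sup>2) *\<^sub>R y) + 1" for k
        using F(3,4) by auto
    qed (use elim Fl in auto)
  qed
  have ou0: "0 \<le> ou \<rho> \<phi> x" for x unfolding ou_def using \<phi> by (intro integral_nonneg_AE) auto
  let ?S = "(\<integral>x. \<phi> x powr p \<partial>gauss) powr (r / p)"
  have lS: "(\<lambda>k. (\<integral>x. F k x powr p \<partial>gauss) powr (r / p)) \<longlonglongrightarrow> ?S"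
    by (rule tendsto_powr2[OF lp tendsto_const]) (use p in auto)
  have "(\<integral>\<^sup>+x. ennreal (ou \<rho> \<phi> x powr r) \<partial>gauss) = (\<integral>\<^sup>+x. liminf (\<lambda>k. ennreal (ou \<rho> (F k) x powr r)) \<partial>gauss)"
  proof (rule nn_integral_cong_AE)
    show "AE x in gauss. ennreal (ou \<rho> \<phi> x powr r) = liminf (\<lambda>k. ennreal (ou \<rho> (F k) x powr r))"
      using AEl
    proof eventually_elim
      case (elim x)
      have "(\<lambda>k. ou \<rho> (F k) x powr r) \<longlonglongrightarrow> ou \<rho> \<phi> x powr r"
      proof (rule tendsto_powr2[OF elim tendsto_const])
        show "eventually (\<lambda>k. 0 \<le> ou \<rho> (F k) x) sequentially"
          by (intro always_eventually allI order_trans[OF _ ouF(1)]) simp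
      qed (use p in auto)
      then have "(\<lambda>k. ennreal (ou \<rho> (F k) x powr r)) \<longlonglongrightarrow> ennreal (ou \<rho> \<phi> x powr r)"
        by (rule tendsto_ennrealI)
      from lim_imp_Liminf[OF _ this] show ?case by simp
    qed
  qed
  also have "\<dots> \<le> liminf (\<lambda>k. \<integral>\<^sup>+x. ennreal (ou \<rho> (F k) x powr r) \<partial>gauss)"
    by (rule nn_integral_liminf) measurable
  also have "\<dots> \<le> liminf (\<lambda>k. ennreal ((\<integral>x. F k x powr p \<partial>gauss) powr (r / p)))"
    using bnd by (intro Liminf_mono always_eventually allI) (simp add: nn_integral_eq_integral[OF iouF] ennreal_leI)
  also have "\<dots> = ennreal ?S"
    using lim_imp_Liminf[OF _ tendsto_ennrealI[OF lS]] by simp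
  finally have le: "(\<integral>\<^sup>+x. ennreal (ou \<rho> \<phi> x powr r) \<partial>gauss) \<le> ennreal ?S" .
  show int: "integrable gauss (\<lambda>x. ou \<rho> \<phi> x powr r)"
    by (rule integrableI_bounded) (use le in \<open>auto intro: le_less_trans\<close>)
  then show "(\<integral>x. ou \<rho> \<phi> x powr r \<partial>gauss) \<le> ?S"
    using le by (simp add: nn_integral_eq_integral)
qed

section \<open>Polynomials and their leading parts\<close>

definition vmonom :: "('n \<Rightarrow> nat) \<Rightarrow> real^'n \<Rightarrow> complex" where
  "vmonom \<alpha> x = (\<Prod>i\<in>UNIV. complex_of_real (x $ i) ^ \<alpha> i)"

text \<open>The strict bound makes \<open>poly_lt 0\<close> the zero space. It stands for F_(-1), so
  that the chaos of order 0 fits the general pattern.\<close>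

definition poly_lt :: "nat \<Rightarrow> (real^'n \<Rightarrow> complex) \<Rightarrow> bool" where
  "poly_lt n f \<longleftrightarrow> (\<exists>c. f = (\<lambda>x. \<Sum>\<alpha> | sum \<alpha> UNIV < n. c \<alpha> * vmonom \<alpha> x))"

lemma poly_fun_iff: "poly_fun n f \<longleftrightarrow> poly_lt (Suc n) f"
  by (simp add: poly_fun_def poly_lt_def vmonom_def less_Suc_eq_le fun_eq_iff)

lemma finite_multidegrees: "finite {\<alpha> :: 'n::finite \<Rightarrow> nat. sum \<alpha> UNIV < n}"
proof (rule finite_subset)
  show "{\<alpha> :: 'n \<Rightarrow> nat. sum \<alpha> UNIV < n} \<subseteq> PiE UNIV (\<lambda>_. {..<n})"
  proof
    fix \<alpha> :: "'n \<Rightarrow> nat" assume "\<alpha> \<in> {\<alpha>. sum \<alpha> UNIV < n}"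
    then have "\<alpha> i < n" for i using member_le_sum[of i UNIV \<alpha>] by simp
    then show "\<alpha> \<in> PiE UNIV (\<lambda>_. {..<n})" by auto
  qed
  show "finite (PiE (UNIV :: 'n set) (\<lambda>_. {..<n}))" by (intro finite_PiE) auto
qed

lemma poly_lt_vmonom:
  assumes "sum \<alpha> UNIV < n"
  shows "poly_lt n (\<lambda>x. c * vmonom \<alpha> x)"
  unfolding poly_lt_def
proof (intro exI[of _ "\<lambda>\<beta>. if \<beta> = \<alpha> then c else 0"] ext)
  fix x
  show "c * vmonom \<alpha> x = (\<Sum>\<beta> | sum \<beta> UNIV < n. (if \<beta> = \<alpha> then c else 0) * vmonom \<beta> x)"
    using assms by (simp add: if_distrib[of "\<lambda>t. t * _"] sum.delta[OF finite_multidegrees] cong: if_cong)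
qed

lemma poly_lt_zero [simp]: "poly_lt n (\<lambda>_. 0)"
  unfolding poly_lt_def by (intro exI[of _ "\<lambda>_. 0"]) simp

lemma poly_lt_add:
  assumes "poly_lt n f" "poly_lt n g"
  shows "poly_lt n (\<lambda>x. f x + g x)"
proof -
  from assms obtain c d where "f = (\<lambda>x. \<Sum>\<alpha> | sum \<alpha> UNIV < n. c \<alpha> * vmonom \<alpha> x)"
    "g = (\<lambda>x. \<Sum>\<alpha> | sum \<alpha> UNIV < n. d \<alpha> * vmonom \<alpha> x)" unfolding poly_lt_def by blast
  then show ?thesis
    unfolding poly_lt_def by (intro exI[of _ "\<lambda>\<alpha>. c \<alpha> + d \<alpha>"]) (simp add: sum.distrib distrib_right)
qed

lemma poly_lt_cmult:
  assumes "poly_lt n f"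
  shows "poly_lt n (\<lambda>x. k * f x)"
proof -
  from assms obtain c where "f = (\<lambda>x. \<Sum>\<alpha> | sum \<alpha> UNIV < n. c \<alpha> * vmonom \<alpha> x)" unfolding poly_lt_def by blast
  then show ?thesis
    unfolding poly_lt_def by (intro exI[of _ "\<lambda>\<alpha>. k * c \<alpha>"]) (simp add: sum_distrib_left mult.assoc)
qed

lemma poly_lt_diff:
  assumes "poly_lt n f" "poly_lt n g"
  shows "poly_lt n (\<lambda>x. f x - g x)"
  using poly_lt_add[OF assms(1) poly_lt_cmult[OF assms(2), of "-1"]] by simp

lemma poly_lt_sum:
  assumes "\<And>i. i \<in> I \<Longrightarrow> poly_lt n (f i)"
  shows "poly_lt n (\<lambda>x. \<Sum>i\<in>I. f i x)"
  using assms by (induction I rule: infinite_finite_induct) (auto intro: poly_lt_add)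

lemma poly_lt_induct [consumes 1, case_names zero add vmonom]:
  assumes "poly_lt n f" and zero: "P (\<lambda>_. 0)"
    and add: "\<And>f g. poly_lt n f \<Longrightarrow> poly_lt n g \<Longrightarrow> P f \<Longrightarrow> P g \<Longrightarrow> P (\<lambda>x. f x + g x)"
    and vmonom: "\<And>\<alpha> c. sum \<alpha> UNIV < n \<Longrightarrow> P (\<lambda>x. c * vmonom \<alpha> x)"
  shows "P f"
proof -
  from assms(1) obtain c where f: "f = (\<lambda>x. \<Sum>\<alpha> | sum \<alpha> UNIV < n. c \<alpha> * vmonom \<alpha> x)"
    unfolding poly_lt_def by blast
  have "P (\<lambda>x. \<Sum>\<alpha>\<in>S. c \<alpha> * vmonom \<alpha> x)" if "S \<subseteq> {\<alpha>. sum \<alpha> UNIV < n}" for S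
    using finite_subset[OF that finite_multidegrees] that
  proof (induction S rule: finite_induct)
    case (insert \<alpha> S)
    then have "P (\<lambda>x. c \<alpha> * vmonom \<alpha> x + (\<Sum>\<alpha>\<in>S. c \<alpha> * vmonom \<alpha> x))"
      by (intro add poly_lt_sum poly_lt_vmonom vmonom) auto
    then show ?case using insert by simp
  qed (simp add: zero)
  then show ?thesis unfolding f by simp
qed

lemma poly_lt_mono:
  assumes "poly_lt m f" "m \<le> n"
  shows "poly_lt n f"
  using assms(1) by (induction rule: poly_lt_induct) (use assms(2) in \<open>auto intro: poly_lt_add poly_lt_vmonom\<close>)

text \<open>The bounds are degree at most m for f and below n for g, so that the degrees add without
  any truncated subtraction.\<close>

lemma poly_lt_mult:
  assumes "poly_lt (Suc m) f" "poly_lt n g"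
  shows "poly_lt (m + n) (\<lambda>x. f x * g x)"
  using assms(1)
proof (induction rule: poly_lt_induct)
  case (add f1 f2)
  then show ?case using poly_lt_add[of "m + n" "\<lambda>x. f1 x * g x" "\<lambda>x. f2 x * g x"] by (simp add: distrib_right)
next
  case (vmonom \<alpha> c)
  show ?case
    using assms(2)
  proof (induction rule: poly_lt_induct)
    case (add g1 g2)
    then show ?case
      using poly_lt_add[of "m + n" "\<lambda>x. c * vmonom \<alpha> x * g1 x" "\<lambda>x. c * vmonom \<alpha> x * g2 x"] by (simp add: distrib_left)
  next
    case vm: (vmonom \<beta> d)
    have eq: "(\<lambda>x. c * vmonom \<alpha> x * (d * vmonom \<beta> x)) = (\<lambda>x. c * d * vmonom (\<lambda>i. \<alpha> i + \<beta> i) x)"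
      by (simp add: vmonom_def power_add prod.distrib fun_eq_iff)
    show ?case
      unfolding eq by (rule poly_lt_vmonom) (use vm vmonom in \<open>simp add: sum.distrib\<close>)
  qed simp
qed simp

lemma poly_fun_const: "poly_fun 0 (\<lambda>_. c)"
  unfolding poly_fun_iff using poly_lt_vmonom[of "\<lambda>_. 0" 1 c] by (simp add: vmonom_def)

lemma poly_fun_coord:
  fixes i :: "'n::finite"
  shows "poly_fun 1 (\<lambda>x. complex_of_real (x $ i))"
proof -
  have "vmonom (\<lambda>j. if j = i then 1 else 0) x = complex_of_real (x $ i)" for x :: "real^'n"
    unfolding vmonom_def by (simp add: if_distrib[of "\<lambda>n. _ ^ n"] prod.delta cong: if_cong)
  then show ?thesis
    unfolding poly_fun_iff using poly_lt_vmonom[of "\<lambda>j. if j = i then 1 else 0" 2 1] by (simp add: numeral_2_eq_2)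
qed

lemma poly_fun_mult: "poly_fun m f \<Longrightarrow> poly_fun n g \<Longrightarrow> poly_fun (m + n) (\<lambda>x. f x * g x)"
  unfolding poly_fun_iff using poly_lt_mult[of m f "Suc n" g] by simp

lemma norm_vmonom_le: "norm (vmonom \<alpha> x) \<le> fact (sum \<alpha> UNIV) * exp (norm x)"
proof -
  have "norm (vmonom \<alpha> x) = (\<Prod>i\<in>UNIV. \<bar>x $ i\<bar> ^ \<alpha> i)"
    by (simp add: vmonom_def prod_norm[symmetric] norm_power)
  also have "\<dots> \<le> (\<Prod>i\<in>UNIV. norm x ^ \<alpha> i)"
    by (intro prod_mono conjI power_mono component_le_norm_cart) auto
  also have "\<dots> = norm x ^ sum \<alpha> UNIV" by (simp add: power_sum)
  also have "\<dots> \<le> fact (sum \<alpha> UNIV) * exp (norm x)" by (intro power_le_fact_exp) auto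
  finally show ?thesis .
qed

lemma poly_lt_exp_bound:
  assumes "poly_lt n f"
  shows "\<exists>C\<ge>0. \<forall>x. norm (f x) \<le> C * exp (norm x)"
  using assms
proof (induction rule: poly_lt_induct)
  case zero
  show ?case by (intro exI[of _ 0]) simp
next
  case (add f g)
  then obtain C D where "C \<ge> 0" "D \<ge> 0" "\<And>x. norm (f x) \<le> C * exp (norm x)" "\<And>x. norm (g x) \<le> D * exp (norm x)" by blast
  then show ?case
    by (intro exI[of _ "C + D"]) (auto simp: distrib_right intro: order_trans[OF norm_triangle_ineq add_mono])
next
  case (vmonom \<alpha> c)
  show ?case
    using norm_vmonom_le[of \<alpha>]
    by (intro exI[of _ "norm c * fact (sum \<alpha> UNIV)"]) (auto simp: norm_mult mult.assoc intro: mult_left_mono)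
qed

lemma poly_lt_continuous:
  assumes "poly_lt n f"
  shows "continuous_on UNIV f"
  using assms by (induction rule: poly_lt_induct) (auto simp: vmonom_def intro!: continuous_intros)

lemma poly_lt_measurable: "poly_lt n f \<Longrightarrow> f \<in> borel_measurable borel"
  by (intro borel_measurable_continuous_onI poly_lt_continuous)

lemma poly_lt_integrable:
  assumes "poly_lt n f"
  shows "integrable gauss f"
  using poly_lt_exp_bound[OF assms] integrable_gauss_exp_bound[OF poly_lt_measurable[OF assms], of _ 1] by auto

lemma borel_measurable_cnj [measurable (raw)]:
  assumes "f \<in> borel_measurable M"
  shows "(\<lambda>x. cnj (f x)) \<in> borel_measurable M"
  using assms by (rule borel_measurable_continuous_on[OF continuous_on_cnj[OF continuous_on_id]])

lemma poly_lt_integrable_mult: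
  assumes f: "poly_lt m f" and g: "poly_lt n g"
  shows "integrable gauss (\<lambda>x. f x * cnj (g x))"
proof -
  obtain C D where CD: "C \<ge> 0" "D \<ge> 0" "\<And>x. norm (f x) \<le> C * exp (norm x)" "\<And>x. norm (g x) \<le> D * exp (norm x)"
    using poly_lt_exp_bound[OF f] poly_lt_exp_bound[OF g] by blast
  have [measurable]: "f \<in> borel_measurable borel" "g \<in> borel_measurable borel"
    using f g by (auto intro: poly_lt_measurable)
  show ?thesis
  proof (rule integrable_gauss_exp_bound)
    fix x
    have "norm (f x * cnj (g x)) \<le> (C * exp (norm x)) * (D * exp (norm x))"
      using CD by (simp add: norm_mult mult_mono')
    also have "\<dots> = C * D * exp (2 * norm x)" by (subst mult_2, subst exp_add) (simp only: mult_ac)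
    finally show "norm (f x * cnj (g x)) \<le> C * D * exp (2 * norm x)" .
  qed measurable
qed

section \<open>Polynomials in two vector variables and their leading parts\<close>

text \<open>Finite sums of products u(x) w(y). The predicate P records the admissible pairs of
  degree bounds: i + j < n expresses the total degree, i < n the degree in x alone.\<close>

inductive bisum :: "(nat \<Rightarrow> nat \<Rightarrow> bool) \<Rightarrow> (real^'n \<Rightarrow> real^'n \<Rightarrow> complex) \<Rightarrow> bool" for P where
  zero: "bisum P (\<lambda>x y. 0)"
| prod: "poly_fun i u \<Longrightarrow> poly_fun j w \<Longrightarrow> P i j \<Longrightarrow> bisum P (\<lambda>x y. u x * w y)"
| add: "bisum P F \<Longrightarrow> bisum P G \<Longrightarrow> bisum P (\<lambda>x y. F x y + G x y)"

lemma bisum_mult: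
  assumes "bisum P F" "bisum Q G" and R: "\<And>i j k l. P i j \<Longrightarrow> Q k l \<Longrightarrow> R (i + k) (j + l)"
  shows "bisum R (\<lambda>x y. F x y * G x y)"
  using assms(1)
proof induction
  case zero
  then show ?case by (simp add: bisum.zero)
next
  case (prod i u j w)
  show ?case
    using assms(2)
  proof induction
    case zero
    then show ?case by (simp add: bisum.zero)
  next
    case p2: (prod k u' l w')
    have "bisum R (\<lambda>x y. (u x * u' x) * (w y * w' y))"
      using bisum.prod[OF poly_fun_mult[OF prod(1) p2(1)] poly_fun_mult[OF prod(2) p2(2)], of R] R[OF prod(3) p2(3)] by simp
    then show ?case by (simp add: mult_ac)
  next
    case (add F G)
    from bisum.add[OF this(3,4)] show ?case by (simp add: distrib_left)
  qed
next
  case (add F1 F2)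
  from bisum.add[OF this(3,4)] show ?case by (simp add: distrib_right)
qed

lemma bisum_mono:
  assumes "bisum P F" "\<And>i j. P i j \<Longrightarrow> Q i j"
  shows "bisum Q F"
  using assms(1) by induction (auto intro: bisum.intros assms(2))

lemma bisum_fst: "poly_fun i u \<Longrightarrow> P i 0 \<Longrightarrow> bisum P (\<lambda>x y. u x)"
  using bisum.prod[of i u 0 "\<lambda>_. 1" P] by (simp add: poly_fun_const)

lemma bisum_snd: "poly_fun j w \<Longrightarrow> P 0 j \<Longrightarrow> bisum P (\<lambda>x y. w y)"
  using bisum.prod[of 0 "\<lambda>_. 1" j w P] by (simp add: poly_fun_const)

lemma bisum_cmult:
  assumes "bisum P F"
  shows "bisum P (\<lambda>x y. c * F x y)"
  using bisum_mult[OF bisum_fst[OF poly_fun_const[of c], of "\<lambda>i j. i = 0 \<and> j = 0"] assms, of P] by simp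

lemma bisum_diff: "bisum P F \<Longrightarrow> bisum P G \<Longrightarrow> bisum P (\<lambda>x y. F x y - G x y)"
  using bisum.add[OF _ bisum_cmult[of P G "-1"], of F] by simp

lemma bisum_vmonom_affine:
  fixes \<alpha> :: "'n::finite \<Rightarrow> nat"
  shows "bisum (\<lambda>i j. i + j \<le> sum \<alpha> UNIV) (\<lambda>x y. vmonom \<alpha> (a *\<^sub>R x + b *\<^sub>R y))"
proof -
  have lin: "bisum (\<lambda>i j. i + j \<le> 1) (\<lambda>x y. complex_of_real ((a *\<^sub>R x + b *\<^sub>R y) $ k))" for k :: 'n
    using bisum.add[OF bisum_cmult[OF bisum_fst[OF poly_fun_coord[of k]], of _ "of_real a"]
        bisum_cmult[OF bisum_snd[OF poly_fun_coord[of k]], of _ "of_real b"], of "\<lambda>i j. i + j \<le> 1"] by simp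
  have pow: "bisum (\<lambda>i j. i + j \<le> n) (\<lambda>x y. complex_of_real ((a *\<^sub>R x + b *\<^sub>R y) $ k) ^ n)" for k :: 'n and n
  proof (induction n)
    case 0
    then show ?case using bisum_fst[OF poly_fun_const[of 1], of "\<lambda>i j. i + j \<le> 0"] by simp
  next
    case (Suc n)
    have "bisum (\<lambda>i j. i + j \<le> Suc n) (\<lambda>x y. complex_of_real ((a *\<^sub>R x + b *\<^sub>R y) $ k)
        * complex_of_real ((a *\<^sub>R x + b *\<^sub>R y) $ k) ^ n)"
      by (rule bisum_mult[OF lin Suc]) auto
    then show ?case by simp
  qed
  have "bisum (\<lambda>i j. i + j \<le> sum \<alpha> S) (\<lambda>x y. \<Prod>k\<in>S. complex_of_real ((a *\<^sub>R x + b *\<^sub>R y) $ k) ^ \<alpha> k)"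
    if "finite S" for S :: "'n set"
    using that
  proof induction
    case empty
    then show ?case using bisum_fst[OF poly_fun_const[of 1], of "\<lambda>i j. i + j \<le> 0"] by simp
  next
    case (insert k S)
    have "bisum (\<lambda>i j. i + j \<le> \<alpha> k + sum \<alpha> S) (\<lambda>x y. complex_of_real ((a *\<^sub>R x + b *\<^sub>R y) $ k) ^ \<alpha> k
        * (\<Prod>k\<in>S. complex_of_real ((a *\<^sub>R x + b *\<^sub>R y) $ k) ^ \<alpha> k))"
      by (rule bisum_mult[OF pow insert.IH]) auto
    then show ?case using insert.hyps by simp
  qed
  then show ?thesis unfolding vmonom_def by simp
qed

lemma bisum_poly_affine:
  assumes "poly_lt n f"
  shows "bisum (\<lambda>i j. i + j < n) (\<lambda>x y. f (a *\<^sub>R x + b *\<^sub>R y))"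
  using assms
proof (induction rule: poly_lt_induct)
  case (vmonom \<alpha> c)
  show ?case by (rule bisum_cmult[OF bisum_mono[OF bisum_vmonom_affine]]) (use vmonom in auto)
qed (auto intro: bisum.zero bisum.add)

text \<open>A leading part in x, with y treated as a parameter: F and p agree up to terms of lower
  degree in x. The polynomial p may be inhomogeneous and is determined only modulo lower
  degree.\<close>

definition lead :: "nat \<Rightarrow> (real^'n \<Rightarrow> real^'n \<Rightarrow> complex) \<Rightarrow> (real^'n \<Rightarrow> complex) \<Rightarrow> bool" where
  "lead n F p \<longleftrightarrow> poly_fun n p \<and> bisum (\<lambda>i j. i < n) (\<lambda>x y. F x y - p x)"

lemma lead_mult:
  assumes "lead m F p" "lead n G q"
  shows "lead (m + n) (\<lambda>x y. F x y * G x y) (\<lambda>x. p x * q x)"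
proof -
  have p: "bisum (\<lambda>i j. i \<le> m) (\<lambda>x y. p x)" and q: "bisum (\<lambda>i j. i \<le> n) (\<lambda>x y. q x)"
    using assms by (auto simp: lead_def intro: bisum_fst)
  have F: "bisum (\<lambda>i j. i < m) (\<lambda>x y. F x y - p x)" and G: "bisum (\<lambda>i j. i < n) (\<lambda>x y. G x y - q x)"
    using assms by (auto simp: lead_def)
  have "bisum (\<lambda>i j. i < m + n) (\<lambda>x y. p x * (G x y - q x) + ((F x y - p x) * q x + (F x y - p x) * (G x y - q x)))"
    by (intro bisum.add bisum_mult[OF p G] bisum_mult[OF F q] bisum_mult[OF F G]) auto
  then have "bisum (\<lambda>i j. i < m + n) (\<lambda>x y. F x y * G x y - p x * q x)" by (simp add: algebra_simps)
  then show ?thesis using assms by (auto simp: lead_def intro: poly_fun_mult)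
qed

lemma lead_one: "lead 0 (\<lambda>x y. 1) (\<lambda>x. 1)"
  by (simp add: lead_def poly_fun_const bisum.zero)

lemma lead_add: "lead n F p \<Longrightarrow> lead n G q \<Longrightarrow> lead n (\<lambda>x y. F x y + G x y) (\<lambda>x. p x + q x)"
  using bisum.add[of "\<lambda>i j. i < n" "\<lambda>x y. F x y - p x" "\<lambda>x y. G x y - q x"]
  by (auto simp: lead_def poly_fun_iff poly_lt_add add_diff_add)

lemma lead_cmult: "lead n F p \<Longrightarrow> lead n (\<lambda>x y. c * F x y) (\<lambda>x. c * p x)"
  using bisum_cmult[of "\<lambda>i j. i < n" "\<lambda>x y. F x y - p x" c]
  by (auto simp: lead_def poly_fun_iff poly_lt_cmult right_diff_distrib)

lemma lead_vmonom:
  fixes \<alpha> :: "'n::finite \<Rightarrow> nat"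
  shows "lead (sum \<alpha> UNIV) (\<lambda>x y. vmonom \<alpha> (a *\<^sub>R x + b *\<^sub>R y)) (\<lambda>x. of_real a ^ sum \<alpha> UNIV * vmonom \<alpha> x)"
proof -
  have lin: "lead 1 (\<lambda>x y. complex_of_real ((a *\<^sub>R x + b *\<^sub>R y) $ k)) (\<lambda>x. of_real a * complex_of_real (x $ k))" for k :: 'n
    unfolding lead_def
    using bisum_cmult[OF bisum_snd[OF poly_fun_coord[of k], of "\<lambda>i j. i < 1"], of "of_real b"] poly_fun_coord[of k]
    by (simp add: poly_fun_iff poly_lt_cmult)
  have pow: "lead n (\<lambda>x y. complex_of_real ((a *\<^sub>R x + b *\<^sub>R y) $ k) ^ n) (\<lambda>x. of_real a ^ n * complex_of_real (x $ k) ^ n)" for k :: 'n and n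
  proof (induction n)
    case (Suc n)
    from lead_mult[OF lin[of k] Suc] show ?case by (simp add: mult_ac)
  qed (use lead_one in simp)
  have "lead (sum \<alpha> S) (\<lambda>x y. \<Prod>k\<in>S. complex_of_real ((a *\<^sub>R x + b *\<^sub>R y) $ k) ^ \<alpha> k)
      (\<lambda>x. of_real a ^ sum \<alpha> S * (\<Prod>k\<in>S. complex_of_real (x $ k) ^ \<alpha> k))"
    if "finite S" for S :: "'n set"
    using that
  proof induction
    case (insert k S)
    from lead_mult[OF pow[of "\<alpha> k" k] insert.IH] show ?case
      using insert.hyps by (simp add: power_add mult_ac)
  qed (use lead_one in simp)
  then show ?thesis unfolding vmonom_def by simp
qed

text \<open>Monomials of degree n in f scale by a^n; those of lower degree are error terms on both
  sides, so the whole of f, and not just its top homogeneous part, may stand on the right.\<close>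

lemma lead_poly:
  assumes "poly_fun n f"
  shows "lead n (\<lambda>x y. f (a *\<^sub>R x + b *\<^sub>R y)) (\<lambda>x. of_real a ^ n * f x)"
proof -
  have "poly_lt (Suc n) f" using assms by (simp add: poly_fun_iff)
  then show ?thesis
  proof (induction rule: poly_lt_induct)
    case zero
    show ?case by (simp add: lead_def bisum.zero poly_fun_iff)
  next
    case (add f g)
    from lead_add[OF add(3,4)] show ?case by (simp add: distrib_left)
  next
    case (vmonom \<alpha> c)
    show ?case
    proof (cases "sum \<alpha> UNIV = n")
      case True
      from lead_cmult[OF lead_vmonom[of \<alpha> a b], of c] show ?thesis unfolding True by (simp add: mult_ac)
    next
      case False
      then have lt: "sum \<alpha> UNIV < n" using vmonom by simp
      have 1: "bisum (\<lambda>i j. i < n) (\<lambda>x y. c * vmonom \<alpha> (a *\<^sub>R x + b *\<^sub>R y))"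
        by (rule bisum_cmult[OF bisum_mono[OF bisum_vmonom_affine]]) (use lt in auto)
      have "poly_fun (sum \<alpha> UNIV) (\<lambda>x. of_real a ^ n * c * vmonom \<alpha> x)"
        unfolding poly_fun_iff by (rule poly_lt_vmonom) simp
      then have "bisum (\<lambda>i j. i < n) (\<lambda>x y. of_real a ^ n * c * vmonom \<alpha> x)"
        by (rule bisum_fst) (use lt in simp)
      from bisum_diff[OF 1 this] show ?thesis
        using lt by (auto simp: lead_def poly_fun_iff mult.assoc[symmetric] intro: poly_lt_vmonom)
    qed
  qed
qed

text \<open>The factors in y integrate to scalars, so the degree in x is not raised.\<close>

lemma bisum_integral_snd:
  assumes "bisum P F" and P: "\<And>i j. P i j \<Longrightarrow> i < n"
  shows "poly_lt n (\<lambda>x. \<integral>y. F x y \<partial>gauss)"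
proof -
  have "poly_lt n (\<lambda>x. \<integral>y. F x y \<partial>gauss) \<and> (\<forall>x. integrable gauss (F x))"
    using assms(1)
  proof induction
    case (prod i u j w)
    have w: "integrable gauss w" using prod by (auto simp: poly_fun_iff intro: poly_lt_integrable)
    have "poly_lt n (\<lambda>x. (\<integral>y. w y \<partial>gauss) * u x)"
      using prod P[of i j] by (intro poly_lt_cmult poly_lt_mono[of "Suc i" _ n]) (auto simp: poly_fun_iff)
    then show ?case using w by (simp add: mult.commute)
  qed (auto intro: poly_lt_add)
  then show ?thesis by blast
qed

section \<open>Chaos decomposition and Wick products of polynomials\<close>

lemma gauss_pair_mult:
  fixes f g :: "real^'n \<Rightarrow> 'b::{real_normed_field, banach, second_countable_topology}"
  assumes f: "integrable gauss f" and g: "integrable gauss g"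
  shows "integrable (gauss \<Otimes>\<^sub>M gauss) (\<lambda>z. f (fst z) * g (snd z))"
    and "(\<integral>z. f (fst z) * g (snd z) \<partial>(gauss \<Otimes>\<^sub>M gauss)) = (\<integral>x. f x \<partial>gauss) * (\<integral>x. g x \<partial>gauss)"
proof -
  note [measurable] = borel_measurable_integrable[OF f] borel_measurable_integrable[OF g]
  have "integrable (gauss \<Otimes>\<^sub>M gauss) (\<lambda>(x, y). f x * g y)"
  proof (rule gauss2.Fubini_integrable)
    have "integrable gauss (\<lambda>x. norm (f x) * (\<integral>y. norm (g y) \<partial>gauss))"
      using f by simp
    then show "integrable gauss (\<lambda>x. \<integral>y. norm (case (x, y) of (x, y) \<Rightarrow> f x * g y) \<partial>gauss)"
      using g by (simp add: norm_mult)
    show "AE x in gauss. integrable gauss (\<lambda>y. case (x, y) of (x, y) \<Rightarrow> f x * g y)"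
      using g by simp
  qed measurable
  then show i: "integrable (gauss \<Otimes>\<^sub>M gauss) (\<lambda>z. f (fst z) * g (snd z))" by (simp add: split_beta')
  from gauss2.integral_fst'[OF i] f g
  show "(\<integral>z. f (fst z) * g (snd z) \<partial>(gauss \<Otimes>\<^sub>M gauss)) = (\<integral>x. f x \<partial>gauss) * (\<integral>x. g x \<partial>gauss)"
    by simp
qed

text \<open>When a^2 + b^2 = 1, the two arguments form the rotated pair, so for independent standard
  Gaussian x and y they are again independent and standard. Both the L^1 continuity and the
  orthogonality to lower degrees rest on this.\<close>

definition mehler :: "real \<Rightarrow> real \<Rightarrow> (real^'n \<Rightarrow> complex) \<Rightarrow> (real^'n \<Rightarrow> complex) \<Rightarrow> real^'n \<Rightarrow> complex" where
  "mehler a b f g x = (\<integral>y. f (a *\<^sub>R x + b *\<^sub>R y) * g (b *\<^sub>R x - a *\<^sub>R y) \<partial>gauss)"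

lemma mehler_integrable_pair:
  fixes f g :: "real^'n \<Rightarrow> complex"
  assumes "a\<^sup>2 + b\<^sup>2 = 1" "a \<noteq> 0" and f: "integrable gauss f" and g: "integrable gauss g"
  shows "integrable (gauss \<Otimes>\<^sub>M gauss) (\<lambda>z. f (a *\<^sub>R fst z + b *\<^sub>R snd z) * g (b *\<^sub>R fst z - a *\<^sub>R snd z))"
  using integrable_gauss_rotate[OF assms(1,2) gauss_pair_mult(1)[OF f g]] by (simp add: split_beta')

lemma mehler_measurable [measurable]:
  assumes [measurable]: "f \<in> borel_measurable borel" "g \<in> borel_measurable borel"
  shows "mehler a b f g \<in> borel_measurable borel"
  unfolding mehler_def[abs_def] by measurable

section \<open>The Gaussian inner product and orthogonal projection of polynomials\<close>

lemma gip_add_left: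
  assumes "poly_lt k f" "poly_lt l g" "poly_lt m h"
  shows "gip (\<lambda>x. f x + g x) h = gip f h + gip g h"
  using poly_lt_integrable_mult[OF assms(1,3)] poly_lt_integrable_mult[OF assms(2,3)]
  by (simp add: gip_def distrib_right)

lemma gip_cmult_left: "gip (\<lambda>x. c * f x) h = c * gip f h"
  by (simp add: gip_def mult.assoc)

lemma gip_cnj: "gip g f = cnj (gip f g)"
  unfolding gip_def Bochner_Integration.integral_cnj[symmetric] by (simp add: mult.commute)

lemma gip_diff_left:
  assumes "poly_lt k f" "poly_lt l g" "poly_lt m h"
  shows "gip (\<lambda>x. f x - g x) h = gip f h - gip g h"
  using gip_add_left[OF assms(1) poly_lt_cmult[OF assms(2), of "-1"] assms(3)] gip_cmult_left[of "-1" g h] by simp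

lemma gip_add_right:
  assumes "poly_lt k f" "poly_lt l g" "poly_lt m h"
  shows "gip h (\<lambda>x. f x + g x) = gip h f + gip h g"
  using gip_add_left[OF assms] by (metis gip_cnj complex_cnj_add)

lemma gip_cmult_right: "gip h (\<lambda>x. c * f x) = cnj c * gip h f"
  by (metis gip_cnj gip_cmult_left complex_cnj_mult)

lemma gip_zero [simp]: "gip (\<lambda>_. 0) h = 0" "gip h (\<lambda>_. 0) = 0"
  by (simp_all add: gip_def)

lemma gip_sum_left:
  assumes "finite I" "\<And>i. i \<in> I \<Longrightarrow> poly_lt k (f i)" "poly_lt m h"
  shows "gip (\<lambda>x. \<Sum>i\<in>I. f i x) h = (\<Sum>i\<in>I. gip (f i) h)"
  using assms(1,2)
proof (induction I rule: finite_induct)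
  case (insert i I)
  have "gip (\<lambda>x. f i x + (\<Sum>i\<in>I. f i x)) h = gip (f i) h + gip (\<lambda>x. \<Sum>i\<in>I. f i x) h"
    by (rule gip_add_left[OF _ _ assms(3)]) (use insert in \<open>auto intro!: poly_lt_sum\<close>)
  then show ?case using insert by simp
qed simp

text \<open>A polynomial that vanishes almost everywhere vanishes identically, because its nonzero
  set is open and the density is positive. Projections onto chaoses are thus unique as functions, as
  the definite description in \<open>chaos_proj\<close> requires.\<close>

lemma gip_definite:
  fixes f :: "real^'n \<Rightarrow> complex"
  assumes f: "poly_lt n f" and 0: "gip f f = 0"
  shows "f = (\<lambda>_. 0)"
proof (rule ccontr)
  assume "f \<noteq> (\<lambda>_. 0)"
  then obtain x where x: "f x \<noteq> 0" by auto
  define A where "A = {y. f y \<noteq> 0}"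
  note [measurable] = poly_lt_measurable[OF f]
  have "A = f -` (- {0})" by (auto simp: A_def)
  then have oA: "open A"
    using open_vimage[OF _ poly_lt_continuous[OF f], of "- {0}"] by (simp add: open_Compl)
  have eq: "f y * cnj (f y) = complex_of_real ((cmod (f y))\<^sup>2)" for y by (rule complex_norm_square[symmetric])
  have i: "integrable gauss (\<lambda>y. (cmod (f y))\<^sup>2)"
    using poly_lt_integrable_mult[OF f f] unfolding eq by (simp only: complex_of_real_integrable_eq)
  have "(\<integral>y. (cmod (f y))\<^sup>2 \<partial>gauss) = 0"
    using 0 unfolding gip_def eq by (simp only: integral_complex_of_real of_real_eq_0_iff)
  then have "AE y in gauss. (cmod (f y))\<^sup>2 = 0"
    using integral_nonneg_eq_0_iff_AE[OF i] by simp
  then have "AE y in gauss. y \<notin> A" by (simp add: A_def)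
  then have "AE y in lborel. y \<notin> A"
    unfolding gauss_eq by (subst (asm) AE_density) (auto simp: gdens_pos)
  then have "A \<in> null_sets lborel"
    using oA by (subst (asm) AE_iff_null_sets[symmetric]) auto
  then have "A \<in> null_sets lebesgue" by (rule null_sets_completionI)
  then have "negligible A" by (simp add: negligible_iff_null_sets)
  moreover have "x \<in> A" using x by (simp add: A_def)
  ultimately show False using open_not_negligible[OF oA] by auto
qed

definition poly_subspace :: "((real^'n \<Rightarrow> complex) \<Rightarrow> bool) \<Rightarrow> nat \<Rightarrow> bool" where
  "poly_subspace V n \<longleftrightarrow> V (\<lambda>_. 0) \<and> (\<forall>f. V f \<longrightarrow> poly_lt n f)
     \<and> (\<forall>f g. V f \<longrightarrow> V g \<longrightarrow> V (\<lambda>x. f x + g x)) \<and> (\<forall>f c. V f \<longrightarrow> V (\<lambda>x. c * f x))"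

text \<open>One Gram-Schmidt step: the new vector e is replaced by its component b orthogonal to V,
  and the projection of f gains the multiple t of b.\<close>

lemma orthogonal_projection_step:
  fixes V :: "(real^'n \<Rightarrow> complex) \<Rightarrow> bool"
  assumes lin: "poly_subspace V n"
    and proj: "\<And>f. poly_lt m f \<Longrightarrow> \<exists>g. V g \<and> (\<forall>h. V h \<longrightarrow> gip (\<lambda>x. f x - g x) h = 0)"
    and nm: "n \<le> m" and e: "poly_lt n e" and f: "poly_lt m f"
  shows "\<exists>g. (\<exists>v c. V v \<and> g = (\<lambda>x. v x + c * e x)) \<and>
    (\<forall>h. (\<exists>v c. V v \<and> h = (\<lambda>x. v x + c * e x)) \<longrightarrow> gip (\<lambda>x. f x - g x) h = 0)"
proof -
  have V: "V f \<Longrightarrow> poly_lt n f" "V f \<Longrightarrow> V g \<Longrightarrow> V (\<lambda>x. f x + g x)" "V f \<Longrightarrow> V (\<lambda>x. c * f x)" for f g c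
    using lin by (auto simp: poly_subspace_def)
  obtain k where k: "V k" "\<And>h. V h \<Longrightarrow> gip (\<lambda>x. f x - k x) h = 0" using proj[OF f] by blast
  obtain h where h: "V h" "\<And>v. V v \<Longrightarrow> gip (\<lambda>x. e x - h x) v = 0" using proj[OF poly_lt_mono[OF e nm]] by blast
  define b where "b = (\<lambda>x. e x - h x)"
  have pb: "poly_lt n b" unfolding b_def using e V(1)[OF h(1)] by (rule poly_lt_diff)
  have pr: "poly_lt m (\<lambda>x. f x - k x)" using f poly_lt_mono[OF V(1)[OF k(1)] nm] by (rule poly_lt_diff)
  \<comment> \<open>If \<open>gip b b\<close> is 0, the quotient is 0 by convention and b itself is
    0, so the correction vanishes as it should.\<close>
  define t where "t = gip (\<lambda>x. f x - k x) b / gip b b"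
  define g where "g x = k x + t * b x" for x
  have eb: "e = (\<lambda>x. h x + b x)" by (simp add: b_def fun_eq_iff)
  have t0: "gip (\<lambda>x. f x - k x) b = t * gip b b"
  proof (cases "gip b b = 0")
    case True
    then have "b = (\<lambda>_. 0)" by (rule gip_definite[OF pb])
    then show ?thesis by simp
  qed (simp add: t_def)
  have fg: "gip (\<lambda>x. f x - g x) u = gip (\<lambda>x. f x - k x) u - t * gip b u" if "poly_lt n u" for u
  proof -
    have "(\<lambda>x. f x - g x) = (\<lambda>x. (f x - k x) - t * b x)" by (simp add: g_def fun_eq_iff)
    then show ?thesis
      using gip_diff_left[OF pr poly_lt_cmult[OF pb] that, of t] by (simp add: gip_cmult_left)
  qed
  have 1: "gip (\<lambda>x. f x - g x) v = 0" if "V v" for v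
    using fg[OF V(1)[OF that]] k(2)[OF that] h(2)[OF that] by (simp add: b_def)
  have 2: "gip (\<lambda>x. f x - g x) b = 0" using fg[OF pb] t0 by simp
  have V': "V (\<lambda>x. k x + (- t) * h x)" using V(2)[OF k(1) V(3)[OF h(1)]] .
  have pg: "poly_lt m (\<lambda>x. f x - g x)"
    unfolding g_def using poly_lt_diff[OF f poly_lt_add[OF poly_lt_mono[OF V(1)[OF k(1)] nm] poly_lt_mono[OF poly_lt_cmult[OF pb] nm]]] .
  have "gip (\<lambda>x. f x - g x) (\<lambda>x. v x + c * e x) = 0" if v: "V v" for v c
  proof -
    have w: "V (\<lambda>x. v x + c * h x)" using V(2)[OF v V(3)[OF h(1)]] .
    have "(\<lambda>x. v x + c * e x) = (\<lambda>x. (v x + c * h x) + c * b x)" by (simp add: b_def fun_eq_iff algebra_simps)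
    then show ?thesis
      using gip_add_right[OF V(1)[OF w] poly_lt_cmult[OF pb] pg, of c] 1[OF w] 2 by (simp add: gip_cmult_right)
  qed
  moreover have "g = (\<lambda>x. (k x + (- t) * h x) + t * e x)" by (simp add: g_def b_def fun_eq_iff algebra_simps)
  ultimately show ?thesis using V' by blast
qed

text \<open>The monomials are adjoined one at a time, each by a Gram-Schmidt step, in an induction
  over the finite set of multidegrees.\<close>

lemma orthogonal_projection_poly:
  fixes f :: "real^'n \<Rightarrow> complex"
  assumes f: "poly_lt m f" and nm: "n \<le> m"
  shows "\<exists>g. poly_lt n g \<and> (\<forall>h. poly_lt n h \<longrightarrow> gip (\<lambda>x. f x - g x) h = 0)"
proof -
  define V where "V S g \<longleftrightarrow> (\<exists>c. g = (\<lambda>x. \<Sum>\<alpha>\<in>S. c \<alpha> * vmonom \<alpha> x))" for S and g :: "real^'n \<Rightarrow> complex"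
  have main: "\<forall>f. poly_lt m f \<longrightarrow> (\<exists>g. V S g \<and> (\<forall>h. V S h \<longrightarrow> gip (\<lambda>x. f x - g x) h = 0))"
    if "S \<subseteq> {\<alpha>. sum \<alpha> UNIV < n}" for S
    using finite_subset[OF that finite_multidegrees] that
  proof (induction S rule: finite_induct)
    case empty
    show ?case by (simp add: V_def)
  next
    case (insert \<alpha> S)
    have lin: "poly_subspace (V S) n"
      unfolding poly_subspace_def
    proof (intro conjI allI impI)
      show "V S (\<lambda>_. 0)" unfolding V_def by (intro exI[of _ "\<lambda>_. 0"]) simp
      show "poly_lt n f" if "V S f" for f
        using that insert.prems by (auto simp: V_def intro!: poly_lt_sum poly_lt_vmonom)
      show "V S (\<lambda>x. f x + g x)" if fg: "V S f" "V S g" for f g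
      proof -
        obtain c d where "f = (\<lambda>x. \<Sum>\<alpha>\<in>S. c \<alpha> * vmonom \<alpha> x)" "g = (\<lambda>x. \<Sum>\<alpha>\<in>S. d \<alpha> * vmonom \<alpha> x)"
          using fg unfolding V_def by blast
        then show ?thesis
          unfolding V_def by (intro exI[of _ "\<lambda>\<alpha>. c \<alpha> + d \<alpha>"]) (simp add: sum.distrib distrib_right)
      qed
      show "V S (\<lambda>x. k * f x)" if Vf: "V S f" for f k
      proof -
        obtain c where "f = (\<lambda>x. \<Sum>\<alpha>\<in>S. c \<alpha> * vmonom \<alpha> x)" using Vf unfolding V_def by blast
        then show ?thesis
          unfolding V_def by (intro exI[of _ "\<lambda>\<alpha>. k * c \<alpha>"]) (simp add: sum_distrib_left mult.assoc)
      qed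
    qed
    have e: "poly_lt n (vmonom \<alpha>)"
      using poly_lt_vmonom[of \<alpha> n 1] insert.prems by simp
    have Vins: "V (insert \<alpha> S) = (\<lambda>g. \<exists>v c. V S v \<and> g = (\<lambda>x. v x + c * vmonom \<alpha> x))"
    proof (intro ext iffI)
      fix g assume "V (insert \<alpha> S) g"
      then obtain c where "g = (\<lambda>x. \<Sum>\<beta>\<in>insert \<alpha> S. c \<beta> * vmonom \<beta> x)" by (auto simp: V_def)
      then have "g = (\<lambda>x. (\<Sum>\<beta>\<in>S. c \<beta> * vmonom \<beta> x) + c \<alpha> * vmonom \<alpha> x)"
        using insert.hyps by (simp add: add.commute)
      then show "\<exists>v c. V S v \<and> g = (\<lambda>x. v x + c * vmonom \<alpha> x)" unfolding V_def by blast
    next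
      fix g assume "\<exists>v c. V S v \<and> g = (\<lambda>x. v x + c * vmonom \<alpha> x)"
      then obtain d c where "g = (\<lambda>x. (\<Sum>\<beta>\<in>S. d \<beta> * vmonom \<beta> x) + c * vmonom \<alpha> x)" by (auto simp: V_def)
      moreover have "(\<Sum>\<beta>\<in>S. (d(\<alpha> := c)) \<beta> * vmonom \<beta> x) = (\<Sum>\<beta>\<in>S. d \<beta> * vmonom \<beta> x)" for x
        using insert.hyps by (intro sum.cong) auto
      ultimately have "g = (\<lambda>x. \<Sum>\<beta>\<in>insert \<alpha> S. (d(\<alpha> := c)) \<beta> * vmonom \<beta> x)"
        using insert.hyps by (simp add: add.commute)
      then show "V (insert \<alpha> S) g" unfolding V_def by blast
    qed
    have IH: "\<exists>g. V S g \<and> (\<forall>h. V S h \<longrightarrow> gip (\<lambda>x. f x - g x) h = 0)" if "poly_lt m f" for f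
      using insert.IH insert.prems that by simp
    show ?case
      unfolding Vins using orthogonal_projection_step[OF lin IH nm e] by blast
  qed
  have "V {\<alpha>. sum \<alpha> UNIV < n} = poly_lt n" by (simp add: V_def poly_lt_def fun_eq_iff)
  with main[OF subset_refl] f show ?thesis by simp
qed

section \<open>Chaos components of polynomials\<close>

lemma chaos_iff:
  fixes f :: "real^'n \<Rightarrow> complex"
  shows "f \<in> chaos n \<longleftrightarrow> poly_lt (Suc n) f \<and> (\<forall>h. poly_lt n h \<longrightarrow> gip f h = 0)"
proof (cases n)
  case 0
  have "gip f h = 0" if "poly_lt 0 h" for h
    using that by (auto simp: poly_lt_def)
  then show ?thesis using 0 by (auto simp: chaos_def poly_fun_iff)
qed (simp add: chaos_def poly_fun_iff)

lemma chaos_poly: "f \<in> chaos n \<Longrightarrow> poly_lt (Suc n) f"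
  by (simp add: chaos_iff)

lemma chaos_zero: "(\<lambda>_. 0) \<in> chaos n"
  by (simp add: chaos_iff)

lemma chaos_cmult: "f \<in> chaos n \<Longrightarrow> (\<lambda>x. c * f x) \<in> chaos n"
  by (simp add: chaos_iff poly_lt_cmult gip_cmult_left)

lemma chaos_diff: "f \<in> chaos n \<Longrightarrow> g \<in> chaos n \<Longrightarrow> (\<lambda>x. f x - g x) \<in> chaos n"
  by (auto simp: chaos_iff poly_lt_diff gip_diff_left)

lemma chaos_orthogonal:
  assumes "f \<in> chaos m" "g \<in> chaos n" "m \<noteq> n"
  shows "gip f g = 0"
proof (cases "m < n")
  case True
  then have "gip g f = 0" using assms poly_lt_mono[of "Suc m" f n] by (auto simp: chaos_iff)
  then show ?thesis by (subst gip_cnj) simp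
next
  case False
  then show ?thesis using assms poly_lt_mono[of "Suc n" g m] by (auto simp: chaos_iff)
qed

text \<open>Such an f is orthogonal to itself. In use: two elements of one chaos that agree up to
  lower degree are equal.\<close>

lemma chaos_poly_lt_eq_0:
  assumes "f \<in> chaos n" "poly_lt n f"
  shows "f = (\<lambda>_. 0)"
  using assms by (intro gip_definite[of n]) (auto simp: chaos_iff)

lemma chaos_proj_eqI:
  assumes f: "poly_lt k f" and g: "g \<in> chaos n" and orth: "\<And>h. h \<in> chaos n \<Longrightarrow> gip (\<lambda>x. f x - g x) h = 0"
  shows "chaos_proj n f = g"
  unfolding chaos_proj_def
proof (rule the_equality)
  show "g \<in> chaos n \<and> (\<forall>h\<in>chaos n. gip (\<lambda>x. f x - g x) h = 0)" using g orth by blast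
  fix g' assume g': "g' \<in> chaos n \<and> (\<forall>h\<in>chaos n. gip (\<lambda>x. f x - g' x) h = 0)"
  define d where "d = (\<lambda>x. g' x - g x)"
  have d: "d \<in> chaos n" unfolding d_def using g g' by (intro chaos_diff) auto
  have "gip d d = gip (\<lambda>x. (f x - g x) - (f x - g' x)) d" by (simp add: d_def)
  also have "\<dots> = gip (\<lambda>x. f x - g x) d - gip (\<lambda>x. f x - g' x) d"
  proof (rule gip_diff_left[OF _ _ chaos_poly[OF d], where k = "max k (Suc n)" and l = "max k (Suc n)"])
    show "poly_lt (max k (Suc n)) (\<lambda>x. f x - g x)" "poly_lt (max k (Suc n)) (\<lambda>x. f x - g' x)"
      using f g g' by (auto intro!: poly_lt_diff intro: poly_lt_mono[OF f] poly_lt_mono[OF chaos_poly])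
  qed
  also have "\<dots> = 0" using orth[OF d] g' d by simp
  finally have "d = (\<lambda>_. 0)" by (rule gip_definite[OF chaos_poly[OF d]])
  then show "g' = g" by (simp add: d_def fun_eq_iff)
qed

text \<open>Subtracting from f its projection onto lower degrees leaves an element of the top chaos.
  Fixing the components from n on as zero lets later sums run over any larger range.\<close>

lemma chaos_decomposition_exists:
  fixes f :: "real^'n \<Rightarrow> complex"
  assumes "poly_lt n f"
  shows "\<exists>F. (\<forall>m. F m \<in> chaos m) \<and> (\<forall>m\<ge>n. F m = (\<lambda>_. 0)) \<and> f = (\<lambda>x. \<Sum>m<n. F m x)"
  using assms
proof (induction n arbitrary: f)
  case 0
  then have "f = (\<lambda>_. 0)" by (auto simp: poly_lt_def)
  then show ?case by (intro exI[of _ "\<lambda>_ _. 0"]) (auto simp: chaos_zero)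
next
  case (Suc n)
  obtain g where g: "poly_lt n g" "\<And>h. poly_lt n h \<Longrightarrow> gip (\<lambda>x. f x - g x) h = 0"
    using orthogonal_projection_poly[OF Suc.prems, of n] by auto
  from Suc.IH[OF g(1)] obtain F where F: "\<And>m. F m \<in> chaos m" "\<And>m. m \<ge> n \<Longrightarrow> F m = (\<lambda>_. 0)"
    "g = (\<lambda>x. \<Sum>m<n. F m x)" by blast
  have "(\<lambda>x. f x - g x) \<in> chaos n"
    using g(2) poly_lt_diff[OF Suc.prems poly_lt_mono[OF g(1), of "Suc n"]] by (simp add: chaos_iff)
  moreover have "f = (\<lambda>x. \<Sum>m<Suc n. (F(n := (\<lambda>x. f x - g x))) m x)"
    using F(3) by (simp add: fun_eq_iff)
  ultimately show ?case
    using F by (intro exI[of _ "F(n := (\<lambda>x. f x - g x))"]) auto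
qed

lemma chaos_proj_sum:
  fixes F :: "nat \<Rightarrow> real^'n \<Rightarrow> complex"
  assumes F: "\<And>m. F m \<in> chaos m" "\<And>m. m \<ge> n \<Longrightarrow> F m = (\<lambda>_. 0)"
  shows "chaos_proj m (\<lambda>x. \<Sum>k<n. F k x) = F m"
proof -
  have pF: "poly_lt n (F k)" if "k < n" for k
    using chaos_poly[OF F(1)[of k]] that by (auto intro: poly_lt_mono)
  then have f: "poly_lt n (\<lambda>x. \<Sum>k<n. F k x)" by (intro poly_lt_sum) auto
  show ?thesis
  proof (rule chaos_proj_eqI[OF f F(1)])
    fix h :: "real^'n \<Rightarrow> complex" assume h: "h \<in> chaos m"
    have "gip (\<lambda>x. (\<Sum>k<n. F k x) - F m x) h = gip (\<lambda>x. \<Sum>k<n. F k x) h - gip (F m) h"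
      by (rule gip_diff_left[OF f chaos_poly[OF F(1)] chaos_poly[OF h]])
    also have "gip (\<lambda>x. \<Sum>k<n. F k x) h = (\<Sum>k<n. gip (F k) h)"
      by (rule gip_sum_left[OF _ _ chaos_poly[OF h]]) (auto intro: pF)
    also have "\<dots> = (\<Sum>k<n. if k = m then gip (F m) h else 0)"
      using chaos_orthogonal[OF F(1) h] by (intro sum.cong) auto
    also have "\<dots> = gip (F m) h"
      using F(2)[of m] by (simp add: sum.delta)
    finally show "gip (\<lambda>x. (\<Sum>k<n. F k x) - F m x) h = 0" by simp
  qed
qed

lemma chaos_decomposition:
  fixes f :: "real^'n \<Rightarrow> complex"
  assumes f: "poly_lt n f"
  shows "chaos_proj m f \<in> chaos m" and "n \<le> m \<Longrightarrow> chaos_proj m f = (\<lambda>_. 0)"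
    and "f x = (\<Sum>m<n. chaos_proj m f x)"
proof -
  obtain F where F: "\<And>m. F m \<in> chaos m" "\<And>m. m \<ge> n \<Longrightarrow> F m = (\<lambda>_. 0)" "f = (\<lambda>x. \<Sum>m<n. F m x)"
    using chaos_decomposition_exists[OF f] by blast
  have eq: "chaos_proj m f = F m" for m
    unfolding F(3) by (rule chaos_proj_sum[OF F(1,2)])
  show "chaos_proj m f \<in> chaos m" unfolding eq by (rule F(1))
  show "n \<le> m \<Longrightarrow> chaos_proj m f = (\<lambda>_. 0)" unfolding eq by (rule F(2))
  show "f x = (\<Sum>m<n. chaos_proj m f x)" unfolding eq by (subst F(3)) simp
qed

lemma chaos_proj_chaos:
  assumes "f \<in> chaos n"
  shows "chaos_proj m f = (if m = n then f else (\<lambda>_. 0))"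
  using assms by (intro chaos_proj_eqI[OF chaos_poly[OF assms]]) (auto simp: chaos_zero intro: chaos_orthogonal)

lemma poly_fun_pdeg: "poly_fun n f \<Longrightarrow> poly_lt (Suc (pdeg f)) f"
  unfolding poly_fun_iff[symmetric] pdeg_def by (rule LeastI)

text \<open>On a summand u(x) w(y) the integral factors into \<open>gip f u * gip g w\<close>, and P
  makes the degree of u or of w too small.\<close>

lemma bisum_orthogonal:
  fixes f g :: "real^'n \<Rightarrow> complex"
  assumes H: "bisum P H" and f: "f \<in> chaos m" and g: "g \<in> chaos n"
    and P: "\<And>i j. P i j \<Longrightarrow> i < m \<or> j < n"
  shows "integrable (gauss \<Otimes>\<^sub>M gauss) (\<lambda>z. f (fst z) * g (snd z) * cnj (H (fst z) (snd z)))
    \<and> (\<integral>z. f (fst z) * g (snd z) * cnj (H (fst z) (snd z)) \<partial>(gauss \<Otimes>\<^sub>M gauss)) = 0"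
  using H
proof induction
  case zero
  then show ?case by simp
next
  case (prod i u j w)
  have pu: "poly_lt (Suc i) u" and pw: "poly_lt (Suc j) w" using prod by (auto simp: poly_fun_iff)
  have fu: "integrable gauss (\<lambda>x. f x * cnj (u x))" and gw: "integrable gauss (\<lambda>x. g x * cnj (w x))"
    by (rule poly_lt_integrable_mult[OF chaos_poly[OF f] pu], rule poly_lt_integrable_mult[OF chaos_poly[OF g] pw])
  have "gip f u = 0 \<or> gip g w = 0"
    using P[OF prod(3)] f g poly_lt_mono[OF pu, of m] poly_lt_mono[OF pw, of n] by (auto simp: chaos_iff)
  then show ?case
    using gauss_pair_mult[OF fu gw] by (auto simp: gip_def mult_ac)
next
  case (add F G)
  then show ?case by (auto simp: distrib_left)
qed

text \<open>For homogeneous chaoses both sides have the same component of top degree and lie in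
  the chaos of order \<open>m + n\<close>; orthogonality of the left side to lower degrees is seen by
  rotating the pair of Gaussian variables back.\<close>
lemma mehler_chaos:
  fixes f g :: "real^'n \<Rightarrow> complex"
  assumes ab: "a\<^sup>2 + b\<^sup>2 = 1" and a: "a \<noteq> 0" and f: "f \<in> chaos m" and g: "g \<in> chaos n"
  shows "mehler a b f g = (\<lambda>x. of_real a ^ m * of_real b ^ n * chaos_proj (m + n) (\<lambda>y. f y * g y) x)"
proof -
  have pf: "poly_fun m f" "poly_fun n g" using f g by (auto simp: chaos_iff poly_fun_iff)
  have fi: "integrable gauss f" "integrable gauss g"
    using f g by (auto intro: poly_lt_integrable chaos_poly)
  note [measurable] = borel_measurable_integrable[OF fi(1)] borel_measurable_integrable[OF fi(2)]
  define D where "D x y = f (a *\<^sub>R x + b *\<^sub>R y) * g (b *\<^sub>R x - a *\<^sub>R y)" for x y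
  \<comment> \<open>The second argument is b x + (-a) y, so g contributes the leading part b^n
    g(x).\<close>
  have l: "lead (m + n) D (\<lambda>x. (of_real a ^ m * f x) * (of_real b ^ n * g x))"
    unfolding D_def using lead_mult[OF lead_poly[OF pf(1), of a b] lead_poly[OF pf(2), of b "-a"]] by simp
  have iD: "integrable gauss (D x)" for x
  proof -
    have "integrable gauss (\<lambda>y. (D x y - (of_real a ^ m * f x) * (of_real b ^ n * g x)) + (of_real a ^ m * f x) * (of_real b ^ n * g x))"
    proof (rule Bochner_Integration.integrable_add)
      have "bisum (\<lambda>i j. i < m + n) (\<lambda>x y. D x y - (of_real a ^ m * f x) * (of_real b ^ n * g x))"
        using l by (simp add: lead_def)
      then show "integrable gauss (\<lambda>y. D x y - (of_real a ^ m * f x) * (of_real b ^ n * g x))"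
        by induction (auto simp: poly_fun_iff intro: poly_lt_integrable)
    qed simp
    then show ?thesis by simp
  qed
  have low: "poly_lt (m + n) (\<lambda>x. mehler a b f g x - (of_real a ^ m * of_real b ^ n) * (f x * g x))"
  proof -
    have "poly_lt (m + n) (\<lambda>x. \<integral>y. D x y - (of_real a ^ m * f x) * (of_real b ^ n * g x) \<partial>gauss)"
      using l by (intro bisum_integral_snd[where P = "\<lambda>i j. i < m + n"]) (auto simp: lead_def)
    moreover have "(\<integral>y. D x y - (of_real a ^ m * f x) * (of_real b ^ n * g x) \<partial>gauss)
        = mehler a b f g x - (of_real a ^ m * of_real b ^ n) * (f x * g x)" for x
      using iD by (simp add: mehler_def D_def[symmetric] mult_ac)
    ultimately show ?thesis by simp
  qed
  have pfg: "poly_lt (Suc (m + n)) (\<lambda>x. f x * g x)"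
    using poly_fun_mult[OF pf] by (simp add: poly_fun_iff)
  have pM: "poly_lt (Suc (m + n)) (mehler a b f g)"
    using poly_lt_add[OF poly_lt_mono[OF low, of "Suc (m + n)"] poly_lt_cmult[OF pfg, of "of_real a ^ m * of_real b ^ n"]]
    by simp
  have inv: "a *\<^sub>R (a *\<^sub>R x + b *\<^sub>R y) + b *\<^sub>R (b *\<^sub>R x - a *\<^sub>R y) = x" for x y :: "real^'n"
  proof -
    have "a *\<^sub>R (a *\<^sub>R x + b *\<^sub>R y) + b *\<^sub>R (b *\<^sub>R x - a *\<^sub>R y) = (a\<^sup>2 + b\<^sup>2) *\<^sub>R x"
      by (simp add: algebra_simps power2_eq_square)
    then show ?thesis using ab by simp
  qed
  have Mc: "mehler a b f g \<in> chaos (m + n)"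
    unfolding chaos_iff
  proof (intro conjI allI impI pM)
    fix h :: "real^'n \<Rightarrow> complex" assume h: "poly_lt (m + n) h"
    \<comment> \<open>Rotating back turns h(x) into h(a x + b y), of total degree below m + n. A
      summand with degree bounds i + j < m + n has i < m or j < n.\<close>
    define F where "F z = f (fst z) * g (snd z) * cnj (h (a *\<^sub>R fst z + b *\<^sub>R snd z))" for z
    have "integrable (gauss \<Otimes>\<^sub>M gauss) F \<and> (\<integral>z. F z \<partial>(gauss \<Otimes>\<^sub>M gauss)) = 0"
      unfolding F_def by (rule bisum_orthogonal[OF bisum_poly_affine[OF h] f g]) linarith
    then have iF: "integrable (gauss \<Otimes>\<^sub>M gauss) F" and F0: "(\<integral>z. F z \<partial>(gauss \<Otimes>\<^sub>M gauss)) = 0" by auto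
    have Frot: "F (a *\<^sub>R x + b *\<^sub>R y, b *\<^sub>R x - a *\<^sub>R y) = D x y * cnj (h x)" for x y
      by (simp add: F_def D_def inv)
    have iR: "integrable (gauss \<Otimes>\<^sub>M gauss) (\<lambda>z. D (fst z) (snd z) * cnj (h (fst z)))"
      using integrable_gauss_rotate[OF ab a iF] by (simp add: split_beta' Frot)
    have "gip (mehler a b f g) h = (\<integral>x. (\<integral>y. D x y * cnj (h x) \<partial>gauss) \<partial>gauss)"
      using iD by (simp add: gip_def mehler_def D_def)
    also have "\<dots> = (\<integral>z. D (fst z) (snd z) * cnj (h (fst z)) \<partial>(gauss \<Otimes>\<^sub>M gauss))"
      using gauss2.integral_fst'[OF iR] by simp
    also have "\<dots> = (\<integral>z. F z \<partial>(gauss \<Otimes>\<^sub>M gauss))"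
      using integral_gauss_rotate[OF ab a borel_measurable_integrable[OF iF]] by (simp add: split_beta' Frot)
    finally show "gip (mehler a b f g) h = 0" using F0 by simp
  qed
  define G where "G = chaos_proj (m + n) (\<lambda>y. f y * g y)"
  define k where "k = complex_of_real a ^ m * complex_of_real b ^ n"
  have G: "G \<in> chaos (m + n)" unfolding G_def by (rule chaos_decomposition(1)[OF pfg])
  have fgG: "poly_lt (m + n) (\<lambda>x. f x * g x - G x)"
  proof -
    have "f x * g x - G x = (\<Sum>i<m + n. chaos_proj i (\<lambda>y. f y * g y) x)" for x
      using chaos_decomposition(3)[OF pfg, of x] by (simp add: G_def)
    moreover have "poly_lt (m + n) (\<lambda>x. \<Sum>i<m + n. chaos_proj i (\<lambda>y. f y * g y) x)"
      by (intro poly_lt_sum) (auto intro!: poly_lt_mono[OF chaos_poly[OF chaos_decomposition(1)[OF pfg]]])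
    ultimately show ?thesis by simp
  qed
  \<comment> \<open>Both functions lie in the chaos of order m + n and have the same leading part,
    so their difference has lower degree and vanishes.\<close>
  have "(\<lambda>x. mehler a b f g x - k * G x) = (\<lambda>_. 0)"
  proof (rule chaos_poly_lt_eq_0[OF chaos_diff[OF Mc chaos_cmult[OF G]]])
    show "poly_lt (m + n) (\<lambda>x. mehler a b f g x - k * G x)"
      using poly_lt_add[OF low poly_lt_cmult[OF fgG, of k]] by (simp add: k_def algebra_simps)
  qed
  then show ?thesis by (simp add: fun_eq_iff k_def G_def)
qed

lemma is_poly_iff: "is_poly f \<longleftrightarrow> (\<exists>n. poly_lt n f)"
  unfolding is_poly_def poly_fun_iff by (meson le_SucI order_refl poly_lt_mono)

lemma is_poly_pdeg: "is_poly f \<Longrightarrow> poly_lt (Suc (pdeg f)) f"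
  unfolding is_poly_def by (auto intro: poly_fun_pdeg)

lemma chaos_proj_cmult:
  assumes f: "poly_lt n f"
  shows "chaos_proj m (\<lambda>x. c * f x) = (\<lambda>x. c * chaos_proj m f x)"
proof -
  have "chaos_proj m (\<lambda>x. \<Sum>k<n. c * chaos_proj k f x) = (\<lambda>x. c * chaos_proj m f x)"
    by (rule chaos_proj_sum) (auto intro: chaos_cmult chaos_decomposition[OF f] simp: chaos_decomposition(2)[OF f])
  moreover have "(\<Sum>k<n. c * chaos_proj k f x) = c * f x" for x
    using chaos_decomposition(3)[OF f, of x] by (simp add: sum_distrib_left)
  ultimately show ?thesis by simp
qed

lemma chaos_proj_zero: "chaos_proj m (\<lambda>_. 0) = (\<lambda>_. 0)"
  by (rule chaos_proj_eqI[of 0]) (auto simp: chaos_zero)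

lemma chaos_proj_sq_poly:
  assumes "is_poly f"
  shows "chaos_proj m (sq_poly c f) = (\<lambda>x. of_real c ^ m * chaos_proj m f x)"
proof -
  note f = is_poly_pdeg[OF assms]
  have "chaos_proj m (\<lambda>x. \<Sum>k<Suc (pdeg f). of_real c ^ k * chaos_proj k f x) = (\<lambda>x. of_real c ^ m * chaos_proj m f x)"
    by (rule chaos_proj_sum) (auto intro: chaos_cmult chaos_decomposition[OF f] simp: chaos_decomposition(2)[OF f])
  then show ?thesis by (simp add: sq_poly_def lessThan_Suc_atMost)
qed

lemma is_poly_sq_poly:
  assumes "is_poly f"
  shows "is_poly (sq_poly c f)"
proof -
  note f = is_poly_pdeg[OF assms]
  have "poly_lt (Suc (pdeg f)) (sq_poly c f)"
    unfolding sq_poly_def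
    by (intro poly_lt_sum poly_lt_cmult poly_lt_mono[OF chaos_poly[OF chaos_decomposition(1)[OF f]]]) auto
  then show ?thesis by (auto simp: is_poly_iff)
qed

text \<open>Integrability holds at every x, not just almost everywhere; on polynomials
  \<open>mehler\<close> is therefore bilinear pointwise.\<close>

lemma poly_mehler_integrable:
  fixes f g :: "real^'n \<Rightarrow> complex"
  assumes f: "poly_lt m f" and g: "poly_lt n g"
  shows "integrable gauss (\<lambda>y. f (a *\<^sub>R x + b *\<^sub>R y) * g (b *\<^sub>R x - a *\<^sub>R y))"
proof -
  obtain C D where CD: "C \<ge> 0" "D \<ge> 0" "\<And>x. norm (f x) \<le> C * exp (norm x)" "\<And>x. norm (g x) \<le> D * exp (norm x)"
    using poly_lt_exp_bound[OF f] poly_lt_exp_bound[OF g] by blast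
  have [measurable]: "f \<in> borel_measurable borel" "g \<in> borel_measurable borel"
    using f g by (auto intro: poly_lt_measurable)
  show ?thesis
  proof (rule integrable_gauss_exp_bound)
    fix y
    have "norm (a *\<^sub>R x + b *\<^sub>R y) \<le> \<bar>a\<bar> * norm x + \<bar>b\<bar> * norm y"
      using norm_triangle_ineq[of "a *\<^sub>R x" "b *\<^sub>R y"] by simp
    then have 1: "norm (f (a *\<^sub>R x + b *\<^sub>R y)) \<le> C * exp (\<bar>a\<bar> * norm x + \<bar>b\<bar> * norm y)"
      by (intro order_trans[OF CD(3)] mult_left_mono CD(1)) simp
    have "norm (b *\<^sub>R x - a *\<^sub>R y) \<le> \<bar>b\<bar> * norm x + \<bar>a\<bar> * norm y"
      using norm_triangle_ineq4[of "b *\<^sub>R x" "a *\<^sub>R y"] by simp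
    then have 2: "norm (g (b *\<^sub>R x - a *\<^sub>R y)) \<le> D * exp (\<bar>b\<bar> * norm x + \<bar>a\<bar> * norm y)"
      by (intro order_trans[OF CD(4)] mult_left_mono CD(2)) simp
    have "norm (f (a *\<^sub>R x + b *\<^sub>R y) * g (b *\<^sub>R x - a *\<^sub>R y))
      \<le> (C * exp (\<bar>a\<bar> * norm x + \<bar>b\<bar> * norm y)) * (D * exp (\<bar>b\<bar> * norm x + \<bar>a\<bar> * norm y))"
      unfolding norm_mult by (intro mult_mono 1 2) (use CD in auto)
    also have "\<dots> = C * D * exp ((\<bar>a\<bar> + \<bar>b\<bar>) * norm x) * exp ((\<bar>a\<bar> + \<bar>b\<bar>) * norm y)"
      by (simp add: exp_add[symmetric] algebra_simps)
    finally show "norm (f (a *\<^sub>R x + b *\<^sub>R y) * g (b *\<^sub>R x - a *\<^sub>R y))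
      \<le> C * D * exp ((\<bar>a\<bar> + \<bar>b\<bar>) * norm x) * exp ((\<bar>a\<bar> + \<bar>b\<bar>) * norm y)" .
  qed measurable
qed

lemma mehler_sum:
  fixes F G :: "nat \<Rightarrow> real^'n \<Rightarrow> complex"
  assumes F: "\<And>m. poly_lt k (F m)" and G: "\<And>n. poly_lt l (G n)"
  shows "mehler a b (\<lambda>x. \<Sum>m\<in>I. F m x) (\<lambda>x. \<Sum>n\<in>J. G n x) x = (\<Sum>m\<in>I. \<Sum>n\<in>J. mehler a b (F m) (G n) x)"
  unfolding mehler_def sum_product
  by (simp add: Bochner_Integration.integral_sum poly_mehler_integrable[OF F G])

text \<open>Decompose f and g into homogeneous chaoses: the scalars a^m and b^n that
  \<open>sq_poly\<close> inserts are the ones that \<open>mehler_chaos\<close> produces.\<close>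

lemma wick_sq_poly_eq_mehler:
  fixes f g :: "real^'n \<Rightarrow> complex"
  assumes ab: "a\<^sup>2 + b\<^sup>2 = 1" "a \<noteq> 0" and f: "is_poly f" and g: "is_poly g"
  shows "wick (sq_poly a f) (sq_poly b g) = mehler a b f g"
proof
  fix x
  let ?A = "sq_poly a f" and ?B = "sq_poly b g"
  \<comment> \<open>\<open>sq_poly\<close> can lower the degree, for instance when b = 0, so all
    sums are extended to a common bound; the extra components are zero.\<close>
  define L where "L = max (max (pdeg f) (pdeg g)) (max (pdeg ?A) (pdeg ?B))"
  have dec: "(\<Sum>m\<le>L. chaos_proj m h y) = h y" "poly_lt (Suc L) (chaos_proj m h)" "poly_lt (Suc L) h"
    if "is_poly h" "pdeg h \<le> L" for h :: "real^'n \<Rightarrow> complex" and y m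
  proof -
    show L: "poly_lt (Suc L) h" by (rule poly_lt_mono[OF is_poly_pdeg[OF that(1)]]) (use that in simp)
    show "(\<Sum>m\<le>L. chaos_proj m h y) = h y"
      using chaos_decomposition(3)[OF L, of y] by (simp add: lessThan_Suc_atMost)
    show "poly_lt (Suc L) (chaos_proj m h)"
    proof (cases "m \<le> L")
      case True
      then show ?thesis by (intro poly_lt_mono[OF chaos_poly[OF chaos_decomposition(1)[OF L]]]) simp
    next
      case False
      then show ?thesis using chaos_decomposition(2)[OF L, of m] by simp
    qed
  qed
  have Lf: "pdeg f \<le> L" "pdeg g \<le> L" "pdeg ?A \<le> L" "pdeg ?B \<le> L" by (auto simp: L_def)
  have vA: "chaos_proj m ?A = (\<lambda>_. 0)" if "m > pdeg ?A" for m
    using chaos_decomposition(2)[OF is_poly_pdeg[OF is_poly_sq_poly[OF f]]] that by simp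
  have vB: "chaos_proj m ?B = (\<lambda>_. 0)" if "m > pdeg ?B" for m
    using chaos_decomposition(2)[OF is_poly_pdeg[OF is_poly_sq_poly[OF g]]] that by simp
  have "wick ?A ?B x = (\<Sum>m\<le>L. \<Sum>n\<le>pdeg ?B. chaos_proj (m + n) (\<lambda>y. chaos_proj m ?A y * chaos_proj n ?B y) x)"
    unfolding wick_def
    by (rule sum.mono_neutral_left) (use Lf(3) vA in \<open>auto simp: chaos_proj_zero\<close>)
  also have "\<dots> = (\<Sum>m\<le>L. \<Sum>n\<le>L. chaos_proj (m + n) (\<lambda>y. chaos_proj m ?A y * chaos_proj n ?B y) x)"
    by (intro sum.cong refl sum.mono_neutral_left) (use Lf(4) vB in \<open>auto simp: chaos_proj_zero\<close>)
  also have "\<dots> = (\<Sum>m\<le>L. \<Sum>n\<le>L. mehler a b (chaos_proj m f) (chaos_proj n g) x)"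
  proof (intro sum.cong refl)
    fix m n
    have cf: "chaos_proj m f \<in> chaos m" and cg: "chaos_proj n g \<in> chaos n"
      using chaos_decomposition(1) dec(3)[OF f Lf(1)] dec(3)[OF g Lf(2)] by blast+
    have p: "poly_lt (Suc (m + n)) (\<lambda>y. chaos_proj m f y * chaos_proj n g y)"
      using poly_lt_mult[OF chaos_poly[OF cf] chaos_poly[OF cg]] by simp
    have "(\<lambda>y. chaos_proj m ?A y * chaos_proj n ?B y)
        = (\<lambda>y. (of_real a ^ m * of_real b ^ n) * (chaos_proj m f y * chaos_proj n g y))"
      unfolding chaos_proj_sq_poly[OF f] chaos_proj_sq_poly[OF g] by (simp add: mult_ac)
    then show "chaos_proj (m + n) (\<lambda>y. chaos_proj m ?A y * chaos_proj n ?B y) x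
        = mehler a b (chaos_proj m f) (chaos_proj n g) x"
      using chaos_proj_cmult[OF p] by (simp add: mehler_chaos[OF ab cf cg])
  qed
  also have "\<dots> = mehler a b (\<lambda>x. \<Sum>m\<le>L. chaos_proj m f x) (\<lambda>x. \<Sum>n\<le>L. chaos_proj n g x) x"
    by (rule mehler_sum[symmetric]; rule dec(2)) (use f g Lf in auto)
  also have "\<dots> = mehler a b f g x"
    using dec(1)[OF f Lf(1)] dec(1)[OF g Lf(2)] by simp
  finally show "wick ?A ?B x = mehler a b f g x" .
qed

text \<open>The constant 1 lies in the chaos of order 0, and multiplying by it leaves each component
  in its chaos, so \<Gamma>(a) is the case g = 1.\<close>

lemma sq_poly_eq_mehler:
  fixes f :: "real^'n \<Rightarrow> complex"
  assumes ab: "a\<^sup>2 + b\<^sup>2 = 1" "a \<noteq> 0" and f: "is_poly f"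
  shows "sq_poly a f = mehler a b f (\<lambda>_. 1)"
proof
  fix x
  note pf = is_poly_pdeg[OF f]
  have one: "(\<lambda>_. 1) \<in> chaos 0"
    by (auto simp: chaos_def poly_fun_const)
  have pc: "poly_lt (Suc (pdeg f)) (chaos_proj m f)" for m
  proof (cases "m \<le> pdeg f")
    case True
    then show ?thesis by (intro poly_lt_mono[OF chaos_poly[OF chaos_decomposition(1)[OF pf]]]) simp
  next
    case False
    then show ?thesis using chaos_decomposition(2)[OF pf, of m] by simp
  qed
  have "mehler a b f (\<lambda>_. 1) x = mehler a b (\<lambda>x. \<Sum>m\<le>pdeg f. chaos_proj m f x) (\<lambda>x. \<Sum>n\<in>{0::nat}. 1) x"
  proof -
    have "(\<lambda>x. \<Sum>m\<le>pdeg f. chaos_proj m f x) = f"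
      by (rule ext) (rule chaos_decomposition(3)[OF pf, symmetric, unfolded lessThan_Suc_atMost])
    then show ?thesis by simp
  qed
  also have "\<dots> = (\<Sum>m\<le>pdeg f. mehler a b (chaos_proj m f) (\<lambda>_. 1) x)"
    using mehler_sum[where F = "\<lambda>m. chaos_proj m f" and G = "\<lambda>_ _. 1" and I = "{..pdeg f}" and J = "{0}"
        and a = a and b = b and x = x, OF pc chaos_poly[OF one]] by simp
  also have "\<dots> = sq_poly a f x"
    unfolding sq_poly_def mehler_chaos[OF ab chaos_decomposition(1)[OF pf] one]
    by (simp add: chaos_proj_chaos[OF chaos_decomposition(1)[OF pf]])
  finally show "sq_poly a f x = mehler a b f (\<lambda>_. 1) x" by simp
qed

section \<open>Density of polynomials\<close>

lemma borel_measurable_gauss: "borel_measurable (gauss :: (real^'n) measure) = borel_measurable borel"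
  by (rule measurable_cong_sets) simp_all

lemma is_poly_add: "is_poly f \<Longrightarrow> is_poly g \<Longrightarrow> is_poly (\<lambda>x. f x + g x)"
  unfolding is_poly_iff
proof (elim exE)
  fix m n assume "poly_lt m f" "poly_lt n g"
  then have "poly_lt (max m n) (\<lambda>x. f x + g x)"
    by (intro poly_lt_add) (auto intro: poly_lt_mono)
  then show "\<exists>n. poly_lt n (\<lambda>x. f x + g x)" by blast
qed

lemma is_poly_cmult: "is_poly f \<Longrightarrow> is_poly (\<lambda>x. c * f x)"
  unfolding is_poly_iff by (auto intro: poly_lt_cmult)

lemma is_poly_mult: "is_poly f \<Longrightarrow> is_poly g \<Longrightarrow> is_poly (\<lambda>x. f x * g x)"
  unfolding is_poly_def by (auto intro: poly_fun_mult)

lemma is_poly_const: "is_poly (\<lambda>_. c)"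
  unfolding is_poly_def by (auto intro: poly_fun_const)

lemma is_poly_sum: "(\<And>i. i \<in> I \<Longrightarrow> is_poly (f i)) \<Longrightarrow> is_poly (\<lambda>x. \<Sum>i\<in>I. f i x)"
  by (induction I rule: infinite_finite_induct) (auto intro: is_poly_add is_poly_const)

lemma is_poly_power: "is_poly f \<Longrightarrow> is_poly (\<lambda>x. f x ^ k)"
  by (induction k) (auto intro: is_poly_mult is_poly_const)

lemma is_poly_inner: "is_poly (\<lambda>x :: real^'n. complex_of_real (t \<bullet> x))"
proof -
  have "is_poly (\<lambda>x :: real^'n. \<Sum>i\<in>UNIV. complex_of_real (t $ i) * complex_of_real (x $ i))"
    by (intro is_poly_sum is_poly_cmult) (auto simp: is_poly_def intro: poly_fun_coord)
  then show ?thesis by (simp add: inner_vec_def)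
qed

lemma is_poly_integrable: "is_poly f \<Longrightarrow> integrable gauss f"
  by (auto simp: is_poly_iff intro: poly_lt_integrable)

lemma is_poly_measurable: "is_poly f \<Longrightarrow> f \<in> borel_measurable borel"
  by (auto simp: is_poly_iff intro: poly_lt_measurable)

definition poly_approx :: "(real^'n \<Rightarrow> complex) \<Rightarrow> bool" where
  "poly_approx f \<longleftrightarrow> integrable gauss f \<and> (\<forall>e>0. \<exists>p. is_poly p \<and> (\<integral>x. norm (f x - p x) \<partial>gauss) < e)"

lemma poly_approx_limit:
  assumes f: "integrable gauss f" and lim: "\<And>e. 0 < e \<Longrightarrow> \<exists>g. poly_approx g \<and> (\<integral>x. norm (f x - g x) \<partial>gauss) < e"
  shows "poly_approx f"
  unfolding poly_approx_def
proof (intro conjI allI impI f)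
  fix e :: real assume "0 < e"
  then obtain g where g: "poly_approx g" "(\<integral>x. norm (f x - g x) \<partial>gauss) < e/2"
    using lim[of "e/2"] by auto
  then obtain p where p: "is_poly p" "(\<integral>x. norm (g x - p x) \<partial>gauss) < e/2"
    unfolding poly_approx_def using \<open>0 < e\<close> by (meson half_gt_zero)
  have "(\<integral>x. norm (f x - p x) \<partial>gauss) < e"
    using gauss_dist_triangle[OF f _ is_poly_integrable[OF p(1)], of g] g p by (simp add: poly_approx_def)
  then show "\<exists>p. is_poly p \<and> (\<integral>x. norm (f x - p x) \<partial>gauss) < e" using p by blast
qed

lemma poly_approx_add:
  assumes f: "poly_approx f" and g: "poly_approx g"
  shows "poly_approx (\<lambda>x. f x + g x)"
  unfolding poly_approx_def
proof (intro conjI allI impI)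
  have i: "integrable gauss f" "integrable gauss g" using f g by (auto simp: poly_approx_def)
  then show "integrable gauss (\<lambda>x. f x + g x)" by simp
  fix e :: real assume "0 < e"
  then obtain p q where p: "is_poly p" "(\<integral>x. norm (f x - p x) \<partial>gauss) < e/2"
    and q: "is_poly q" "(\<integral>x. norm (g x - q x) \<partial>gauss) < e/2"
    using f g unfolding poly_approx_def by (meson half_gt_zero)
  have ip: "integrable gauss p" "integrable gauss q" using p q by (auto intro: is_poly_integrable)
  have "(\<integral>x. norm (f x + g x - (p x + q x)) \<partial>gauss) \<le> (\<integral>x. norm (f x - p x) + norm (g x - q x) \<partial>gauss)"
    using i ip by (intro integral_mono) (auto simp: norm_diff_triangle_ineq)
  also have "\<dots> < e" using i ip p q by simp
  finally show "\<exists>p. is_poly p \<and> (\<integral>x. norm (f x + g x - p x) \<partial>gauss) < e"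
    using is_poly_add[OF p(1) q(1)] by blast
qed

lemma poly_approx_cmult:
  assumes f: "poly_approx f"
  shows "poly_approx (\<lambda>x. c * f x)"
  unfolding poly_approx_def
proof (intro conjI allI impI)
  have i: "integrable gauss f" using f by (auto simp: poly_approx_def)
  then show "integrable gauss (\<lambda>x. c * f x)" by simp
  fix e :: real assume "0 < e"
  then have "0 < e / (norm c + 1)" by (simp add: add_nonneg_pos)
  then obtain p where p: "is_poly p" "(\<integral>x. norm (f x - p x) \<partial>gauss) < e / (norm c + 1)"
    using f unfolding poly_approx_def by blast
  have "(\<integral>x. norm (c * f x - c * p x) \<partial>gauss) = norm c * (\<integral>x. norm (f x - p x) \<partial>gauss)"
    by (simp add: right_diff_distrib[symmetric] norm_mult)
  also have "\<dots> \<le> norm c * (e / (norm c + 1))" using p by (intro mult_left_mono) auto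
  also have "\<dots> < e" using \<open>0 < e\<close> by (simp add: divide_simps add_nonneg_pos)
  finally show "\<exists>p. is_poly p \<and> (\<integral>x. norm (c * f x - p x) \<partial>gauss) < e"
    using is_poly_cmult[OF p(1)] by blast
qed

text \<open>The partial sums of the exponential series are polynomials dominated by exp (|t| |x|).
  This function is integrable, which is where the Gaussian tails enter the density argument.\<close>

lemma poly_approx_exp: "poly_approx (\<lambda>x :: real^'n. exp (\<i> * complex_of_real (t \<bullet> x)))"
proof -
  define z where "z x = \<i> * complex_of_real (t \<bullet> x)" for x :: "real^'n"
  define S where "S N x = (\<Sum>k<N. inverse (fact k) *\<^sub>R z x ^ k)" for N :: nat and x :: "real^'n"
  have zn: "norm (z x) \<le> norm t * norm x" for x
    using Cauchy_Schwarz_ineq2[of t x] by (simp add: z_def norm_mult)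
  have S: "is_poly (S N)" for N
    unfolding S_def z_def scaleR_conv_of_real by (intro is_poly_sum is_poly_cmult is_poly_power is_poly_inner)
  note [measurable] = is_poly_measurable[OF S]
  have [measurable]: "(\<lambda>x. exp (z x)) \<in> borel_measurable borel"
    unfolding z_def by (intro borel_measurable_continuous_onI continuous_intros)
  have Sn: "norm (S N x) \<le> exp (norm t * norm x)" for N x
  proof -
    have "norm (S N x) \<le> (\<Sum>k<N. inverse (fact k) *\<^sub>R norm (z x) ^ k)"
      unfolding S_def by (rule order_trans[OF norm_sum]) (simp add: norm_power norm_mult)
    also have "\<dots> \<le> exp (norm (z x))"
      unfolding exp_def by (intro sum_le_suminf summable_exp_generic) auto
    also have "\<dots> \<le> exp (norm t * norm x)" using zn by simp
    finally show ?thesis .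
  qed
  have en: "norm (exp (z x)) \<le> exp (norm t * norm x)" for x
    using norm_exp[of "z x"] zn[of x] by (meson exp_le_cancel_iff order_trans)
  have lim: "(\<lambda>N. S N x) \<longlonglongrightarrow> exp (z x)" for x
    unfolding S_def exp_def by (rule summable_LIMSEQ[OF summable_exp_generic])
  have "(\<lambda>N. \<integral>x. norm (exp (z x) - S N x) \<partial>gauss) \<longlonglongrightarrow> (\<integral>x. 0 \<partial>(gauss :: (real^'n) measure))"
  proof (rule integral_dominated_convergence[where w = "\<lambda>x. 2 * exp (norm t * norm x)"])
    show "integrable gauss (\<lambda>x::real^'n. 2 * exp (norm t * norm x))"
      by (intro integrable_mult_right integrable_gauss_exp_norm)
    show "AE x in gauss. (\<lambda>N. norm (exp (z x) - S N x)) \<longlonglongrightarrow> 0"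
      using lim by (intro AE_I2 tendsto_norm_zero) (auto intro!: tendsto_eq_intros)
    show "AE x in gauss. norm (norm (exp (z x) - S N x)) \<le> 2 * exp (norm t * norm x)" for N
    proof (rule AE_I2)
      fix x
      show "norm (norm (exp (z x) - S N x)) \<le> 2 * exp (norm t * norm x)"
        using norm_triangle_ineq4[of "exp (z x)" "S N x"] en[of x] Sn[of N x] unfolding real_norm_def abs_norm_cancel by linarith
    qed
  qed measurable
  then have conv: "(\<lambda>N. \<integral>x. norm (exp (z x) - S N x) \<partial>gauss) \<longlonglongrightarrow> 0" by simp
  have "poly_approx (\<lambda>x. exp (z x))"
    unfolding poly_approx_def
  proof (intro conjI allI impI)
    show "integrable gauss (\<lambda>x. exp (z x))"
      by (rule integrable_gauss_exp_bound[of _ 1 "norm t"]) (use en in auto)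
    fix e :: real assume "0 < e"
    then obtain N where "(\<integral>x. norm (exp (z x) - S N x) \<partial>gauss) < e"
      using order_tendstoD(2)[OF conv, of e] by (auto simp: eventually_sequentially)
    then show "\<exists>p. is_poly p \<and> (\<integral>x. norm (exp (z x) - p x) \<partial>gauss) < e" using S by blast
  qed
  then show ?thesis by (simp add: z_def)
qed

section \<open>Trigonometric polynomials and approximation of bounded Lipschitz functions\<close>

text \<open>Bounded substitutes for polynomials. The product formula for cosines makes them an
  algebra; the phase \<theta> provides sines, and t = 0 provides the constants.\<close>

inductive trig_poly :: "(real^'n \<Rightarrow> real) \<Rightarrow> bool" where
  cos: "trig_poly (\<lambda>x. c * cos (t \<bullet> x + \<theta>))"
| add: "trig_poly f \<Longrightarrow> trig_poly g \<Longrightarrow> trig_poly (\<lambda>x. f x + g x)"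

lemma trig_poly_const: "trig_poly (\<lambda>_. c)"
  using trig_poly.cos[of c 0 0] by simp

lemma trig_poly_mult:
  assumes "trig_poly f" "trig_poly g"
  shows "trig_poly (\<lambda>x. f x * g x)"
  using assms(1)
proof induction
  case (cos c t \<theta>)
  show ?case
    using assms(2)
  proof induction
    case c2: (cos d s \<eta>)
    have "(\<lambda>x. c * cos (t \<bullet> x + \<theta>) * (d * cos (s \<bullet> x + \<eta>)))
      = (\<lambda>x. (c * d / 2) * cos ((t - s) \<bullet> x + (\<theta> - \<eta>)) + (c * d / 2) * cos ((t + s) \<bullet> x + (\<theta> + \<eta>)))"
    proof
      fix x
      have "c * cos (t \<bullet> x + \<theta>) * (d * cos (s \<bullet> x + \<eta>)) = c * d * (cos (t \<bullet> x + \<theta>) * cos (s \<bullet> x + \<eta>))" by simp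
      also have "cos (t \<bullet> x + \<theta>) * cos (s \<bullet> x + \<eta>)
        = (cos ((t \<bullet> x + \<theta>) - (s \<bullet> x + \<eta>)) + cos ((t \<bullet> x + \<theta>) + (s \<bullet> x + \<eta>))) / 2" by (rule cos_times_cos)
      also have "(t \<bullet> x + \<theta>) - (s \<bullet> x + \<eta>) = (t - s) \<bullet> x + (\<theta> - \<eta>)" by (simp add: inner_diff_left)
      also have "(t \<bullet> x + \<theta>) + (s \<bullet> x + \<eta>) = (t + s) \<bullet> x + (\<theta> + \<eta>)" by (simp add: inner_add_left)
      finally show "c * cos (t \<bullet> x + \<theta>) * (d * cos (s \<bullet> x + \<eta>))
        = (c * d / 2) * cos ((t - s) \<bullet> x + (\<theta> - \<eta>)) + (c * d / 2) * cos ((t + s) \<bullet> x + (\<theta> + \<eta>))"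
        by (simp add: field_simps)
    qed
    then show ?case by (simp only: trig_poly.add trig_poly.cos)
  next
    case (add f g)
    from trig_poly.add[OF this(3,4)] show ?case by (simp add: distrib_left)
  qed
next
  case (add f1 f2)
  from trig_poly.add[OF this(3,4)] show ?case by (simp add: distrib_right)
qed

lemma trig_poly_continuous: "trig_poly f \<Longrightarrow> continuous_on S f"
  by (induction rule: trig_poly.induct) (auto intro!: continuous_intros)

lemma trig_poly_bounded:
  assumes "trig_poly f"
  shows "\<exists>B\<ge>0. \<forall>x. \<bar>f x\<bar> \<le> B"
  using assms
proof induction
  case (cos c t \<theta>)
  have "\<bar>c * cos y\<bar> \<le> \<bar>c\<bar>" for y using abs_cos_le_one[of y] by (simp add: abs_mult mult_left_le)
  then show ?case by (intro exI[of _ "\<bar>c\<bar>"]) auto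
next
  case (add f g)
  then obtain B C where "B \<ge> 0" "C \<ge> 0" "\<And>x. \<bar>f x\<bar> \<le> B" "\<And>x. \<bar>g x\<bar> \<le> C" by blast
  then show ?case by (intro exI[of _ "B + C"]) (auto intro: order_trans[OF abs_triangle_ineq add_mono])
qed

lemma trig_poly_approx:
  assumes "trig_poly f"
  shows "poly_approx (\<lambda>x. complex_of_real (f x))"
  using assms
proof induction
  case (cos c t \<theta>)
  have e: "complex_of_real (c * cos (t \<bullet> x + \<theta>))
    = (c / 2 * exp (\<i> * of_real \<theta>)) * exp (\<i> * complex_of_real (t \<bullet> x))
      + (c / 2 * exp (- \<i> * of_real \<theta>)) * exp (\<i> * complex_of_real ((- t) \<bullet> x))" for x
  proof -
    have "complex_of_real (cos (t \<bullet> x + \<theta>)) = (exp (\<i> * complex_of_real (t \<bullet> x + \<theta>)) + exp (- (\<i> * complex_of_real (t \<bullet> x + \<theta>)))) / 2"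
      unfolding cos_of_real[symmetric] by (rule cos_exp_eq)
    then show ?thesis by (simp add: distrib_left exp_add[symmetric] exp_diff field_simps exp_minus)
  qed
  show ?case
    unfolding e by (intro poly_approx_add poly_approx_cmult poly_approx_exp)
next
  case (add f g)
  from poly_approx_add[OF this(3,4)] show ?case by simp
qed

lemma trig_poly_real_polynomial:
  assumes "real_polynomial_function q" "trig_poly \<tau>"
  shows "trig_poly (\<lambda>x. q (\<tau> x))"
  using assms(1)
proof induction
  case (linear f)
  then obtain c where "f = (\<lambda>y. y * c)" using real_bounded_linear by blast
  then show ?case using trig_poly_mult[OF assms(2) trig_poly_const[of c]] by simp
qed (auto intro: trig_poly.add trig_poly_mult trig_poly_const)

text \<open>The Stone-Weierstrass approximant on a ball is uncontrolled outside; clipping it at the bound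
  of \<open>g\<close> and approximating the clipping function by a polynomial keeps it a trigonometric polynomial.\<close>
lemma lipschitz_poly_approx:
  fixes g :: "real^'n \<Rightarrow> real"
  assumes L: "L-lipschitz_on UNIV g" and B: "\<And>x. \<bar>g x\<bar> \<le> B"
  shows "poly_approx (\<lambda>x. complex_of_real (g x))"
proof (rule poly_approx_limit)
  note [measurable] = lipschitz_borel_measurable[OF L]
  have ig: "integrable gauss g" by (rule bounded_lipschitz_integrable[OF L B])
  then show "integrable gauss (\<lambda>x. complex_of_real (g x))" by simp
  fix e :: real assume e: "0 < e"
  define \<kappa> where "\<kappa> = (\<integral>y. norm y \<partial>(gauss :: (real^'n) measure))"
  have \<kappa>: "0 \<le> \<kappa>" by (simp add: \<kappa>_def)
  have B0: "0 \<le> B" using B[of 0] by linarith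
  \<comment> \<open>Outside the ball of radius R the error is at most 2 B |x| / R up to e/8. The
    choice makes 2 B \<kappa> / R smaller than 3 e / 4, and the summand 1 keeps R positive.\<close>
  define R where "R = (4 * B * \<kappa> + 1) / e"
  have R: "0 < R" using e B0 \<kappa> by (simp add: R_def add_nonneg_pos)
  have cg: "continuous_on (cball 0 R) g"
    using lipschitz_on_continuous_on[OF L] continuous_on_subset by blast
  have "\<exists>\<tau>. trig_poly \<tau> \<and> (\<forall>x\<in>cball 0 R. \<bar>g x - \<tau> x\<bar> < e/8)"
  proof (rule Stone_Weierstrass_HOL[where P = trig_poly])
    fix x y :: "real^'n" assume "x \<in> cball 0 R \<and> y \<in> cball 0 R \<and> x \<noteq> y"
    then have n: "(x - y) \<bullet> (x - y) \<noteq> 0" by simp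
    \<comment> \<open>A cosine in the direction x - y, with the phase chosen so that it is 1 at y
      and 0 at x, separates the points.\<close>
    define u where "u = (pi / 2 / ((x - y) \<bullet> (x - y))) *\<^sub>R (x - y)"
    have "trig_poly (\<lambda>z. 1 * cos (u \<bullet> z + (- (u \<bullet> y))))" by (rule trig_poly.cos)
    moreover have "cos (u \<bullet> x + (- (u \<bullet> y))) = 0"
    proof -
      have "u \<bullet> x + (- (u \<bullet> y)) = u \<bullet> (x - y)" by (simp add: inner_diff_right)
      also have "\<dots> = pi / 2" unfolding u_def inner_scaleR_left using n by (simp only: times_divide_eq_left) simp
      finally show ?thesis by (simp only: cos_pi_half)
    qed
    ultimately show "\<exists>f. trig_poly f \<and> f x \<noteq> f y"
      by (intro exI[of _ "\<lambda>z. 1 * cos (u \<bullet> z + (- (u \<bullet> y)))"]) simp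
  qed (use e cg in \<open>auto intro: trig_poly_const trig_poly_continuous trig_poly.add trig_poly_mult\<close>)
  then obtain \<tau> where \<tau>: "trig_poly \<tau>" "\<And>x. norm x \<le> R \<Longrightarrow> \<bar>g x - \<tau> x\<bar> < e/8" by auto
  obtain T where "0 \<le> T \<and> (\<forall>x. \<bar>\<tau> x\<bar> \<le> T)"
    using trig_poly_bounded[OF \<tau>(1)] ..
  then have T: "\<bar>\<tau> x\<bar> \<le> T" for x by simp
  \<comment> \<open>Clipping brings the values closer to g, which lies in [-B, B]. The range of
    \<tau> lies in the compact interval [-T, T], so \<open>clip\<close> can be approximated by a
    polynomial there.\<close>
  define clip where "clip y = max (- B) (min B y)" for y :: real
  have "continuous_on {-T..T} clip" unfolding clip_def by (intro continuous_intros)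
  then obtain q where q: "real_polynomial_function q" "\<And>y. y \<in> {-T..T} \<Longrightarrow> \<bar>clip y - q y\<bar> < e/8"
    by (rule Stone_Weierstrass_real_polynomial_function[rotated 1, of "{-T..T}" clip "e/8"]) (use e in auto)
  define h where "h x = q (\<tau> x)" for x
  have h: "trig_poly h" unfolding h_def by (rule trig_poly_real_polynomial[OF q(1) \<tau>(1)])
  have pt: "\<bar>g x - h x\<bar> \<le> e/4 + 2 * B / R * norm x" for x
  proof -
    have 1: "\<bar>clip (\<tau> x) - h x\<bar> < e/8" unfolding h_def using T[of x] by (intro q(2)) (auto simp: abs_le_iff)
    show ?thesis
    proof (cases "norm x \<le> R")
      case True
      have "\<bar>g x - clip (\<tau> x)\<bar> \<le> \<bar>g x - \<tau> x\<bar>" unfolding clip_def using B[of x] by linarith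
      with 1 \<tau>(2)[OF True] have "\<bar>g x - h x\<bar> \<le> e/4" by linarith
      also have "e/4 \<le> e/4 + 2 * B / R * norm x" using B0 R by simp
      finally show ?thesis .
    next
      case False
      have "\<bar>g x - clip (\<tau> x)\<bar> \<le> 2 * B" unfolding clip_def using B[of x] B0 by linarith
      moreover have "2 * B \<le> 2 * B / R * norm x"
      proof -
        have "2 * B * R \<le> 2 * B * norm x" using False B0 by (intro mult_left_mono) auto
        then show ?thesis using R by (simp add: field_simps)
      qed
      ultimately show ?thesis using 1 e by linarith
    qed
  qed
  obtain B' where "0 \<le> B' \<and> (\<forall>x. \<bar>h x\<bar> \<le> B')"
    using trig_poly_bounded[OF h] ..
  then have B': "\<bar>h x\<bar> \<le> B'" for x by simp
  have hm [measurable]: "h \<in> borel_measurable borel"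
    by (intro borel_measurable_continuous_onI trig_poly_continuous h)
  have ih: "integrable gauss h"
    using B' by (intro gauss.integrable_const_bound[of _ B']) auto
  have inorm: "integrable gauss (\<lambda>y::real^'n. norm y)"
    using integrable_gauss_norm_power[of 0 1] by simp
  have "(\<integral>x. norm (complex_of_real (g x) - complex_of_real (h x)) \<partial>gauss) = (\<integral>x. \<bar>g x - h x\<bar> \<partial>gauss)"
    unfolding of_real_diff[symmetric] norm_of_real ..
  also have "\<dots> \<le> (\<integral>x. e/4 + 2 * B / R * norm x \<partial>(gauss :: (real^'n) measure))"
    using ig ih inorm by (intro integral_mono pt) auto
  also have "\<dots> = e/4 + 2 * B / R * \<kappa>" using inorm by (simp add: \<kappa>_def)
  also have "\<dots> < e"
  proof -
    have "R * e = 4 * B * \<kappa> + 1" using e by (simp add: R_def)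
    then have "R * (e * 3 / 4) = (4 * (B * \<kappa>) + 1) * 3 / 4" by simp
    then have "2 * B * \<kappa> < R * (e * 3 / 4)" using mult_nonneg_nonneg[OF B0 \<kappa>] by simp
    then have "2 * B * \<kappa> / R < e * 3 / 4" using R by (simp add: field_simps)
    then show ?thesis by simp
  qed
  finally show "\<exists>k. poly_approx k \<and> (\<integral>x. norm (complex_of_real (g x) - k x) \<partial>gauss) < e"
    using trig_poly_approx[OF h] by blast
qed

lemma poly_dense_L1:
  fixes f :: "real^'n \<Rightarrow> complex"
  assumes f: "integrable gauss f"
  shows "poly_approx f"
proof -
  have re: "poly_approx (\<lambda>x. complex_of_real (h x))" if h: "integrable gauss h" for h :: "real^'n \<Rightarrow> real"
  proof (rule poly_approx_limit)
    show "integrable gauss (\<lambda>x. complex_of_real (h x))" using h by simp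
    fix e :: real assume "0 < e"
    then obtain g L B where g: "L-lipschitz_on UNIV g" "\<And>x. \<bar>g x\<bar> \<le> B" "(\<integral>x. \<bar>h x - g x\<bar> \<partial>gauss) < e"
      using lipschitz_dense_L1[OF h] unfolding lip_approx_def by blast
    have "(\<integral>x. norm (complex_of_real (h x) - complex_of_real (g x)) \<partial>gauss) < e"
      unfolding of_real_diff[symmetric] norm_of_real by (rule g(3))
    then show "\<exists>k. poly_approx k \<and> (\<integral>x. norm (complex_of_real (h x) - k x) \<partial>gauss) < e"
      using lipschitz_poly_approx[OF g(1,2)] by blast
  qed
  have "poly_approx (\<lambda>x. complex_of_real (Re (f x)) + \<i> * complex_of_real (Im (f x)))"
    using f by (intro poly_approx_add poly_approx_cmult re integrable_Re integrable_Im)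
  then show ?thesis by (simp add: complex_eq[symmetric])
qed

section \<open>Extension to integrable functions\<close>

text \<open>By rotation invariance the absolute value of the integrand has the product of the L^1
  norms as its double integral; Fubini adds that almost every section is integrable.\<close>

lemma mehler_L1:
  fixes f g :: "real^'n \<Rightarrow> complex"
  assumes ab: "a\<^sup>2 + b\<^sup>2 = 1" "a \<noteq> 0" and f: "integrable gauss f" and g: "integrable gauss g"
  shows "integrable gauss (mehler a b f g)"
    and "(\<integral>x. norm (mehler a b f g x) \<partial>gauss) \<le> (\<integral>x. norm (f x) \<partial>gauss) * (\<integral>x. norm (g x) \<partial>gauss)"
    and "AE x in gauss. integrable gauss (\<lambda>y. f (a *\<^sub>R x + b *\<^sub>R y) * g (b *\<^sub>R x - a *\<^sub>R y))"
proof -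
  let ?D = "\<lambda>z. f (a *\<^sub>R fst z + b *\<^sub>R snd z) * g (b *\<^sub>R fst z - a *\<^sub>R snd z)"
  have i: "integrable (gauss \<Otimes>\<^sub>M gauss) ?D" by (rule mehler_integrable_pair[OF ab f g])
  show im: "integrable gauss (mehler a b f g)"
    using gauss2.integrable_fst'[OF i] by (simp add: mehler_def[abs_def])
  show "AE x in gauss. integrable gauss (\<lambda>y. f (a *\<^sub>R x + b *\<^sub>R y) * g (b *\<^sub>R x - a *\<^sub>R y))"
    using gauss2.AE_integrable_fst'[OF i] by simp
  note i' = integrable_norm[OF i]
  have p: "integrable (gauss \<Otimes>\<^sub>M gauss) (\<lambda>z. norm (f (fst z)) * norm (g (snd z)))"
    by (rule gauss_pair_mult(1)[OF integrable_norm[OF f] integrable_norm[OF g]])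
  have "(\<integral>x. norm (mehler a b f g x) \<partial>gauss) \<le> (\<integral>x. (\<integral>y. norm (?D (x, y)) \<partial>gauss) \<partial>gauss)"
  proof (rule integral_mono[OF integrable_norm[OF im] gauss2.integrable_fst'[OF i']])
    show "norm (mehler a b f g x) \<le> (\<integral>y. norm (?D (x, y)) \<partial>gauss)" for x
      unfolding mehler_def fst_conv snd_conv by (rule integral_norm_bound)
  qed
  also have "\<dots> = (\<integral>z. norm (?D z) \<partial>(gauss \<Otimes>\<^sub>M gauss))"
    by (rule gauss2.integral_fst'[OF i'])
  also have "\<dots> = (\<integral>z. norm (f (fst z)) * norm (g (snd z)) \<partial>(gauss \<Otimes>\<^sub>M gauss))"
    using integral_gauss_rotate[OF ab borel_measurable_integrable[OF p]] by (simp add: split_beta' norm_mult)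
  also have "\<dots> = (\<integral>x. norm (f x) \<partial>gauss) * (\<integral>x. norm (g x) \<partial>gauss)"
    by (rule gauss_pair_mult(2)[OF integrable_norm[OF f] integrable_norm[OF g]])
  finally show "(\<integral>x. norm (mehler a b f g x) \<partial>gauss) \<le> (\<integral>x. norm (f x) \<partial>gauss) * (\<integral>x. norm (g x) \<partial>gauss)" .
qed

lemma L1_conv_iff:
  assumes "\<And>k. integrable gauss (fs k)" "integrable gauss f"
  shows "L1_conv fs f \<longleftrightarrow> (\<lambda>k. \<integral>x. norm (fs k x - f x) \<partial>gauss) \<longlonglongrightarrow> 0"
proof -
  have "(\<integral>\<^sup>+x. ennreal (cmod (fs k x - f x)) \<partial>gauss) = ennreal (\<integral>x. norm (fs k x - f x) \<partial>gauss)" for k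
    using assms by (intro nn_integral_eq_integral) auto
  then show ?thesis
    unfolding L1_conv_def by (simp add: ennreal_tendsto_0_iff)
qed

lemma L1_conv_unique:
  assumes fs: "\<And>k. integrable gauss (fs k)" and f: "integrable gauss f" and g: "integrable gauss g"
    and "L1_conv fs f" "L1_conv fs g"
  shows "AE x in gauss. f x = g x"
proof -
  have l: "(\<lambda>k. \<integral>x. norm (fs k x - f x) \<partial>gauss) \<longlonglongrightarrow> 0" "(\<lambda>k. \<integral>x. norm (fs k x - g x) \<partial>gauss) \<longlonglongrightarrow> 0"
    using assms by (simp_all add: L1_conv_iff)
  have "(\<integral>x. norm (f x - g x) \<partial>gauss) \<le> 0 + 0"
  proof (rule LIMSEQ_le_const[OF tendsto_add[OF l]], intro exI allI impI)
    fix k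
    show "(\<integral>x. norm (f x - g x) \<partial>gauss) \<le> (\<integral>x. norm (fs k x - f x) \<partial>gauss) + (\<integral>x. norm (fs k x - g x) \<partial>gauss)"
      using gauss_dist_triangle[OF f fs g, of k] by (simp add: norm_minus_commute)
  qed
  then have "(\<integral>x. norm (f x - g x) \<partial>gauss) = 0"
    by (simp add: order_antisym)
  then have "AE x in gauss. norm (f x - g x) = 0"
    using f g by (subst (asm) integral_nonneg_eq_0_iff_AE) auto
  then show ?thesis by simp
qed

text \<open>Continuity of a bounded bilinear map: with d and e the errors of the two factors, the
  difference splits into the images of (d, e), (d, \<psi>) and (\<phi>, e).\<close>

lemma L1_conv_mehler:
  fixes \<phi> \<psi> :: "real^'n \<Rightarrow> complex"
  assumes ab: "a\<^sup>2 + b\<^sup>2 = 1" "a \<noteq> 0"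
    and fs: "\<And>k. integrable gauss (fs k)" and gs: "\<And>k. integrable gauss (gs k)"
    and \<phi>: "integrable gauss \<phi>" and \<psi>: "integrable gauss \<psi>"
    and lf: "L1_conv fs \<phi>" and lg: "L1_conv gs \<psi>"
  shows "L1_conv (\<lambda>k. mehler a b (fs k) (gs k)) (mehler a b \<phi> \<psi>)"
proof -
  define N where "N f = (\<integral>x. norm (f x) \<partial>gauss)" for f :: "real^'n \<Rightarrow> complex"
  let ?d = "\<lambda>k x. fs k x - \<phi> x" and ?e = "\<lambda>k x. gs k x - \<psi> x"
  have id: "integrable gauss (?d k)" "integrable gauss (?e k)" for k using fs gs \<phi> \<psi> by auto
  have d: "(\<lambda>k. N (?d k)) \<longlonglongrightarrow> 0" "(\<lambda>k. N (?e k)) \<longlonglongrightarrow> 0"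
    using lf lg by (simp_all add: L1_conv_iff fs gs \<phi> \<psi> N_def)
  have le: "(\<integral>x. norm (mehler a b (fs k) (gs k) x - mehler a b \<phi> \<psi> x) \<partial>gauss)
      \<le> N (?d k) * N (?e k) + N (?d k) * N \<psi> + N \<phi> * N (?e k)" for k
  proof -
    note m1 = mehler_L1[OF ab id(1)[of k] id(2)[of k]] and m2 = mehler_L1[OF ab id(1)[of k] \<psi>]
      and m3 = mehler_L1[OF ab \<phi> id(2)[of k]]
    have i: "integrable gauss (\<lambda>x. mehler a b (fs k) (gs k) x - mehler a b \<phi> \<psi> x)"
      using mehler_L1(1)[OF ab fs gs] mehler_L1(1)[OF ab \<phi> \<psi>] by simp
    \<comment> \<open>The splitting holds at points where all five sections are integrable, hence
      almost everywhere.\<close>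
    have "AE x in gauss. mehler a b (fs k) (gs k) x - mehler a b \<phi> \<psi> x
      = mehler a b (?d k) (?e k) x + mehler a b (?d k) \<psi> x + mehler a b \<phi> (?e k) x"
      using m1(3) m2(3) m3(3) mehler_L1(3)[OF ab \<phi> \<psi>] mehler_L1(3)[OF ab fs[of k] gs[of k]]
    proof eventually_elim
      case (elim x)
      show ?case unfolding mehler_def
        unfolding Bochner_Integration.integral_add[OF elim(1,2), symmetric]
          Bochner_Integration.integral_diff[OF elim(5,4), symmetric]
          Bochner_Integration.integral_add[OF Bochner_Integration.integrable_add[OF elim(1,2)] elim(3), symmetric]
        by (intro Bochner_Integration.integral_cong refl) (simp add: algebra_simps)
    qed
    then have "(\<integral>x. norm (mehler a b (fs k) (gs k) x - mehler a b \<phi> \<psi> x) \<partial>gauss)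
      \<le> (\<integral>x. norm (mehler a b (?d k) (?e k) x) + norm (mehler a b (?d k) \<psi> x) + norm (mehler a b \<phi> (?e k) x) \<partial>gauss)"
      using i m1(1) m2(1) m3(1)
      by (intro integral_mono_AE) (auto elim!: eventually_mono intro!: order_trans[OF norm_triangle_ineq] add_mono norm_triangle_ineq)
    also have "\<dots> = N (mehler a b (?d k) (?e k)) + N (mehler a b (?d k) \<psi>) + N (mehler a b \<phi> (?e k))"
      using m1(1) m2(1) m3(1) by (simp add: N_def)
    also have "\<dots> \<le> N (?d k) * N (?e k) + N (?d k) * N \<psi> + N \<phi> * N (?e k)"
      unfolding N_def by (intro add_mono m1(2) m2(2) m3(2))
    finally show ?thesis .
  qed
  have "(\<lambda>k. N (?d k) * N (?e k) + N (?d k) * N \<psi> + N \<phi> * N (?e k)) \<longlonglongrightarrow> 0 * 0 + 0 * N \<psi> + N \<phi> * 0"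
    by (intro tendsto_intros d)
  then have z: "(\<lambda>k. N (?d k) * N (?e k) + N (?d k) * N \<psi> + N \<phi> * N (?e k)) \<longlonglongrightarrow> 0"
    by simp
  have "(\<lambda>k. \<integral>x. norm (mehler a b (fs k) (gs k) x - mehler a b \<phi> \<psi> x) \<partial>gauss) \<longlonglongrightarrow> 0"
    by (rule tendsto_sandwich[OF _ _ tendsto_const z]) (intro always_eventually allI le | simp)+
  then show ?thesis
    by (subst L1_conv_iff) (auto intro: mehler_L1(1)[OF ab] fs gs \<phi> \<psi>)
qed

text \<open>Without such sequences the limit property in \<open>ext1\<close> and \<open>ext2\<close>
  would be vacuous; with them the chosen function is pinned down up to null sets.\<close>

lemma poly_L1_sequence:
  assumes f: "integrable gauss f"
  obtains as where "\<And>k. is_poly (as k)" "L1_conv as f"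
proof -
  define P where "P k p \<longleftrightarrow> is_poly p \<and> (\<integral>x. norm (f x - p x) \<partial>gauss) < 1 / real (Suc k)" for k p
  have "\<exists>p. P k p" for k
    using poly_dense_L1[OF f] unfolding poly_approx_def P_def by simp
  then obtain as where as: "\<And>k. P k (as k)" by metis
  have p: "is_poly (as k)" and d: "(\<integral>x. norm (f x - as k x) \<partial>gauss) < 1 / real (Suc k)" for k
    using as[of k] by (auto simp: P_def)
  have "(\<lambda>k. \<integral>x. norm (as k x - f x) \<partial>gauss) \<longlonglongrightarrow> 0"
  proof (rule tendsto_sandwich[OF _ _ tendsto_const LIMSEQ_Suc[OF lim_1_over_n]])
    show "eventually (\<lambda>k. (\<integral>x. norm (as k x - f x) \<partial>gauss) \<le> 1 / real (Suc k)) sequentially"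
      using d by (intro always_eventually allI) (simp add: norm_minus_commute less_imp_le del: of_nat_Suc)
  qed auto
  then have "L1_conv as f" by (subst L1_conv_iff) (auto intro: f is_poly_integrable p)
  then show ?thesis using p that by blast
qed

lemma Lp_space_1_iff: "f \<in> Lp_space 1 \<longleftrightarrow> integrable gauss f"
  by (auto simp: Lp_space_def borel_measurable_gauss integrable_norm_iff)

text \<open>\<open>mehler a b \<phi> \<psi>\<close> has the defining property, so the choice
  operator returns a function with it as well. Along one pair of polynomial sequences both are L^1
  limits of the same functions, hence equal almost everywhere.\<close>

lemma wick_sq_AE:
  fixes \<phi> \<psi> :: "real^'n \<Rightarrow> complex"
  assumes ab: "a\<^sup>2 + b\<^sup>2 = 1" "a \<noteq> 0" and \<phi>: "integrable gauss \<phi>" and \<psi>: "integrable gauss \<psi>"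
  shows "integrable gauss (wick_sq a b \<phi> \<psi>)" "AE x in gauss. wick_sq a b \<phi> \<psi> x = mehler a b \<phi> \<psi> x"
proof -
  define P where "P g \<longleftrightarrow> g \<in> Lp_space 1 \<and>
     (\<forall>as bs. (\<forall>k. is_poly (as k) \<and> is_poly (bs k)) \<and> L1_conv as \<phi> \<and> L1_conv bs \<psi>
        \<longrightarrow> L1_conv (\<lambda>k. wick (sq_poly a (as k)) (sq_poly b (bs k))) g)" for g
  have im: "integrable gauss (mehler a b \<phi> \<psi>)" by (rule mehler_L1(1)[OF ab \<phi> \<psi>])
  have "P (mehler a b \<phi> \<psi>)"
    unfolding P_def Lp_space_1_iff
    using im by (auto simp: wick_sq_poly_eq_mehler[OF ab] intro!: L1_conv_mehler[OF ab _ _ \<phi> \<psi>] is_poly_integrable)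
  moreover have "wick_sq a b \<phi> \<psi> = (SOME g. P g)"
    unfolding wick_sq_def ext2_def P_def ..
  ultimately have P: "P (wick_sq a b \<phi> \<psi>)" by (simp only: someI)
  then show iw: "integrable gauss (wick_sq a b \<phi> \<psi>)" by (simp add: P_def Lp_space_1_iff)
  obtain as where as: "\<And>k. is_poly (as k)" "L1_conv as \<phi>" using poly_L1_sequence[OF \<phi>] by blast
  obtain bs where bs: "\<And>k. is_poly (bs k)" "L1_conv bs \<psi>" using poly_L1_sequence[OF \<psi>] by blast
  have "L1_conv (\<lambda>k. mehler a b (as k) (bs k)) (wick_sq a b \<phi> \<psi>)"
    using P as bs unfolding P_def by (auto simp: wick_sq_poly_eq_mehler[OF ab])
  moreover have "L1_conv (\<lambda>k. mehler a b (as k) (bs k)) (mehler a b \<phi> \<psi>)"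
    by (intro L1_conv_mehler ab is_poly_integrable as bs \<phi> \<psi>)
  ultimately show "AE x in gauss. wick_sq a b \<phi> \<psi> x = mehler a b \<phi> \<psi> x"
    by (intro L1_conv_unique[OF _ iw im]) (auto intro: mehler_L1(1)[OF ab] is_poly_integrable as bs)
qed

lemma sq_AE:
  fixes \<phi> :: "real^'n \<Rightarrow> complex"
  assumes ab: "a\<^sup>2 + b\<^sup>2 = 1" "a \<noteq> 0" and \<phi>: "integrable gauss \<phi>"
  shows "integrable gauss (sq a \<phi>)" "AE x in gauss. sq a \<phi> x = mehler a b \<phi> (\<lambda>_. 1) x"
proof -
  define P where "P g \<longleftrightarrow> g \<in> Lp_space 1 \<and>
     (\<forall>as. (\<forall>k. is_poly (as k)) \<and> L1_conv as \<phi> \<longrightarrow> L1_conv (\<lambda>k. sq_poly a (as k)) g)" for g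
  have one: "integrable gauss (\<lambda>_::real^'n. 1::complex)" by simp
  have lone: "L1_conv (\<lambda>_ _. 1) (\<lambda>_::real^'n. 1)" by (simp add: L1_conv_def)
  have im: "integrable gauss (mehler a b \<phi> (\<lambda>_. 1))" by (rule mehler_L1(1)[OF ab \<phi> one])
  have lim: "L1_conv (\<lambda>k. sq_poly a (as k)) (mehler a b \<phi> (\<lambda>_. 1))"
    if "\<And>k. is_poly (as k)" "L1_conv as \<phi>" for as
    using L1_conv_mehler[OF ab _ one \<phi> one that(2) lone] that(1)
    by (simp add: sq_poly_eq_mehler[OF ab] is_poly_integrable)
  have "P (mehler a b \<phi> (\<lambda>_. 1))"
    unfolding P_def Lp_space_1_iff using im lim by auto
  moreover have "sq a \<phi> = (SOME g. P g)"
    unfolding sq_def ext1_def P_def ..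
  ultimately have P: "P (sq a \<phi>)" by (simp only: someI)
  then show iw: "integrable gauss (sq a \<phi>)" by (simp add: P_def Lp_space_1_iff)
  obtain as where as: "\<And>k. is_poly (as k)" "L1_conv as \<phi>" using poly_L1_sequence[OF \<phi>] by blast
  have "L1_conv (\<lambda>k. sq_poly a (as k)) (sq a \<phi>)"
    using P as unfolding P_def by auto
  then show "AE x in gauss. sq a \<phi> x = mehler a b \<phi> (\<lambda>_. 1) x"
    by (intro L1_conv_unique[OF _ iw im _ lim[OF as]]) (auto intro: is_poly_integrable is_poly_sq_poly as)
qed

lemma Lp_norm_cong_AE:
  fixes f g :: "real^'n \<Rightarrow> complex"
  assumes "f \<in> borel_measurable borel" "g \<in> borel_measurable borel" "AE x in gauss. f x = g x"
  shows "Lp_norm r f = Lp_norm r g" "f \<in> Lp_space r \<longleftrightarrow> g \<in> Lp_space r"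
proof -
  note [measurable] = assms(1,2)
  have ae: "AE x in gauss. cmod (f x) powr r = cmod (g x) powr r"
    using assms(3) by eventually_elim simp
  have "(\<integral>x. cmod (f x) powr r \<partial>gauss) = (\<integral>x. cmod (g x) powr r \<partial>gauss)"
    by (rule integral_cong_AE[OF _ _ ae]) measurable
  then show "Lp_norm r f = Lp_norm r g" by (simp add: Lp_norm_def)
  have "integrable gauss (\<lambda>x. cmod (f x) powr r) = integrable gauss (\<lambda>x. cmod (g x) powr r)"
    by (rule integrable_cong_AE[OF _ _ ae]) measurable
  then show "f \<in> Lp_space r \<longleftrightarrow> g \<in> Lp_space r"
    using assms(1,2) by (simp add: Lp_space_def borel_measurable_gauss)
qed

text \<open>K is any almost sure bound on |\<psi>|, so that the essential supremum and the case
  \<psi> = 1 with K = 1 are both covered. Taking absolute values inside the integral leaves K times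
  \<open>ou a\<close> of |\<phi>|.\<close>

lemma mehler_hypercontractive:
  fixes \<phi> \<psi> :: "real^'n \<Rightarrow> complex"
  assumes p: "1 < p" "p \<le> r" and a: "a = sqrt (p - 1) / sqrt (r - 1)" and b: "b = sqrt (r - p) / sqrt (r - 1)"
    and \<phi>: "\<phi> \<in> Lp_space p" and \<psi>m [measurable]: "\<psi> \<in> borel_measurable borel"
    and \<psi>: "AE x in gauss. cmod (\<psi> x) \<le> K" and K: "0 \<le> K"
  shows "mehler a b \<phi> \<psi> \<in> Lp_space r" "Lp_norm r (mehler a b \<phi> \<psi>) \<le> Lp_norm p \<phi> * K"
proof -
  have ab: "a\<^sup>2 + b\<^sup>2 = 1" "a \<noteq> 0"
    using p by (auto simp: a b power_divide add_divide_distrib[symmetric])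
  have b0: "0 \<le> b" using p by (simp add: b)
  have "b\<^sup>2 = 1 - a\<^sup>2" using ab(1) by linarith
  \<comment> \<open>\<open>ou\<close> is written with sqrt (1 - a^2), which equals b because b is
    nonnegative.\<close>
  then have bs: "b = sqrt (1 - a\<^sup>2)" using b0 real_sqrt_unique by metis
  have a01: "0 \<le> a" "a \<le> 1" using p by (auto simp: a)
  have \<phi>m [measurable]: "\<phi> \<in> borel_measurable borel" and ip: "integrable gauss (\<lambda>x. cmod (\<phi> x) powr p)"
    using \<phi> by (auto simp: Lp_space_def borel_measurable_gauss)
  have in\<phi>: "integrable gauss (\<lambda>x. cmod (\<phi> x))"
    by (rule integrable_of_powr[OF _ _ _ ip]) (use p in auto)
  define U where "U = ou a (\<lambda>x. cmod (\<phi> x))"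
  have U0: "0 \<le> U x" for x unfolding U_def ou_def by (intro integral_nonneg_AE) auto
  have [measurable]: "U \<in> borel_measurable borel" unfolding U_def by measurable
  have hyp: "integrable gauss (\<lambda>x. U x powr r)"
    "(\<integral>x. U x powr r \<partial>gauss) \<le> (\<integral>x. cmod (\<phi> x) powr p \<partial>gauss) powr (r / p)"
    unfolding U_def by (rule ou_hypercontractive[OF p a _ _ ip]; simp)+
  have AE\<phi>: "AE x in gauss. integrable gauss (\<lambda>y. cmod (\<phi> (a *\<^sub>R x + b *\<^sub>R y)))"
    using gauss2.AE_integrable_fst'[OF gauss_integral_rotated(1)[OF _ in\<phi> a01]] by (simp add: bs)
  \<comment> \<open>The bound on \<psi> is transported by the rotation: the exceptional set is null
    in the second coordinate, hence null among pairs, its rotated copy is null too, and so is almost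
    every section of that copy.\<close>
  have "AE z in gauss \<Otimes>\<^sub>M gauss. cmod (\<psi> (snd (z :: (real^'n) \<times> (real^'n)))) \<le> K"
  proof (rule gauss2.AE_pair_measure)
    show "{z \<in> space (gauss \<Otimes>\<^sub>M gauss). cmod (\<psi> (snd (z :: (real^'n) \<times> (real^'n)))) \<le> K} \<in> sets (gauss \<Otimes>\<^sub>M gauss)"
      by measurable
    show "AE x in gauss. AE y in gauss. cmod (\<psi> (snd (x :: real^'n, y))) \<le> K" using \<psi> by simp
  qed
  from gauss2.AE_pair[OF AE_gauss_rotate[OF ab this]]
  have AE\<psi>: "AE x in gauss. AE y in gauss. cmod (\<psi> (b *\<^sub>R x - a *\<^sub>R y)) \<le> K" by simp
  have le: "AE x in gauss. cmod (mehler a b \<phi> \<psi> x) \<le> K * U x"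
    using AE\<phi> AE\<psi>
  proof eventually_elim
    case (elim x)
    have "cmod (mehler a b \<phi> \<psi> x) \<le> (\<integral>y. cmod (\<phi> (a *\<^sub>R x + b *\<^sub>R y) * \<psi> (b *\<^sub>R x - a *\<^sub>R y)) \<partial>gauss)"
      unfolding mehler_def by (rule integral_norm_bound)
    also have "\<dots> \<le> (\<integral>y. K * cmod (\<phi> (a *\<^sub>R x + b *\<^sub>R y)) \<partial>gauss)"
    proof (rule integral_mono_AE')
      show "integrable gauss (\<lambda>y. K * cmod (\<phi> (a *\<^sub>R x + b *\<^sub>R y)))" using elim(1) by simp
      show "AE y in gauss. cmod (\<phi> (a *\<^sub>R x + b *\<^sub>R y) * \<psi> (b *\<^sub>R x - a *\<^sub>R y)) \<le> K * cmod (\<phi> (a *\<^sub>R x + b *\<^sub>R y))"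
        using elim(2) by eventually_elim (simp add: norm_mult mult.commute[of K] mult_left_mono)
    qed (use K in auto)
    also have "\<dots> = K * U x" by (simp add: U_def ou_def bs)
    finally show ?case .
  qed
  have leK: "AE x in gauss. cmod (mehler a b \<phi> \<psi> x) powr r \<le> K powr r * U x powr r"
    using le
  proof eventually_elim
    case (elim x)
    have "cmod (mehler a b \<phi> \<psi> x) powr r \<le> (K * U x) powr r" using elim p by (intro powr_mono2) auto
    then show ?case using K U0[of x] by (simp add: powr_mult)
  qed
  have im: "integrable gauss (\<lambda>x. cmod (mehler a b \<phi> \<psi> x) powr r)"
  proof (rule Bochner_Integration.integrable_bound)
    show "integrable gauss (\<lambda>x. K powr r * U x powr r)" using hyp(1) by simp
    show "AE x in gauss. norm (cmod (mehler a b \<phi> \<psi> x) powr r) \<le> norm (K powr r * U x powr r)"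
      using leK by eventually_elim simp
  qed measurable
  then show "mehler a b \<phi> \<psi> \<in> Lp_space r"
    by (simp add: Lp_space_def borel_measurable_gauss)
  define I where "I = (\<integral>x. cmod (\<phi> x) powr p \<partial>gauss)"
  have I0: "0 \<le> I" by (simp add: I_def)
  have "(\<integral>x. cmod (mehler a b \<phi> \<psi> x) powr r \<partial>gauss) \<le> (\<integral>x. K powr r * U x powr r \<partial>gauss)"
    using hyp(1) im leK by (intro integral_mono_AE) auto
  also have "\<dots> \<le> K powr r * I powr (r / p)"
    using hyp by (simp add: mult_left_mono I_def)
  finally have "Lp_norm r (mehler a b \<phi> \<psi>) \<le> (K powr r * I powr (r / p)) powr (1 / r)"
    unfolding Lp_norm_def using p by (intro powr_mono2) auto
  also have "\<dots> = K * I powr (1 / p)"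
    using K I0 p by (simp add: powr_mult powr_powr)
  finally show "Lp_norm r (mehler a b \<phi> \<psi>) \<le> Lp_norm p \<phi> * K"
    by (simp add: Lp_norm_def I_def mult.commute)
qed

text \<open>On a probability space the essential supremum of a nonnegative function cannot be
  negative, and membership in \<open>Linf_space\<close> makes it finite, so
  \<open>real_of_ereal\<close> returns its true value instead of a default.\<close>

lemma Linf_norm_bound:
  fixes \<psi> :: "real^'n \<Rightarrow> complex"
  assumes "\<psi> \<in> Linf_space"
  shows "0 \<le> Linf_norm \<psi>" "AE x in gauss. cmod (\<psi> x) \<le> Linf_norm \<psi>"
proof -
  let ?e = "esssup gauss (\<lambda>x. ereal (cmod (\<psi> x)))"
  have fin: "?e < \<infinity>" using assms by (simp add: Linf_space_def)
  have AE: "AE x in gauss. ereal (cmod (\<psi> x)) \<le> ?e" by (rule esssup_AE)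
  have nn: "0 \<le> ?e"
  proof (rule ccontr)
    assume "\<not> 0 \<le> ?e"
    then have neg: "?e < 0" by simp
    have "AE x in (gauss :: (real^'n) measure). False"
      using AE
    proof eventually_elim
      case (elim x)
      have "0 \<le> ereal (cmod (\<psi> x))" by simp
      then show ?case using elim neg by (meson not_less order_trans)
    qed
    then show False by simp
  qed
  have eq: "ereal (Linf_norm \<psi>) = ?e"
    using fin nn by (auto simp: Linf_norm_def ereal_real)
  show "0 \<le> Linf_norm \<psi>" using nn unfolding eq[symmetric] by simp
  show "AE x in gauss. cmod (\<psi> x) \<le> Linf_norm \<psi>" using AE unfolding eq[symmetric] by simp
qed

theorem theorem4p4:
  fixes p r :: real and \<phi> \<psi> :: "real^'n \<Rightarrow> complex"
  assumes "1 < p" and "p \<le> r"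
    and "\<phi> \<in> Lp_space p" and "\<psi> \<in> Linf_space"
  shows "wick_sq (sqrt (p - 1) / sqrt (r - 1)) (sqrt (r - p) / sqrt (r - 1)) \<phi> \<psi> \<in> Lp_space r
    \<and> Lp_norm r (wick_sq (sqrt (p - 1) / sqrt (r - 1)) (sqrt (r - p) / sqrt (r - 1)) \<phi> \<psi>)
        \<le> Lp_norm p \<phi> * Linf_norm \<psi>
    \<and> Lp_norm r (sq (sqrt (p - 1) / sqrt (r - 1)) \<phi>) \<le> Lp_norm p \<phi>"
proof -
  define a b where "a = sqrt (p - 1) / sqrt (r - 1)" and "b = sqrt (r - p) / sqrt (r - 1)"
  have ab: "a\<^sup>2 + b\<^sup>2 = 1" "a \<noteq> 0"
    using assms(1,2) by (auto simp: a_def b_def power_divide add_divide_distrib[symmetric])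
  have \<phi>m [measurable]: "\<phi> \<in> borel_measurable borel" and ip: "integrable gauss (\<lambda>x. cmod (\<phi> x) powr p)"
    using assms(3) by (auto simp: Lp_space_def borel_measurable_gauss)
  \<comment> \<open>The measure is finite, so both functions lie in L^1, where the extended
    operators are identified with \<open>mehler\<close>.\<close>
  have "integrable gauss (\<lambda>x. cmod (\<phi> x))"
    by (rule integrable_of_powr[OF _ _ _ ip]) (use assms(1) in auto)
  then have \<phi>: "integrable gauss \<phi>" by (subst (asm) integrable_norm_iff) auto
  have \<psi>m [measurable]: "\<psi> \<in> borel_measurable borel"
    using assms(4) by (simp add: Linf_space_def borel_measurable_gauss)
  note K = Linf_norm_bound[OF assms(4)]
  have \<psi>: "integrable gauss \<psi>"
    by (rule gauss.integrable_const_bound[OF K(2)]) measurable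
  note w = wick_sq_AE[OF ab \<phi> \<psi>] and s = sq_AE[OF ab \<phi>]
  have wm: "wick_sq a b \<phi> \<psi> \<in> borel_measurable borel" "sq a \<phi> \<in> borel_measurable borel"
    using borel_measurable_integrable[OF w(1)] borel_measurable_integrable[OF s(1)] by (simp_all add: borel_measurable_gauss)
  note H = mehler_hypercontractive[OF assms(1,2) a_def b_def assms(3)]
  have "wick_sq a b \<phi> \<psi> \<in> Lp_space r" "Lp_norm r (wick_sq a b \<phi> \<psi>) \<le> Lp_norm p \<phi> * Linf_norm \<psi>"
    using Lp_norm_cong_AE[OF wm(1) _ w(2), of r] H[OF \<psi>m K(2,1)] by simp_all
  \<comment> \<open>The representation of \<open>sq\<close> with second function 1 makes this the
    case \<psi> = 1, K = 1 of the same bound.\<close>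
  moreover have "Lp_norm r (sq a \<phi>) \<le> Lp_norm p \<phi>"
    using Lp_norm_cong_AE(1)[OF wm(2) _ s(2), of r] H(2)[of "\<lambda>_. 1" 1] by simp
  ultimately show ?thesis unfolding a_def b_def by blast
qed

end
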